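(* (i) Suppose that for all universe levels $a$ there is a function $[]\text{-}cong:\{@0\ A:\mathsf{Type}\,a\}\,\{@0\ x\ y:A\}\to @0\ \mathsf{Id}\,A\,x\,y\to\mathsf{Id}\,(\mathsf{Erased}\,A)\,[x]\,[y]$ for which $[]\text{-}cong\ \mathsf{refl}$ is definitionally equal to $\mathsf{refl}$. Then there is a function $$\mathsf{Vec^F\text{-}elim'}:\{@0\ A:\mathsf{Type}\,a\}\,\big(P:\{@0\ n:\mathbb N\}\to\mathsf{Vec^F}\,A\,n\to\mathsf{Type}\,p\big)\to P\,\langle\rangle\to\big(\{@0\ n:\mathbb N\}\,(x:A)\,(xs:\mathsf{Vec^F}\,A\,n)\to P\,xs\to P\,(x::xs)\big)\to\{@0\ n:\mathbb N\}\,(xs:\mathsf{Vec^F}\,A\,n)\to P\,xs$$ such that $\mathsf{Vec^F\text{-}elim'}\,P\,n\,c\,\langle\rangle$ is definitionally equal to $n$, and $\mathsf{Vec^F\text{-}elim'}\,P\,n\,c\,(x::xs)$ is definitionally equal to $c\,x\,xs\,(\mathsf{Vec^F\text{-}elim'}\,P\,n\,c\,xs)$. (ii) Conversely, from a function $\mathsf{Vec^F\text{-}elim'}$ of type $$\{@0\ A:\mathsf{Type}\,a\}\,\big(P:\{@0\ n:\mathbb N\}\to\mathsf{Vec^F}\,A\,n\to\mathsf{Type}\,p\big)\to P\,\langle\rangle\to\big(\{@0\ n:\mathbb N\}\,(x:A)\,(xs:\mathsf{Vec^F}\,A\,n)\to P\,xs\to P\,(x::xs)\big)\to\{@0\ n:\mathbb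 N\}\,(xs:\mathsf{Vec^F}\,A\,n)\to P\,xs$$ (for all universe levels $a$ and $p$) one can define a function $$[]\text{-}cong_0:\{@0\ n:\mathbb N\}\to @0\ \mathsf{Id}\,\mathbb N\,\mathsf{zero}\,n\to\mathsf{Id}\,(\mathsf{Erased}\,\mathbb N)\,[\mathsf{zero}]\,[n].$$
   Context: The setting is Agda with erasure annotations and no erased matches for identity types assumed. $\mathsf{Type}\,a$ is the universe of types at level $a$. An argument marked $@0$ is erased: it may only be used in erased contexts (type signatures, erased arguments, bodies of erased definitions). $\{\ldots\}$ marks implicit arguments. $\mathsf{Id}\,A\,x\,y$ is the identity type with constructor $\mathsf{refl}:\mathsf{Id}\,A\,x\,x$ and the usual J eliminator (computing definitionally on $\mathsf{refl}$, with a non-erased proof argument). $\mathsf{Erased}\,(@0\ A:\mathsf{Type}\,a):\mathsf{Type}\,a$ is the data type with the single constructor $[\_]:@0\ A\to\mathsf{Erased}\,A$; it has the erased projection $@0\ \mathsf{erased}:\mathsf{Erased}\,A\to A$, $\mathsf{erased}\,[x]=x$. $\mathsf{Vec^F}\,(A:\mathsf{Type}\,a)\,(@0\ n:\mathbb N):\mathsf{Type}\,a$ is the (non-indexed) data type of vectors, "forded" with erased identity proofs, with constructors $\mathsf{nil}:@0\ \mathsf{Id}\,\mathbb N\,\mathsf{zero}\,n\to\mathsf{Vec^F}\,A\,n$ and $\mathsf{cons}:\{@0\ m:\mathbb N\}\to A\to\mathsf{Vec^F}\,A\,m\to @0\ \mathsf{Id}\,\mathbb N\,(\mathsf{suc}\,m)\,n\to\mathsf{Vec^F}\,A\,n$,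 and its standard dependent eliminator (into an erased motive $P:\{n:\mathbb N\}\to\mathsf{Vec^F}\,A\,n\to\mathsf{Type}\,p$, where the case functions receive the numbers and identity proofs as erased arguments). Derived constructors: $\langle\rangle:\mathsf{Vec^F}\,A\,\mathsf{zero}$, $\langle\rangle=\mathsf{nil}\ \mathsf{refl}$ (the empty vector), and $x::xs=\mathsf{cons}\,x\,xs\,\mathsf{refl}:\mathsf{Vec^F}\,A\,(\mathsf{suc}\,n)$ for $x:A$, $xs:\mathsf{Vec^F}\,A\,n$ (with $A$ and $n$ erased). *)

theory Defs
  imports Main
begin

section \<open>Universe levels\<close>

text \<open>
  Level expressions may contain level variables and are identified when they agree under all
  assignments of natural numbers to the variables.  A family indexed by all levels is therefore
  a (prenex) level-polymorphic definition: its generic member is the one at a level variable.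
\<close>

datatype level_exp = LVar nat | LZero | LSuc level_exp | LMax level_exp level_exp

primrec level_val :: "(nat \<Rightarrow> nat) \<Rightarrow> level_exp \<Rightarrow> nat" where
  "level_val \<rho> (LVar i) = \<rho> i"
| "level_val \<rho> LZero = 0"
| "level_val \<rho> (LSuc l) = Suc (level_val \<rho> l)"
| "level_val \<rho> (LMax l l') = max (level_val \<rho> l) (level_val \<rho> l')"

quotient_type level = level_exp / "\<lambda>l l'. \<forall>\<rho>. level_val \<rho> l = level_val \<rho> l'"
  by (auto intro!: equivpI reflpI sympI transpI)

lift_definition lvar :: "nat \<Rightarrow> level" is LVar .
lift_definition lzero :: level is LZero .
lift_definition lsuc :: "level \<Rightarrow> level" is LSuc by simp
lift_definition lmax :: "level \<Rightarrow> level \<Rightarrow> level" is LMax by simp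


section \<open>Syntax\<close>

text \<open>
  \<open>Eras\<close> is the annotation \<open>@0\<close>; \<open>Run\<close> is the absence of an annotation.  The same two
  values serve as the mode of a typing judgement: \<open>Eras\<close> means that a term is checked in an
  erased context.
\<close>

datatype usage = Eras | Run

text \<open>
  The constants are the type formers, constructors and eliminators of the data
  types; all of them are curried functions, and implicit arguments are passed
  like explicit ones.  \<open>Proj\<close> is the erased projection.  The names \<open>Ext k\<close> are not part of the basic theory, see below.
\<close>

datatype 'k const =
    Nat | Zero | Succ | NatElim level
  | Id level | Refl level | J level level
  | Erased level | Box level | Proj level | ErasedElim level level
  | Vec level | VNil level | VCons level | VecElim level level
  | Ext 'k

text \<open>De Bruijn indices; application and abstraction carry the annotation of the argument.\<close>

datatype 'k tm =
    Var nat
  | Const "'k const"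
  | Univ level
  | Pi usage "'k tm" "'k tm"
  | Lam usage "'k tm"
  | App usage "'k tm" "'k tm"

definition up_ren :: "(nat \<Rightarrow> nat) \<Rightarrow> nat \<Rightarrow> nat" where
  "up_ren \<xi> = case_nat 0 (\<lambda>i. Suc (\<xi> i))"

primrec ren :: "(nat \<Rightarrow> nat) \<Rightarrow> 'k tm \<Rightarrow> 'k tm" where
  "ren \<xi> (Var i) = Var (\<xi> i)"
| "ren \<xi> (Const c) = Const c"
| "ren \<xi> (Univ l) = Univ l"
| "ren \<xi> (Pi \<rho> A B) = Pi \<rho> (ren \<xi> A) (ren (up_ren \<xi>) B)"
| "ren \<xi> (Lam \<rho> t) = Lam \<rho> (ren (up_ren \<xi>) t)"
| "ren \<xi> (App \<rho> t u) = App \<rho> (ren \<xi> t) (ren \<xi> u)"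

definition wk :: "nat \<Rightarrow> 'k tm \<Rightarrow> 'k tm" where
  "wk n = ren (\<lambda>i. i + n)"

definition up_sub :: "(nat \<Rightarrow> 'k tm) \<Rightarrow> nat \<Rightarrow> 'k tm" where
  "up_sub \<sigma> = case_nat (Var 0) (\<lambda>i. wk 1 (\<sigma> i))"

primrec sub :: "(nat \<Rightarrow> 'k tm) \<Rightarrow> 'k tm \<Rightarrow> 'k tm" where
  "sub \<sigma> (Var i) = \<sigma> i"
| "sub \<sigma> (Const c) = Const c"
| "sub \<sigma> (Univ l) = Univ l"
| "sub \<sigma> (Pi \<rho> A B) = Pi \<rho> (sub \<sigma> A) (sub (up_sub \<sigma>) B)"
| "sub \<sigma> (Lam \<rho> t) = Lam \<rho> (sub (up_sub \<sigma>) t)"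
| "sub \<sigma> (App \<rho> t u) = App \<rho> (sub \<sigma> t) (sub \<sigma> u)"

definition inst :: "'k tm \<Rightarrow> 'k tm \<Rightarrow> 'k tm" where
  "inst t u = sub (case_nat u Var) t"


section \<open>Named notation for terms\<close>

text \<open>
  To be able to write terms with named variables, a term is presented as a function that
  takes the number of enclosing binders and returns the de Bruijn term.  The variable bound
  when there are \<open>n\<close> enclosing binders is \<open>\<lambda>m. Var (m - Suc n)\<close>: its index at depth \<open>m\<close>.
  A closed term is read off at depth \<open>0\<close>.
\<close>

type_synonym 'k nterm = "nat \<Rightarrow> 'k tm"

definition pi :: "usage \<Rightarrow> 'k nterm \<Rightarrow> ('k nterm \<Rightarrow> 'k nterm) \<Rightarrow> 'k nterm" where
  "pi \<rho> A B = (\<lambda>n. Pi \<rho> (A n) (B (\<lambda>m. Var (m - Suc n)) (Suc n)))"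

syntax
  "_pi_run" :: "pttrn \<Rightarrow> 'a \<Rightarrow> 'a \<Rightarrow> 'a"  ("(3\<Pi> _ : _./ _)" [0, 0, 10] 10)
  "_pi_eras" :: "pttrn \<Rightarrow> 'a \<Rightarrow> 'a \<Rightarrow> 'a"  ("(3\<Pi>\<^sub>0 _ : _./ _)" [0, 0, 10] 10)
translations
  "\<Pi> x : A. B" \<rightleftharpoons> "CONST pi (CONST Run) A (\<lambda>x. B)"
  "\<Pi>\<^sub>0 x : A. B" \<rightleftharpoons> "CONST pi (CONST Eras) A (\<lambda>x. B)"

definition app_run :: "'k nterm \<Rightarrow> 'k nterm \<Rightarrow> 'k nterm"  (infixl "\<bullet>" 200) where
  "t \<bullet> u = (\<lambda>n. App Run (t n) (u n))"

definition app_eras :: "'k nterm \<Rightarrow> 'k nterm \<Rightarrow> 'k nterm"  (infixl "\<bullet>\<^sub>0" 200) where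
  "t \<bullet>\<^sub>0 u = (\<lambda>n. App Eras (t n) (u n))"

definition con :: "'k const \<Rightarrow> 'k nterm" where
  "con c = (\<lambda>_. Const c)"

definition univ_t :: "level \<Rightarrow> 'k nterm" where
  "univ_t l = (\<lambda>_. Univ l)"

text \<open>A term of the empty context, weakened to whatever context it is used in.\<close>

definition closed :: "'k tm \<Rightarrow> 'k nterm" where
  "closed t = (\<lambda>n. wk n t)"

definition nat_t :: "'k nterm" where
  "nat_t = con Nat"

definition zero_t :: "'k nterm" where
  "zero_t = con Zero"

definition suc_t :: "'k nterm \<Rightarrow> 'k nterm" where
  "suc_t n = con Succ \<bullet> n"

definition id_t :: "level \<Rightarrow> 'k nterm \<Rightarrow> 'k nterm \<Rightarrow> 'k nterm \<Rightarrow> 'k nterm" where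
  "id_t a A x y = con (Id a) \<bullet> A \<bullet> x \<bullet> y"

definition refl_t :: "level \<Rightarrow> 'k nterm \<Rightarrow> 'k nterm \<Rightarrow> 'k nterm" where
  "refl_t a A x = con (Refl a) \<bullet>\<^sub>0 A \<bullet>\<^sub>0 x"

definition erased_t :: "level \<Rightarrow> 'k nterm \<Rightarrow> 'k nterm" where
  "erased_t a A = con (Erased a) \<bullet>\<^sub>0 A"

definition box_t :: "level \<Rightarrow> 'k nterm \<Rightarrow> 'k nterm \<Rightarrow> 'k nterm" where
  "box_t a A x = con (Box a) \<bullet>\<^sub>0 A \<bullet>\<^sub>0 x"

definition vec_t :: "level \<Rightarrow> 'k nterm \<Rightarrow> 'k nterm \<Rightarrow> 'k nterm" where
  "vec_t a A n = con (Vec a) \<bullet> A \<bullet>\<^sub>0 n"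

definition nil_t :: "level \<Rightarrow> 'k nterm \<Rightarrow> 'k nterm \<Rightarrow> 'k nterm \<Rightarrow> 'k nterm" where
  "nil_t a A n e = con (VNil a) \<bullet>\<^sub>0 A \<bullet>\<^sub>0 n \<bullet>\<^sub>0 e"

definition cons_t ::
  "level \<Rightarrow> 'k nterm \<Rightarrow> 'k nterm \<Rightarrow> 'k nterm \<Rightarrow> 'k nterm \<Rightarrow> 'k nterm \<Rightarrow> 'k nterm \<Rightarrow> 'k nterm"
where
  "cons_t a A n m x xs e = con (VCons a) \<bullet>\<^sub>0 A \<bullet>\<^sub>0 n \<bullet>\<^sub>0 m \<bullet> x \<bullet> xs \<bullet>\<^sub>0 e"

text \<open>The derived constructors \<open>\<langle>\<rangle>\<close> and \<open>x :: xs\<close>.\<close>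

definition empty_t :: "level \<Rightarrow> 'k nterm \<Rightarrow> 'k nterm" where
  "empty_t a A = nil_t a A zero_t (refl_t lzero nat_t zero_t)"

definition push_t ::
  "level \<Rightarrow> 'k nterm \<Rightarrow> 'k nterm \<Rightarrow> 'k nterm \<Rightarrow> 'k nterm \<Rightarrow> 'k nterm" where
  "push_t a A n x xs = cons_t a A (suc_t n) n x xs (refl_t lzero nat_t (suc_t n))"


section \<open>The types of the constants\<close>

text \<open>
  The theory is open-ended: an extension adds further constants (other definitions, data types
  or assumptions; \<open>Eras\<close> marks constants that are only available in erased contexts) and further
  definitional equalities.  A function that is merely assumed to exist, together with an assumed
  computation rule, is given by such an extension.
\<close>

record 'k extension =
  ext_const :: "'k \<Rightarrow> (usage \<times> 'k tm) option"
  ext_eq :: "('k tm \<times> 'k tm \<times> 'k tm) set"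

primrec const_type :: "'k extension \<Rightarrow> 'k const \<Rightarrow> (usage \<times> 'k tm) option" where
  "const_type S Nat = Some (Run, univ_t lzero 0)"
| "const_type S Zero = Some (Run, nat_t 0)"
| "const_type S Succ = Some (Run, (\<Pi> n : nat_t. nat_t) 0)"
| "const_type S (NatElim p) = Some (Run,
    (\<Pi>\<^sub>0 P : (\<Pi> n : nat_t. univ_t p).
     \<Pi> z : P \<bullet> zero_t.
     \<Pi> s : (\<Pi> n : nat_t. \<Pi> ih : P \<bullet> n. P \<bullet> suc_t n).
     \<Pi> n : nat_t. P \<bullet> n) 0)"
| "const_type S (Id a) = Some (Run, (\<Pi> A : univ_t a. \<Pi> x : A. \<Pi> y : A. univ_t a) 0)"
| "const_type S (Refl a) = Some (Run, (\<Pi>\<^sub>0 A : univ_t a. \<Pi>\<^sub>0 x : A. id_t a A x x) 0)"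
| "const_type S (J a p) = Some (Run,
    (\<Pi>\<^sub>0 A : univ_t a. \<Pi>\<^sub>0 x : A.
     \<Pi>\<^sub>0 P : (\<Pi> y : A. \<Pi> e : id_t a A x y. univ_t p).
     \<Pi> r : P \<bullet> x \<bullet> refl_t a A x.
     \<Pi>\<^sub>0 y : A. \<Pi> e : id_t a A x y. P \<bullet> y \<bullet> e) 0)"
| "const_type S (Erased a) = Some (Run, (\<Pi>\<^sub>0 A : univ_t a. univ_t a) 0)"
| "const_type S (Box a) = Some (Run, (\<Pi>\<^sub>0 A : univ_t a. \<Pi>\<^sub>0 x : A. erased_t a A) 0)"
| "const_type S (Proj a) = Some (Eras, (\<Pi>\<^sub>0 A : univ_t a. \<Pi> x : erased_t a A. A) 0)"
| "const_type S (ErasedElim a p) = Some (Run,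
    (\<Pi>\<^sub>0 A : univ_t a.
     \<Pi>\<^sub>0 P : (\<Pi> x : erased_t a A. univ_t p).
     \<Pi> b : (\<Pi>\<^sub>0 x : A. P \<bullet> box_t a A x).
     \<Pi> x : erased_t a A. P \<bullet> x) 0)"
| "const_type S (Vec a) = Some (Run, (\<Pi> A : univ_t a. \<Pi>\<^sub>0 n : nat_t. univ_t a) 0)"
| "const_type S (VNil a) = Some (Run,
    (\<Pi>\<^sub>0 A : univ_t a. \<Pi>\<^sub>0 n : nat_t. \<Pi>\<^sub>0 e : id_t lzero nat_t zero_t n. vec_t a A n) 0)"
| "const_type S (VCons a) = Some (Run,
    (\<Pi>\<^sub>0 A : univ_t a. \<Pi>\<^sub>0 n : nat_t. \<Pi>\<^sub>0 m : nat_t.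
     \<Pi> x : A. \<Pi> xs : vec_t a A m. \<Pi>\<^sub>0 e : id_t lzero nat_t (suc_t m) n. vec_t a A n) 0)"
| "const_type S (VecElim a p) = Some (Run,
    (\<Pi>\<^sub>0 A : univ_t a.
     \<Pi>\<^sub>0 P : (\<Pi> n : nat_t. \<Pi> xs : vec_t a A n. univ_t p).
     \<Pi> z : (\<Pi>\<^sub>0 n : nat_t. \<Pi>\<^sub>0 e : id_t lzero nat_t zero_t n. P \<bullet> n \<bullet> nil_t a A n e).
     \<Pi> c : (\<Pi>\<^sub>0 n : nat_t. \<Pi>\<^sub>0 m : nat_t. \<Pi> x : A. \<Pi> xs : vec_t a A m.
            \<Pi>\<^sub>0 e : id_t lzero nat_t (suc_t m) n.
            \<Pi> ih : P \<bullet> m \<bullet> xs. P \<bullet> n \<bullet> cons_t a A n m x xs e).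
     \<Pi>\<^sub>0 n : nat_t. \<Pi> xs : vec_t a A n. P \<bullet> n \<bullet> xs) 0)"
| "const_type S (Ext k) = ext_const S k"


section \<open>Computation rules of the eliminators\<close>

abbreviation (input) ap_run :: "'k tm \<Rightarrow> 'k tm \<Rightarrow> 'k tm"  (infixl "\<cdot>" 200) where
  "t \<cdot> u \<equiv> App Run t u"

abbreviation (input) ap_eras :: "'k tm \<Rightarrow> 'k tm \<Rightarrow> 'k tm"  (infixl "\<cdot>\<^sub>0" 200) where
  "t \<cdot>\<^sub>0 u \<equiv> App Eras t u"

inductive comp :: "'k tm \<Rightarrow> 'k tm \<Rightarrow> bool" where
  comp_zero: "comp (Const (NatElim p) \<cdot>\<^sub>0 P \<cdot> z \<cdot> s \<cdot> Const Zero) z"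
| comp_suc: "comp (Const (NatElim p) \<cdot>\<^sub>0 P \<cdot> z \<cdot> s \<cdot> (Const Succ \<cdot> n))
    (s \<cdot> n \<cdot> (Const (NatElim p) \<cdot>\<^sub>0 P \<cdot> z \<cdot> s \<cdot> n))"
| comp_refl: "comp (Const (J a p) \<cdot>\<^sub>0 A \<cdot>\<^sub>0 x \<cdot>\<^sub>0 P \<cdot> r \<cdot>\<^sub>0 x \<cdot> (Const (Refl a) \<cdot>\<^sub>0 A \<cdot>\<^sub>0 x)) r"
| comp_proj: "comp (Const (Proj a) \<cdot>\<^sub>0 A \<cdot> (Const (Box a) \<cdot>\<^sub>0 A \<cdot>\<^sub>0 x)) x"
| comp_box: "comp (Const (ErasedElim a p) \<cdot>\<^sub>0 A \<cdot>\<^sub>0 P \<cdot> b \<cdot> (Const (Box a) \<cdot>\<^sub>0 A \<cdot>\<^sub>0 x)) (b \<cdot>\<^sub>0 x)"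
| comp_nil: "comp (Const (VecElim a p) \<cdot>\<^sub>0 A \<cdot>\<^sub>0 P \<cdot> z \<cdot> c \<cdot>\<^sub>0 n \<cdot> (Const (VNil a) \<cdot>\<^sub>0 A \<cdot>\<^sub>0 n \<cdot>\<^sub>0 e))
    (z \<cdot>\<^sub>0 n \<cdot>\<^sub>0 e)"
| comp_cons: "comp
    (Const (VecElim a p) \<cdot>\<^sub>0 A \<cdot>\<^sub>0 P \<cdot> z \<cdot> c \<cdot>\<^sub>0 n \<cdot>
      (Const (VCons a) \<cdot>\<^sub>0 A \<cdot>\<^sub>0 n \<cdot>\<^sub>0 m \<cdot> x \<cdot> xs \<cdot>\<^sub>0 e))
    (c \<cdot>\<^sub>0 n \<cdot>\<^sub>0 m \<cdot> x \<cdot> xs \<cdot>\<^sub>0 e \<cdot> (Const (VecElim a p) \<cdot>\<^sub>0 A \<cdot>\<^sub>0 P \<cdot> z \<cdot> c \<cdot>\<^sub>0 m \<cdot> xs))"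


section \<open>Judgements\<close>

text \<open>The mode in which an argument with annotation \<open>\<rho>\<close> is checked in mode \<open>\<sigma>\<close>.\<close>

definition arg_mode :: "usage \<Rightarrow> usage \<Rightarrow> usage" where
  "arg_mode \<sigma> \<rho> = (if \<rho> = Eras then Eras else \<sigma>)"

text \<open>The entry at position \<open>i\<close> of a context lives in the context \<open>drop (Suc i) \<Gamma>\<close>.\<close>

type_synonym 'k ctx = "(usage \<times> 'k tm) list"

text \<open>
  Types of variables and constants are checked in mode \<open>Eras\<close>.  Definitional equality is a judgement about terms
  in mode \<open>Eras\<close>; it does not take annotations of variables into account.  The types of
  constants and the added equations are closed, so they need no weakening.
\<close>

inductive
  wf_ctx :: "'k extension \<Rightarrow> 'k ctx \<Rightarrow> bool"  ("_ \<turnstile> _ ok" [51, 51] 50) and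
  has_type :: "'k extension \<Rightarrow> 'k ctx \<Rightarrow> usage \<Rightarrow> 'k tm \<Rightarrow> 'k tm \<Rightarrow> bool"
    ("_ ; _ \<turnstile>[_] _ \<Colon> _" [51, 51, 0, 51, 51] 50) and
  def_eq :: "'k extension \<Rightarrow> 'k ctx \<Rightarrow> 'k tm \<Rightarrow> 'k tm \<Rightarrow> 'k tm \<Rightarrow> bool"
    ("_ ; _ \<turnstile> _ \<doteq> _ \<Colon> _" [51, 51, 51, 51, 51] 50)
for S :: "'k extension"
where
  ctx_empty: "S \<turnstile> [] ok"
| ctx_extend: "S \<turnstile> \<Gamma> ok \<Longrightarrow> S; \<Gamma> \<turnstile>[Eras] A \<Colon> Univ l \<Longrightarrow> S \<turnstile> ((\<rho>, A) # \<Gamma>) ok"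

| ty_var: "S \<turnstile> \<Gamma> ok \<Longrightarrow> i < length \<Gamma> \<Longrightarrow> \<Gamma> ! i = (\<rho>, A) \<Longrightarrow> (\<sigma> = Run \<Longrightarrow> \<rho> = Run) \<Longrightarrow>
    S; \<Gamma> \<turnstile>[\<sigma>] Var i \<Colon> wk (Suc i) A"
| ty_const: "S \<turnstile> \<Gamma> ok \<Longrightarrow> const_type S c = Some (\<rho>, A) \<Longrightarrow> S; [] \<turnstile>[Eras] A \<Colon> Univ l \<Longrightarrow>
    (\<sigma> = Run \<Longrightarrow> \<rho> = Run) \<Longrightarrow> S; \<Gamma> \<turnstile>[\<sigma>] Const c \<Colon> A"
| ty_univ: "S \<turnstile> \<Gamma> ok \<Longrightarrow> S; \<Gamma> \<turnstile>[\<sigma>] Univ l \<Colon> Univ (lsuc l)"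
| ty_pi: "S; \<Gamma> \<turnstile>[\<sigma>] A \<Colon> Univ l \<Longrightarrow> S; (\<rho>, A) # \<Gamma> \<turnstile>[\<sigma>] B \<Colon> Univ l' \<Longrightarrow>
    S; \<Gamma> \<turnstile>[\<sigma>] Pi \<rho> A B \<Colon> Univ (lmax l l')"
| ty_lam: "S; (\<rho>, A) # \<Gamma> \<turnstile>[\<sigma>] t \<Colon> B \<Longrightarrow> S; \<Gamma> \<turnstile>[\<sigma>] Lam \<rho> t \<Colon> Pi \<rho> A B"
| ty_app: "S; \<Gamma> \<turnstile>[\<sigma>] t \<Colon> Pi \<rho> A B \<Longrightarrow> S; \<Gamma> \<turnstile>[arg_mode \<sigma> \<rho>] u \<Colon> A \<Longrightarrow>
    S; \<Gamma> \<turnstile>[\<sigma>] App \<rho> t u \<Colon> inst B u"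
| ty_conv: "S; \<Gamma> \<turnstile>[\<sigma>] t \<Colon> A \<Longrightarrow> S; \<Gamma> \<turnstile> A \<doteq> B \<Colon> Univ l \<Longrightarrow> S; \<Gamma> \<turnstile>[\<sigma>] t \<Colon> B"

| eq_refl: "S; \<Gamma> \<turnstile>[Eras] t \<Colon> A \<Longrightarrow> S; \<Gamma> \<turnstile> t \<doteq> t \<Colon> A"
| eq_sym: "S; \<Gamma> \<turnstile> t \<doteq> u \<Colon> A \<Longrightarrow> S; \<Gamma> \<turnstile> u \<doteq> t \<Colon> A"
| eq_trans: "S; \<Gamma> \<turnstile> t \<doteq> u \<Colon> A \<Longrightarrow> S; \<Gamma> \<turnstile> u \<doteq> v \<Colon> A \<Longrightarrow> S; \<Gamma> \<turnstile> t \<doteq> v \<Colon> A"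
| eq_conv: "S; \<Gamma> \<turnstile> t \<doteq> u \<Colon> A \<Longrightarrow> S; \<Gamma> \<turnstile> A \<doteq> B \<Colon> Univ l \<Longrightarrow> S; \<Gamma> \<turnstile> t \<doteq> u \<Colon> B"
| eq_pi: "S; \<Gamma> \<turnstile>[Eras] A \<Colon> Univ l \<Longrightarrow> S; \<Gamma> \<turnstile> A \<doteq> A' \<Colon> Univ l \<Longrightarrow>
    S; (\<rho>, A) # \<Gamma> \<turnstile> B \<doteq> B' \<Colon> Univ l' \<Longrightarrow> S; \<Gamma> \<turnstile> Pi \<rho> A B \<doteq> Pi \<rho> A' B' \<Colon> Univ (lmax l l')"
| eq_lam: "S; (\<rho>, A) # \<Gamma> \<turnstile> t \<doteq> t' \<Colon> B \<Longrightarrow> S; \<Gamma> \<turnstile> Lam \<rho> t \<doteq> Lam \<rho> t' \<Colon> Pi \<rho> A B"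
| eq_app: "S; \<Gamma> \<turnstile> t \<doteq> t' \<Colon> Pi \<rho> A B \<Longrightarrow> S; \<Gamma> \<turnstile> u \<doteq> u' \<Colon> A \<Longrightarrow>
    S; \<Gamma> \<turnstile> App \<rho> t u \<doteq> App \<rho> t' u' \<Colon> inst B u"
| eq_beta: "S; (\<rho>, A) # \<Gamma> \<turnstile>[Eras] t \<Colon> B \<Longrightarrow> S; \<Gamma> \<turnstile>[Eras] u \<Colon> A \<Longrightarrow>
    S; \<Gamma> \<turnstile> App \<rho> (Lam \<rho> t) u \<doteq> inst t u \<Colon> inst B u"
| eq_eta: "S; \<Gamma> \<turnstile>[Eras] t \<Colon> Pi \<rho> A B \<Longrightarrow>
    S; \<Gamma> \<turnstile> Lam \<rho> (App \<rho> (wk 1 t) (Var 0)) \<doteq> t \<Colon> Pi \<rho> A B"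
| eq_comp: "comp t u \<Longrightarrow> S; \<Gamma> \<turnstile>[Eras] t \<Colon> A \<Longrightarrow> S; \<Gamma> \<turnstile>[Eras] u \<Colon> A \<Longrightarrow>
    S; \<Gamma> \<turnstile> t \<doteq> u \<Colon> A"
| eq_ext: "S \<turnstile> \<Gamma> ok \<Longrightarrow> (t, u, A) \<in> ext_eq S \<Longrightarrow>
    S; [] \<turnstile>[Eras] t \<Colon> A \<Longrightarrow> S; [] \<turnstile>[Eras] u \<Colon> A \<Longrightarrow> S; \<Gamma> \<turnstile> t \<doteq> u \<Colon> A"


section \<open>Hypothetical judgements with named variables\<close>

definition assuming ::
  "usage \<Rightarrow> 'k nterm \<Rightarrow> ('k nterm \<Rightarrow> 'k ctx \<Rightarrow> bool) \<Rightarrow> 'k ctx \<Rightarrow> bool" where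
  "assuming \<rho> A \<phi> = (\<lambda>\<Gamma>. \<phi> (\<lambda>m. Var (m - Suc (length \<Gamma>))) ((\<rho>, A (length \<Gamma>)) # \<Gamma>))"

definition equal ::
  "'k extension \<Rightarrow> 'k nterm \<Rightarrow> 'k nterm \<Rightarrow> 'k nterm \<Rightarrow> 'k ctx \<Rightarrow> bool" where
  "equal S t u A = (\<lambda>\<Gamma>. S; \<Gamma> \<turnstile> t (length \<Gamma>) \<doteq> u (length \<Gamma>) \<Colon> A (length \<Gamma>))"

syntax
  "_assuming_run" :: "pttrn \<Rightarrow> 'a \<Rightarrow> 'a \<Rightarrow> 'a"  ("(3GIVEN _ : _./ _)" [0, 0, 10] 10)
  "_assuming_eras" :: "pttrn \<Rightarrow> 'a \<Rightarrow> 'a \<Rightarrow> 'a"  ("(3GIVEN\<^sub>0 _ : _./ _)" [0, 0, 10] 10)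
translations
  "GIVEN x : A. \<phi>" \<rightleftharpoons> "CONST assuming (CONST Run) A (\<lambda>x. \<phi>)"
  "GIVEN\<^sub>0 x : A. \<phi>" \<rightleftharpoons> "CONST assuming (CONST Eras) A (\<lambda>x. \<phi>)"


section \<open>The functions of the statement\<close>

definition box_cong_type :: "level \<Rightarrow> 'k tm" where
  "box_cong_type a =
    (\<Pi>\<^sub>0 A : univ_t a. \<Pi>\<^sub>0 x : A. \<Pi>\<^sub>0 y : A. \<Pi>\<^sub>0 e : id_t a A x y.
       id_t a (erased_t a A) (box_t a A x) (box_t a A y)) 0"

definition box_cong_comp :: "'k extension \<Rightarrow> level \<Rightarrow> 'k tm \<Rightarrow> bool" where
  "box_cong_comp S a f \<longleftrightarrow>
    (GIVEN\<^sub>0 A : univ_t a. GIVEN\<^sub>0 x : A.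
      equal S
        (closed f \<bullet>\<^sub>0 A \<bullet>\<^sub>0 x \<bullet>\<^sub>0 x \<bullet>\<^sub>0 refl_t a A x)
        (refl_t a (erased_t a A) (box_t a A x))
        (id_t a (erased_t a A) (box_t a A x) (box_t a A x))) []"

definition motive_type :: "level \<Rightarrow> level \<Rightarrow> 'k nterm \<Rightarrow> 'k nterm" where
  "motive_type a p A = (\<Pi>\<^sub>0 n : nat_t. \<Pi> xs : vec_t a A n. univ_t p)"

definition step_type :: "level \<Rightarrow> 'k nterm \<Rightarrow> 'k nterm \<Rightarrow> 'k nterm" where
  "step_type a A P =
    (\<Pi>\<^sub>0 n : nat_t. \<Pi> x : A. \<Pi> xs : vec_t a A n. \<Pi> ih : P \<bullet>\<^sub>0 n \<bullet> xs.
       P \<bullet>\<^sub>0 suc_t n \<bullet> push_t a A n x xs)"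

definition vec_elim'_type :: "level \<Rightarrow> level \<Rightarrow> 'k tm" where
  "vec_elim'_type a p =
    (\<Pi>\<^sub>0 A : univ_t a. \<Pi> P : motive_type a p A.
     \<Pi> z : P \<bullet>\<^sub>0 zero_t \<bullet> empty_t a A. \<Pi> c : step_type a A P.
     \<Pi>\<^sub>0 n : nat_t. \<Pi> xs : vec_t a A n. P \<bullet>\<^sub>0 n \<bullet> xs) 0"

definition vec_elim'_comp_empty :: "'k extension \<Rightarrow> level \<Rightarrow> level \<Rightarrow> 'k tm \<Rightarrow> bool" where
  "vec_elim'_comp_empty S a p f \<longleftrightarrow>
    (GIVEN\<^sub>0 A : univ_t a. GIVEN P : motive_type a p A.
     GIVEN z : P \<bullet>\<^sub>0 zero_t \<bullet> empty_t a A. GIVEN c : step_type a A P.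
      equal S
        (closed f \<bullet>\<^sub>0 A \<bullet> P \<bullet> z \<bullet> c \<bullet>\<^sub>0 zero_t \<bullet> empty_t a A)
        z
        (P \<bullet>\<^sub>0 zero_t \<bullet> empty_t a A)) []"

definition vec_elim'_comp_push :: "'k extension \<Rightarrow> level \<Rightarrow> level \<Rightarrow> 'k tm \<Rightarrow> bool" where
  "vec_elim'_comp_push S a p f \<longleftrightarrow>
    (GIVEN\<^sub>0 A : univ_t a. GIVEN P : motive_type a p A.
     GIVEN z : P \<bullet>\<^sub>0 zero_t \<bullet> empty_t a A. GIVEN c : step_type a A P.
     GIVEN\<^sub>0 n : nat_t. GIVEN x : A. GIVEN xs : vec_t a A n.
      equal S
        (closed f \<bullet>\<^sub>0 A \<bullet> P \<bullet> z \<bullet> c \<bullet>\<^sub>0 suc_t n \<bullet> push_t a A n x xs)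
        (c \<bullet>\<^sub>0 n \<bullet> x \<bullet> xs \<bullet> (closed f \<bullet>\<^sub>0 A \<bullet> P \<bullet> z \<bullet> c \<bullet>\<^sub>0 n \<bullet> xs))
        (P \<bullet>\<^sub>0 suc_t n \<bullet> push_t a A n x xs)) []"

definition box_cong\<^sub>0_type :: "'k tm" where
  "box_cong\<^sub>0_type =
    (\<Pi>\<^sub>0 n : nat_t. \<Pi>\<^sub>0 e : id_t lzero nat_t zero_t n.
       id_t lzero (erased_t lzero nat_t) (box_t lzero nat_t zero_t) (box_t lzero nat_t n)) 0"

end

theory Submission
  imports Defs
begin

text \<open>
  (i) \<open>[]-cong\<close> for the universe \<open>Univ p\<close> turns an erased identity proof between types \<open>A\<close> and \<open>B\<close> into
  one between \<open>[A]\<close> and \<open>[B]\<close> that can be eliminated at run time, with the motive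
  \<open>\<lambda>w _. erased w\<close>; this gives a cast from \<open>A\<close> to \<open>B\<close>.  If \<open>e\<close> is an erased proof that \<open>x\<close> equals
  \<open>y\<close>, then \<open>J\<close>, used in an erased context, gives an erased proof that the types \<open>T x refl\<close> and
  \<open>T y e\<close> are equal.  Casting along it yields a \<open>J\<close> eliminator for erased proofs, which computes on
  \<open>refl\<close>, and this eliminator reduces the cases of the standard vector eliminator to those of
  \<open>\<langle>\<rangle>\<close> and \<open>x :: xs\<close>.

  (ii) Apply the eliminator to \<open>nil e\<close> and a family of types, defined by large elimination, that is
  \<open>Id (Erased \<nat>) [zero] [n]\<close> at \<open>nil\<close> and an inhabited type at \<open>cons\<close>.

  The computation rules need typed \<open>\<beta>\<close>-steps below substitutions, hence the substitution lemma.
\<close>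

section \<open>Renaming and substitution\<close>

text \<open>The standard \<open>J\<close> cannot be applied to the proofs stored in
  \<open>nil\<close> and \<open>cons\<close>: they are erased, whereas the proof argument of
  \<open>J\<close> has to be a run-time term. Congruence for \<open>[_]\<close> bridges this gap,
  because it takes an erased proof and returns one that exists at run time. It is used on the type
  \<open>Univ p\<close>, which is an element of \<open>Univ (lsuc p)\<close>; a cast between types
  of level \<open>p\<close> therefore needs the hypothesis one level higher. The projection out of
  \<open>Erased\<close> is available only in erased contexts, and still the cast is a run-time term:
  the projection occurs only in the motive of \<open>J\<close>, and motives are erased arguments.

  The computation rules depend on a chain of reductions at \<open>refl\<close>. The erased
  \<open>J\<close> reduces to \<open>refl\<close>, then congruence applied to it reduces to
  \<open>refl\<close>, and only then does the outer \<open>J\<close> of the cast compute. The proofs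
  met in the last two stages are not syntactically \<open>refl\<close>, so the lemmas for these
  stages accept any proof that is definitionally equal to it.\<close>

lemma wk_0 [simp]: "wk 0 t = t"
proof -
  have "\<xi> = (\<lambda>i. i) \<Longrightarrow> ren \<xi> t = t" for \<xi>
  proof (induction t arbitrary: \<xi>)
    case (Pi \<rho> A B)
    moreover have "up_ren \<xi> = (\<lambda>i. i)" using Pi.prems by (auto simp: up_ren_def split: nat.split)
    ultimately show ?case by simp
  next
    case (Lam \<rho> t)
    moreover have "up_ren \<xi> = (\<lambda>i. i)" using Lam.prems by (auto simp: up_ren_def split: nat.split)
    ultimately show ?case by simp
  qed auto
  then show ?thesis by (simp add: wk_def)
qed

lemma up_ren_simps [simp]: "up_ren \<xi> 0 = 0" "up_ren \<xi> (Suc i) = Suc (\<xi> i)"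
  by (simp_all add: up_ren_def)

lemma up_sub_simps [simp]: "up_sub \<sigma> 0 = Var 0" "up_sub \<sigma> (Suc i) = ren Suc (\<sigma> i)"
  by (simp_all add: up_sub_def wk_def)

lemma ren_ren: "ren \<xi> (ren \<zeta> t) = ren (\<lambda>i. \<xi> (\<zeta> i)) t"
proof (induction t arbitrary: \<xi> \<zeta>)
  case (Pi \<rho> A B)
  have "(\<lambda>i. up_ren \<xi> (up_ren \<zeta> i)) = up_ren (\<lambda>i. \<xi> (\<zeta> i))"
    by (rule ext) (auto simp: up_ren_def split: nat.split)
  with Pi show ?case by simp
next
  case (Lam \<rho> t)
  have "(\<lambda>i. up_ren \<xi> (up_ren \<zeta> i)) = up_ren (\<lambda>i. \<xi> (\<zeta> i))"
    by (rule ext) (auto simp: up_ren_def split: nat.split)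
  with Lam show ?case by simp
qed auto

text \<open>This rule gives weakenings the form \<open>ren Suc (... (ren Suc t))\<close>, which
  matches the simp rule \<open>sub (case_nat u \<sigma>) (ren Suc t) = sub \<sigma> t\<close> that
  cancels them against an instantiation. Numerals as in \<open>wk 4\<close> must be unfolded by
  \<open>eval_nat_numeral\<close> for it to fire.\<close>

lemma wk_Suc [simp]: "wk (Suc n) t = ren Suc (wk n t)"
  by (simp add: wk_def ren_ren)

lemma ren_up_ren_Suc [simp]: "ren (up_ren \<xi>) (ren Suc t) = ren Suc (ren \<xi> t)"
  by (simp add: ren_ren)

lemma sub_ren: "sub \<sigma> (ren \<xi> t) = sub (\<lambda>i. \<sigma> (\<xi> i)) t"
proof (induction t arbitrary: \<sigma> \<xi>)
  case (Pi \<rho> A B)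
  have "(\<lambda>i. up_sub \<sigma> (up_ren \<xi> i)) = up_sub (\<lambda>i. \<sigma> (\<xi> i))"
    by (rule ext) (auto simp: up_ren_def up_sub_def split: nat.split)
  with Pi show ?case by simp
next
  case (Lam \<rho> t)
  have "(\<lambda>i. up_sub \<sigma> (up_ren \<xi> i)) = up_sub (\<lambda>i. \<sigma> (\<xi> i))"
    by (rule ext) (auto simp: up_ren_def up_sub_def split: nat.split)
  with Lam show ?case by simp
qed auto

lemma ren_sub: "ren \<xi> (sub \<sigma> t) = sub (\<lambda>i. ren \<xi> (\<sigma> i)) t"
proof (induction t arbitrary: \<sigma> \<xi>)
  case (Pi \<rho> A B)
  have "(\<lambda>i. ren (up_ren \<xi>) (up_sub \<sigma> i)) = up_sub (\<lambda>i. ren \<xi> (\<sigma> i))"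
    by (rule ext) (auto simp: up_sub_def wk_def[of 1, simplified] split: nat.split)
  with Pi show ?case by simp
next
  case (Lam \<rho> t)
  have "(\<lambda>i. ren (up_ren \<xi>) (up_sub \<sigma> i)) = up_sub (\<lambda>i. ren \<xi> (\<sigma> i))"
    by (rule ext) (auto simp: up_sub_def split: nat.split)
  with Lam show ?case by simp
qed auto

lemma sub_up_sub_ren_Suc [simp]: "sub (up_sub \<sigma>) (ren Suc t) = ren Suc (sub \<sigma> t)"
  by (simp add: sub_ren ren_sub)

lemma sub_case_nat_ren_Suc [simp]: "sub (case_nat u \<sigma>) (ren Suc t) = sub \<sigma> t"
  by (simp add: sub_ren)

lemma sub_sub: "sub \<sigma> (sub \<tau> t) = sub (\<lambda>i. sub \<sigma> (\<tau> i)) t"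
proof (induction t arbitrary: \<sigma> \<tau>)
  case (Pi \<rho> A B)
  have "(\<lambda>i. sub (up_sub \<sigma>) (up_sub \<tau> i)) = up_sub (\<lambda>i. sub \<sigma> (\<tau> i))"
    by (rule ext) (auto simp: up_sub_def wk_def[of 1] ren_sub sub_ren split: nat.split)
  with Pi show ?case by simp
next
  case (Lam \<rho> t)
  have "(\<lambda>i. sub (up_sub \<sigma>) (up_sub \<tau> i)) = up_sub (\<lambda>i. sub \<sigma> (\<tau> i))"
    by (rule ext) (auto simp: up_sub_def wk_def[of 1] ren_sub sub_ren split: nat.split)
  with Lam show ?case by simp
qed auto

lemma up_sub_Var [simp]: "up_sub Var = Var"
  by (rule ext) (auto simp: up_sub_def wk_def split: nat.split)

lemma sub_Var [simp]: "sub Var t = t"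
  by (induction t) auto

lemma ren_conv_sub: "ren \<xi> t = sub (\<lambda>i. Var (\<xi> i)) t"
  using sub_ren[of Var \<xi> t] by simp

lemma sub_case_nat_comp_up [simp]:
  "(\<lambda>i. sub (case_nat u \<sigma>) (up_sub \<tau> i)) = case_nat u (\<lambda>i. sub \<sigma> (\<tau> i))"
  by (rule ext) (auto simp: up_sub_def wk_def[of 1] sub_ren split: nat.split)

lemma sub_comp_case_nat [simp]:
  "(\<lambda>i. sub \<sigma> (case_nat u \<tau> i)) = case_nat (sub \<sigma> u) (\<lambda>i. sub \<sigma> (\<tau> i))"
  by (rule ext) (auto split: nat.split)

lemma sub_case_nat_sub_up [simp]:
  "sub (case_nat u \<sigma>) (sub (up_sub \<tau>) t) = sub (case_nat u (\<lambda>i. sub \<sigma> (\<tau> i))) t"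
  by (simp add: sub_sub)

lemma sub_sub_case_nat:
  "sub \<sigma> (sub (case_nat u \<tau>) t) = sub (case_nat (sub \<sigma> u) (\<lambda>i. sub \<sigma> (\<tau> i))) t"
  by (simp add: sub_sub)

lemma sub_inst: "sub \<sigma> (inst t u) = inst (sub (up_sub \<sigma>) t) (sub \<sigma> u)"
  by (simp add: inst_def sub_sub_case_nat)

lemma comp_sub: "comp t u \<Longrightarrow> comp (sub \<sigma> t) (sub \<sigma> u)"
  by (induction rule: comp.induct) (simp_all add: comp.intros)

section \<open>Scoping and closed terms\<close>

primrec scoped :: "nat \<Rightarrow> 'k tm \<Rightarrow> bool" where
  "scoped n (Var i) \<longleftrightarrow> i < n"
| "scoped n (Const c) \<longleftrightarrow> True"
| "scoped n (Univ l) \<longleftrightarrow> True"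
| "scoped n (Pi \<rho> A B) \<longleftrightarrow> scoped n A \<and> scoped (Suc n) B"
| "scoped n (Lam \<rho> t) \<longleftrightarrow> scoped (Suc n) t"
| "scoped n (App \<rho> t u) \<longleftrightarrow> scoped n t \<and> scoped n u"

lemma sub_cong_scoped: "scoped n t \<Longrightarrow> (\<And>i. i < n \<Longrightarrow> \<sigma> i = \<tau> i) \<Longrightarrow> sub \<sigma> t = sub \<tau> t"
proof (induction t arbitrary: n \<sigma> \<tau>)
  case (Pi \<rho> A B)
  have "up_sub \<sigma> i = up_sub \<tau> i" if "i < Suc n" for i
    using that Pi.prems by (cases i) auto
  with Pi show ?case by (metis scoped.simps(4) sub.simps(4))
next
  case (Lam \<rho> t)
  have "up_sub \<sigma> i = up_sub \<tau> i" if "i < Suc n" for i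
    using that Lam.prems by (cases i) auto
  with Lam show ?case by (metis scoped.simps(5) sub.simps(5))
qed (simp_all, metis)

lemma sub_closed: "scoped 0 t \<Longrightarrow> sub \<sigma> t = t"
  using sub_cong_scoped[of 0 t \<sigma> Var] by simp

lemma ren_closed: "scoped 0 t \<Longrightarrow> ren \<xi> t = t"
  by (simp add: ren_conv_sub sub_closed)

lemma wk_closed: "scoped 0 t \<Longrightarrow> wk n t = t"
  by (simp add: wk_def ren_closed)

lemma scoped_ren: "scoped n t \<Longrightarrow> (\<And>i. i < n \<Longrightarrow> \<xi> i < m) \<Longrightarrow> scoped m (ren \<xi> t)"
proof (induction t arbitrary: n m \<xi>)
  case (Pi \<rho> A B)
  have "up_ren \<xi> i < Suc m" if "i < Suc n" for i
    using that Pi.prems by (cases i) auto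
  with Pi show ?case by (metis scoped.simps(4) ren.simps(4))
next
  case (Lam \<rho> t)
  have "up_ren \<xi> i < Suc m" if "i < Suc n" for i
    using that Lam.prems by (cases i) auto
  with Lam show ?case by simp
qed auto

lemma scoped_sub: "scoped n t \<Longrightarrow> (\<And>i. i < n \<Longrightarrow> scoped m (\<sigma> i)) \<Longrightarrow> scoped m (sub \<sigma> t)"
proof (induction t arbitrary: n m \<sigma>)
  case (Pi \<rho> A B)
  have "scoped (Suc m) (up_sub \<sigma> i)" if "i < Suc n" for i
    using that Pi.prems by (cases i) (auto intro: scoped_ren)
  with Pi show ?case by (metis scoped.simps(4) sub.simps(4))
next
  case (Lam \<rho> t)
  have "scoped (Suc m) (up_sub \<sigma> i)" if "i < Suc n" for i
    using that Lam.prems by (cases i) (auto intro: scoped_ren)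
  with Lam show ?case by simp
qed auto

lemma scoped_inst: "scoped (Suc n) t \<Longrightarrow> scoped n u \<Longrightarrow> scoped n (inst t u)"
  unfolding inst_def by (erule scoped_sub) (auto split: nat.split)

section \<open>Metatheory\<close>

primrec ctx_all :: "('k ctx \<Rightarrow> 'k tm \<Rightarrow> bool) \<Rightarrow> 'k ctx \<Rightarrow> bool" where
  "ctx_all Q [] \<longleftrightarrow> True"
| "ctx_all Q (x # \<Gamma>) \<longleftrightarrow> Q \<Gamma> (snd x) \<and> ctx_all Q \<Gamma>"

lemma scoped_nth:
  "ctx_all (\<lambda>\<Gamma>. scoped (length \<Gamma>)) \<Gamma> \<Longrightarrow> i < length \<Gamma> \<Longrightarrow>
    scoped (length \<Gamma>) (wk (Suc i) (snd (\<Gamma> ! i)))"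
proof (induction \<Gamma> arbitrary: i)
  case (Cons x \<Gamma>)
  then show ?case by (cases i) (auto intro: scoped_ren)
qed simp

text \<open>Its main consequence is that whatever is typed in the empty context is closed and hence
  fixed by renamings and substitutions. This concerns the types of constants, the added equations
  and the assumed functions, all of which are used in larger contexts without weakening.\<close>

lemma judgement_scoped:
  fixes S :: "'k extension"
  shows "S \<turnstile> \<Gamma> ok \<Longrightarrow> ctx_all (\<lambda>\<Gamma>. scoped (length \<Gamma>)) \<Gamma>"
    and "S; \<Gamma> \<turnstile>[\<sigma>] t \<Colon> A \<Longrightarrow> ctx_all (\<lambda>\<Gamma>. scoped (length \<Gamma>)) \<Gamma> \<and>
      scoped (length \<Gamma>) t \<and> scoped (length \<Gamma>) A"
    and "S; \<Gamma> \<turnstile> t \<doteq> u \<Colon> A \<Longrightarrow> ctx_all (\<lambda>\<Gamma>. scoped (length \<Gamma>)) \<Gamma> \<and>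
      scoped (length \<Gamma>) t \<and> scoped (length \<Gamma>) u \<and> scoped (length \<Gamma>) A"
proof (induction rule: wf_ctx_has_type_def_eq.inducts)
  case (ty_var \<Gamma> i \<rho> A \<sigma>)
  then show ?case using scoped_nth[of \<Gamma> i] by simp
next
  case (ty_const \<Gamma> c \<rho> A l \<sigma>)
  then show ?case using scoped_ren[of 0 A]
    by (metis list.size(3) not_less_zero ren_closed scoped.simps(2))
next
  case (eq_ext \<Gamma> t u A)
  then show ?case by (metis list.size(3) not_less_zero ren_closed scoped_ren)
qed (auto intro: scoped_inst scoped_ren)

lemma has_type_closed:
  assumes "S; [] \<turnstile>[m] t \<Colon> A"
  shows "scoped 0 t" "scoped 0 A"
  using judgement_scoped(2)[OF assms] by simp_all

lemma ctx_tail: "S \<turnstile> x # \<Gamma> ok \<Longrightarrow> S \<turnstile> \<Gamma> ok"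
  by (auto elim: wf_ctx.cases)

lemma ctx_ok:
  fixes S :: "'k extension"
  shows "S \<turnstile> \<Gamma> ok \<Longrightarrow> True"
    and has_type_ctx: "S; \<Gamma> \<turnstile>[\<sigma>] t \<Colon> A \<Longrightarrow> S \<turnstile> \<Gamma> ok"
    and "S; \<Gamma> \<turnstile> t \<doteq> u \<Colon> A \<Longrightarrow> S \<turnstile> \<Gamma> ok"
  by (induction rule: wf_ctx_has_type_def_eq.inducts) (auto dest: ctx_tail)

text \<open>Definitional equality only speaks about terms in mode \<open>Eras\<close>, so a run-time
  typing has to be downgraded before it can enter an equality rule.\<close>

lemma has_type_eras:
  fixes S :: "'k extension"
  shows "S \<turnstile> \<Gamma> ok \<Longrightarrow> True"
    and erase: "S; \<Gamma> \<turnstile>[\<sigma>] t \<Colon> A \<Longrightarrow> S; \<Gamma> \<turnstile>[Eras] t \<Colon> A"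
    and "S; \<Gamma> \<turnstile> t \<doteq> u \<Colon> A \<Longrightarrow> True"
proof (induction rule: wf_ctx_has_type_def_eq.inducts)
  case (ty_var \<Gamma> i \<rho> A \<sigma>)
  then show ?case using wf_ctx_has_type_def_eq.ty_var[where \<sigma> = Eras] by blast
next
  case (ty_app \<Gamma> \<sigma> t \<rho> A B u)
  then show ?case by (auto intro!: wf_ctx_has_type_def_eq.ty_app simp: arg_mode_def)
qed (auto intro: wf_ctx_has_type_def_eq.intros)


text \<open>
  Every judgement is preserved by a class of substitutions that is closed under going below
  binders; renamings come first, because going below a binder weakens a substitution.
\<close>

lemma judgement_map:
  fixes S :: "'k extension"
    and R :: "usage \<Rightarrow> 'k ctx \<Rightarrow> (nat \<Rightarrow> 'k tm) \<Rightarrow> 'k ctx \<Rightarrow> bool"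
  assumes lift: "\<And>m \<Gamma> s \<Delta> \<rho> A. R m \<Gamma> s \<Delta> \<Longrightarrow> S \<turnstile> (\<rho>, sub s A) # \<Gamma> ok \<Longrightarrow>
      R m ((\<rho>, sub s A) # \<Gamma>) (up_sub s) ((\<rho>, A) # \<Delta>)"
    and var: "\<And>m \<Gamma> s \<Delta> i \<rho> A. R m \<Gamma> s \<Delta> \<Longrightarrow> S \<turnstile> \<Gamma> ok \<Longrightarrow> i < length \<Delta> \<Longrightarrow>
      \<Delta> ! i = (\<rho>, A) \<Longrightarrow> (m = Run \<Longrightarrow> \<rho> = Run) \<Longrightarrow> S; \<Gamma> \<turnstile>[m] s i \<Colon> sub s (wk (Suc i) A)"
    and mode: "\<And>m \<Gamma> s \<Delta>. R m \<Gamma> s \<Delta> \<Longrightarrow> R Eras \<Gamma> s \<Delta>"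
  defines "stab \<equiv> ctx_all (\<lambda>\<Delta> A. \<exists>l. \<forall>\<Gamma> s. S \<turnstile> \<Gamma> ok \<longrightarrow> R Eras \<Gamma> s \<Delta> \<longrightarrow>
      S; \<Gamma> \<turnstile>[Eras] sub s A \<Colon> Univ l)"
  shows "S \<turnstile> \<Delta> ok \<Longrightarrow> stab \<Delta>"
    and "S; \<Delta> \<turnstile>[m] t \<Colon> A \<Longrightarrow> stab \<Delta> \<and> (\<forall>\<Gamma> s. S \<turnstile> \<Gamma> ok \<longrightarrow> R m \<Gamma> s \<Delta> \<longrightarrow>
      S; \<Gamma> \<turnstile>[m] sub s t \<Colon> sub s A)"
    and "S; \<Delta> \<turnstile> t \<doteq> u \<Colon> A \<Longrightarrow> stab \<Delta> \<and> (\<forall>\<Gamma> s. S \<turnstile> \<Gamma> ok \<longrightarrow> R Eras \<Gamma> s \<Delta> \<longrightarrow>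
      S; \<Gamma> \<turnstile> sub s t \<doteq> sub s u \<Colon> sub s A)"
proof (induction rule: wf_ctx_has_type_def_eq.inducts)
  case ctx_empty
  then show ?case by (simp add: stab_def)
next
  case (ctx_extend \<Gamma> A l \<rho>)
  then show ?case by (auto simp: stab_def)
next
  case (ty_var \<Delta> i \<rho> A m)
  show ?case
  proof (intro conjI allI impI)
    fix \<Gamma> s assume "S \<turnstile> \<Gamma> ok" "R m \<Gamma> s \<Delta>"
    with ty_var show "S; \<Gamma> \<turnstile>[m] sub s (Var i) \<Colon> sub s (wk (Suc i) A)"
      by (simp add: var del: wk_Suc)
  qed (use ty_var in blast)
next
  case (ty_const \<Gamma> c \<rho> A l \<sigma>)
  moreover have "sub s A = A" for s
    using ty_const by (blast intro: sub_closed has_type_closed)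
  ultimately show ?case by (auto intro: wf_ctx_has_type_def_eq.ty_const)
next
  case (ty_univ \<Gamma> \<sigma> l)
  then show ?case by (auto intro: wf_ctx_has_type_def_eq.ty_univ)
next
  case (ty_pi \<Delta> m A l \<rho> B l')
  show ?case
  proof (intro conjI allI impI)
    show "stab \<Delta>" using ty_pi by blast
    fix \<Gamma> s assume ok: "S \<turnstile> \<Gamma> ok" and R: "R m \<Gamma> s \<Delta>"
    have A: "S; \<Gamma> \<turnstile>[m] sub s A \<Colon> Univ l" using ty_pi ok R by auto
    then have "S \<turnstile> (\<rho>, sub s A) # \<Gamma> ok" using ok erase by (blast intro: ctx_extend)
    then have "S; (\<rho>, sub s A) # \<Gamma> \<turnstile>[m] sub (up_sub s) B \<Colon> Univ l'"
      using ty_pi lift[OF R] by auto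
    then show "S; \<Gamma> \<turnstile>[m] sub s (Pi \<rho> A B) \<Colon> sub s (Univ (lmax l l'))"
      using A by (auto intro: wf_ctx_has_type_def_eq.ty_pi)
  qed
next
  case (ty_lam \<rho> A \<Delta> m t B)
  show ?case
  proof (intro conjI allI impI)
    show "stab \<Delta>" using ty_lam by (simp add: stab_def)
    fix \<Gamma> s assume ok: "S \<turnstile> \<Gamma> ok" and R: "R m \<Gamma> s \<Delta>"
    \<comment> \<open>\<open>ty_lam\<close> has no premise saying that \<open>A\<close> is a type,
      so no induction hypothesis covers \<open>sub s A\<close>. The invariant \<open>stab\<close>
      supplies it: it records that every entry of the context stays a type under the substitutions
      of the class.\<close>
    have "S \<turnstile> (\<rho>, sub s A) # \<Gamma> ok"
      using ty_lam ok mode[OF R] by (auto simp: stab_def intro: ctx_extend)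
    then have "S; (\<rho>, sub s A) # \<Gamma> \<turnstile>[m] sub (up_sub s) t \<Colon> sub (up_sub s) B"
      using ty_lam lift[OF R] by blast
    then show "S; \<Gamma> \<turnstile>[m] sub s (Lam \<rho> t) \<Colon> sub s (Pi \<rho> A B)"
      by (simp add: wf_ctx_has_type_def_eq.ty_lam)
  qed
next
  case (ty_app \<Delta> m t \<rho> A B u)
  have "R (arg_mode m \<rho>) \<Gamma> s \<Delta>" if "R m \<Gamma> s \<Delta>" for \<Gamma> s
    using that mode by (auto simp: arg_mode_def)
  with ty_app show ?case by (auto simp: sub_inst intro!: wf_ctx_has_type_def_eq.ty_app)
next
  case (ty_conv \<Delta> m t A B l)
  show ?case
  proof (intro conjI allI impI)
    fix \<Gamma> s assume "S \<turnstile> \<Gamma> ok" "R m \<Gamma> s \<Delta>"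
    with ty_conv mode have "S; \<Gamma> \<turnstile>[m] sub s t \<Colon> sub s A" "S; \<Gamma> \<turnstile> sub s A \<doteq> sub s B \<Colon> Univ l"
      by auto
    then show "S; \<Gamma> \<turnstile>[m] sub s t \<Colon> sub s B" by (rule wf_ctx_has_type_def_eq.ty_conv)
  qed (use ty_conv in blast)
next
  case (eq_refl \<Gamma> t A)
  then show ?case by (auto intro: wf_ctx_has_type_def_eq.eq_refl)
next
  case (eq_sym \<Gamma> t u A)
  then show ?case by (auto intro: wf_ctx_has_type_def_eq.eq_sym)
next
  case (eq_trans \<Gamma> t u A v)
  then show ?case by (blast intro: wf_ctx_has_type_def_eq.eq_trans)
next
  case (eq_conv \<Gamma> t u A B l)
  show ?case
  proof (intro conjI allI impI)
    fix \<Gamma>' s assume "S \<turnstile> \<Gamma>' ok" "R Eras \<Gamma>' s \<Gamma>"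
    with eq_conv have "S; \<Gamma>' \<turnstile> sub s t \<doteq> sub s u \<Colon> sub s A"
      "S; \<Gamma>' \<turnstile> sub s A \<doteq> sub s B \<Colon> Univ l"
      by auto
    then show "S; \<Gamma>' \<turnstile> sub s t \<doteq> sub s u \<Colon> sub s B" by (rule wf_ctx_has_type_def_eq.eq_conv)
  qed (use eq_conv in blast)
next
  case (eq_pi \<Delta> A l A' \<rho> B B' l')
  show ?case
  proof (intro conjI allI impI)
    show "stab \<Delta>" using eq_pi by blast
    fix \<Gamma> s assume ok: "S \<turnstile> \<Gamma> ok" and R: "R Eras \<Gamma> s \<Delta>"
    have A: "S; \<Gamma> \<turnstile>[Eras] sub s A \<Colon> Univ l" "S; \<Gamma> \<turnstile> sub s A \<doteq> sub s A' \<Colon> Univ l"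
      using eq_pi ok R by auto
    then have "S \<turnstile> (\<rho>, sub s A) # \<Gamma> ok" using ok by (blast intro: ctx_extend)
    then have "S; (\<rho>, sub s A) # \<Gamma> \<turnstile> sub (up_sub s) B \<doteq> sub (up_sub s) B' \<Colon> Univ l'"
      using eq_pi lift[OF R] by auto
    then show "S; \<Gamma> \<turnstile> sub s (Pi \<rho> A B) \<doteq> sub s (Pi \<rho> A' B') \<Colon> sub s (Univ (lmax l l'))"
      using A by (auto intro: wf_ctx_has_type_def_eq.eq_pi)
  qed
next
  case (eq_lam \<rho> A \<Delta> t t' B)
  show ?case
  proof (intro conjI allI impI)
    show "stab \<Delta>" using eq_lam by (simp add: stab_def)
    fix \<Gamma> s assume ok: "S \<turnstile> \<Gamma> ok" and R: "R Eras \<Gamma> s \<Delta>"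
    have "S \<turnstile> (\<rho>, sub s A) # \<Gamma> ok"
      using eq_lam ok R by (auto simp: stab_def intro: ctx_extend)
    then have "S; (\<rho>, sub s A) # \<Gamma> \<turnstile> sub (up_sub s) t \<doteq> sub (up_sub s) t' \<Colon> sub (up_sub s) B"
      using eq_lam lift[OF R] by blast
    then show "S; \<Gamma> \<turnstile> sub s (Lam \<rho> t) \<doteq> sub s (Lam \<rho> t') \<Colon> sub s (Pi \<rho> A B)"
      by (simp add: wf_ctx_has_type_def_eq.eq_lam)
  qed
next
  case (eq_app \<Gamma> t t' \<rho> A B u u')
  then show ?case by (auto simp: sub_inst intro!: wf_ctx_has_type_def_eq.eq_app)
next
  case (eq_beta \<rho> A \<Delta> t B u)
  show ?case
  proof (intro conjI allI impI)
    show "stab \<Delta>" using eq_beta by (simp add: stab_def)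
    fix \<Gamma> s assume ok: "S \<turnstile> \<Gamma> ok" and R: "R Eras \<Gamma> s \<Delta>"
    have "stab ((\<rho>, A) # \<Delta>)" using eq_beta by blast
    then have "S \<turnstile> (\<rho>, sub s A) # \<Gamma> ok"
      using ok R by (auto simp: stab_def intro: ctx_extend)
    then have "S; (\<rho>, sub s A) # \<Gamma> \<turnstile>[Eras] sub (up_sub s) t \<Colon> sub (up_sub s) B"
      using eq_beta lift[OF R] by blast
    then show "S; \<Gamma> \<turnstile> sub s (App \<rho> (Lam \<rho> t) u) \<doteq> sub s (inst t u) \<Colon> sub s (inst B u)"
      using eq_beta ok R by (simp add: sub_inst wf_ctx_has_type_def_eq.eq_beta)
  qed
next
  case (eq_eta \<Delta> t \<rho> A B)
  show ?case
  proof (intro conjI allI impI)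
    show "stab \<Delta>" using eq_eta by blast
    fix \<Gamma> s assume "S \<turnstile> \<Gamma> ok" "R Eras \<Gamma> s \<Delta>"
    then have "S; \<Gamma> \<turnstile>[Eras] sub s t \<Colon> Pi \<rho> (sub s A) (sub (up_sub s) B)" using eq_eta by simp
    from wf_ctx_has_type_def_eq.eq_eta[OF this]
    show "S; \<Gamma> \<turnstile> sub s (Lam \<rho> (App \<rho> (wk 1 t) (Var 0))) \<doteq> sub s t \<Colon> sub s (Pi \<rho> A B)" by simp
  qed
next
  case (eq_comp t u \<Gamma> A)
  then show ?case by (auto intro: wf_ctx_has_type_def_eq.eq_comp comp_sub)
next
  case (eq_ext \<Gamma> t u A)
  moreover have "sub s t = t" "sub s u = u" "sub s A = A" for s
    using eq_ext by (blast intro: sub_closed has_type_closed)+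
  ultimately show ?case by (auto intro: wf_ctx_has_type_def_eq.eq_ext)
qed

text \<open>The images are described by looking them up in the target context instead of by typing
  them, since a typing condition could not be lifted below a binder before weakening is
  available.\<close>

definition renames :: "usage \<Rightarrow> 'k ctx \<Rightarrow> (nat \<Rightarrow> 'k tm) \<Rightarrow> 'k ctx \<Rightarrow> bool" where
  "renames m \<Gamma> s \<Delta> \<longleftrightarrow> (\<forall>i \<rho> A. i < length \<Delta> \<longrightarrow> \<Delta> ! i = (\<rho>, A) \<longrightarrow>
    (\<exists>j B. s i = Var j \<and> j < length \<Gamma> \<and> \<Gamma> ! j = (\<rho>, B) \<and> wk (Suc j) B = sub s (wk (Suc i) A)))"

lemma renames_lift:
  assumes "renames m \<Gamma> s \<Delta>"
  shows "renames m ((\<rho>, sub s A) # \<Gamma>) (up_sub s) ((\<rho>, A) # \<Delta>)"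
  unfolding renames_def
proof (intro allI impI)
  fix i \<rho>' A' assume i: "i < length ((\<rho>, A) # \<Delta>)" "((\<rho>, A) # \<Delta>) ! i = (\<rho>', A')"
  show "\<exists>j B. up_sub s i = Var j \<and> j < length ((\<rho>, sub s A) # \<Gamma>) \<and>
    ((\<rho>, sub s A) # \<Gamma>) ! j = (\<rho>', B) \<and> wk (Suc j) B = sub (up_sub s) (wk (Suc i) A')"
  proof (cases i)
    case 0
    then show ?thesis using i by (intro exI[of _ 0]) simp
  next
    case (Suc k)
    with assms i obtain j B where "s k = Var j" "j < length \<Gamma>" "\<Gamma> ! j = (\<rho>', B)"
      "wk (Suc j) B = sub s (wk (Suc k) A')"
      unfolding renames_def by force
    then show ?thesis using Suc i by (intro exI[of _ "Suc j"]) (simp del: sub_ren)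
  qed
qed

lemma weaken:
  fixes S :: "'k extension"
  assumes "S \<turnstile> (\<rho>, B) # \<Gamma> ok"
    and "S; \<Gamma> \<turnstile>[m] t \<Colon> A"
  shows "S; (\<rho>, B) # \<Gamma> \<turnstile>[m] ren Suc t \<Colon> ren Suc A"
proof -
  have r: "renames m ((\<rho>, B) # \<Gamma>) (\<lambda>i. Var (Suc i)) \<Gamma>" for m
    by (auto simp: renames_def ren_conv_sub[symmetric])
  have var: "S; \<Gamma> \<turnstile>[m] s i \<Colon> sub s (wk (Suc i) A)"
    if R: "renames m \<Gamma> s \<Delta>" "S \<turnstile> \<Gamma> ok" "i < length \<Delta>" "\<Delta> ! i = (\<rho>, A)" "m = Run \<Longrightarrow> \<rho> = Run"
    for m \<Gamma> s \<Delta> i \<rho> A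
  proof -
    obtain j B where "s i = Var j" "j < length \<Gamma>" "\<Gamma> ! j = (\<rho>, B)" "wk (Suc j) B = sub s (wk (Suc i) A)"
      using R unfolding renames_def by blast
    then show ?thesis using R ty_var[of S \<Gamma> j \<rho> B m] by simp
  qed
  have mode: "renames m \<Gamma> s \<Delta> \<Longrightarrow> renames Eras \<Gamma> s \<Delta>" for m \<Gamma> s \<Delta>
    by (simp add: renames_def)
  have "\<forall>\<Gamma>' s. S \<turnstile> \<Gamma>' ok \<longrightarrow> renames m \<Gamma>' s \<Gamma> \<longrightarrow> S; \<Gamma>' \<turnstile>[m] sub s t \<Colon> sub s A"
    by (rule conjunct2[OF judgement_map(2)[where R = renames]])
      (erule renames_lift | fact var | fact mode | fact assms(2))+
  with assms(1) r show ?thesis unfolding ren_conv_sub by blast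
qed

text \<open>An image is typed in the mode of an argument, so an erased variable may be replaced by a
  term that makes sense only in erased contexts. This is sound because a position checked in mode
  \<open>Run\<close> admits only variables annotated \<open>Run\<close>, for which
  \<open>arg_mode m \<rho>\<close> is \<open>m\<close> itself.\<close>

definition substs ::
  "'k extension \<Rightarrow> usage \<Rightarrow> 'k ctx \<Rightarrow> (nat \<Rightarrow> 'k tm) \<Rightarrow> 'k ctx \<Rightarrow> bool" where
  "substs S m \<Gamma> s \<Delta> \<longleftrightarrow> (\<forall>i \<rho> A. i < length \<Delta> \<longrightarrow> \<Delta> ! i = (\<rho>, A) \<longrightarrow>
    S; \<Gamma> \<turnstile>[arg_mode m \<rho>] s i \<Colon> sub s (wk (Suc i) A))"

lemma substs_Nil: "substs S m \<Gamma> s []"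
  by (simp add: substs_def)

lemma substs_Cons:
  assumes "substs S m \<Gamma> s \<Delta>" "S; \<Gamma> \<turnstile>[arg_mode m \<rho>] u \<Colon> sub s A"
  shows "substs S m \<Gamma> (case_nat u s) ((\<rho>, A) # \<Delta>)"
  using assms by (auto simp: substs_def nth_Cons split: nat.split)

lemma substs_Var:
  assumes "S \<turnstile> \<Gamma> ok"
  shows "substs S m \<Gamma> Var \<Gamma>"
  unfolding substs_def sub_Var
proof (intro allI impI)
  fix i \<rho> A assume "i < length \<Gamma>" "\<Gamma> ! i = (\<rho>, A)"
  with assms show "S; \<Gamma> \<turnstile>[arg_mode m \<rho>] Var i \<Colon> wk (Suc i) A"
    by (rule ty_var) (auto simp: arg_mode_def split: if_splits intro: usage.exhaust)
qed

lemma substs_lift: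
  fixes S :: "'k extension"
  assumes "substs S m \<Gamma> s \<Delta>" and ok: "S \<turnstile> (\<rho>, sub s A) # \<Gamma> ok"
  shows "substs S m ((\<rho>, sub s A) # \<Gamma>) (up_sub s) ((\<rho>, A) # \<Delta>)"
  unfolding substs_def
proof (intro allI impI)
  fix i \<rho>' A' assume i: "i < length ((\<rho>, A) # \<Delta>)" "((\<rho>, A) # \<Delta>) ! i = (\<rho>', A')"
  show "S; (\<rho>, sub s A) # \<Gamma> \<turnstile>[arg_mode m \<rho>'] up_sub s i \<Colon> sub (up_sub s) (wk (Suc i) A')"
  proof (cases i)
    case 0
    then show ?thesis using i ty_var[OF ok, of 0 \<rho> "sub s A" "arg_mode m \<rho>"]
      by (cases \<rho>) (auto simp: arg_mode_def)
  next
    case (Suc k)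
    with assms i have "S; \<Gamma> \<turnstile>[arg_mode m \<rho>'] s k \<Colon> sub s (wk (Suc k) A')"
      by (simp add: substs_def)
    from weaken[OF ok this] show ?thesis using Suc by simp
  qed
qed

lemma
  fixes S :: "'k extension"
  assumes ok: "S \<turnstile> \<Gamma> ok"
  shows subst: "S; \<Delta> \<turnstile>[m] t \<Colon> A \<Longrightarrow> substs S m \<Gamma> s \<Delta> \<Longrightarrow> S; \<Gamma> \<turnstile>[m] sub s t \<Colon> sub s A"
    and subst_eq: "S; \<Delta> \<turnstile> t \<doteq> u \<Colon> A \<Longrightarrow> substs S Eras \<Gamma> s \<Delta> \<Longrightarrow>
      S; \<Gamma> \<turnstile> sub s t \<doteq> sub s u \<Colon> sub s A"
proof -
  have mode: "substs S Eras \<Gamma> s \<Delta>" if "substs S m \<Gamma> s \<Delta>" for m \<Gamma> s \<Delta>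
    using that erase unfolding substs_def arg_mode_def by (metis (full_types))
  have var: "S; \<Gamma> \<turnstile>[m] s i \<Colon> sub s (wk (Suc i) A)"
    if "substs S m \<Gamma> s \<Delta>" "S \<turnstile> \<Gamma> ok" "i < length \<Delta>" "\<Delta> ! i = (\<rho>, A)" "m = Run \<Longrightarrow> \<rho> = Run"
    for m \<Gamma> s \<Delta> i \<rho> A
  proof -
    have "arg_mode m \<rho> = m" using that(5) by (cases m) (auto simp: arg_mode_def)
    then show ?thesis using that unfolding substs_def by metis
  qed
  show "S; \<Gamma> \<turnstile>[m] sub s t \<Colon> sub s A" if "S; \<Delta> \<turnstile>[m] t \<Colon> A" and s: "substs S m \<Gamma> s \<Delta>"
  proof -
    have "\<forall>\<Gamma> s. S \<turnstile> \<Gamma> ok \<longrightarrow> substs S m \<Gamma> s \<Delta> \<longrightarrow> S; \<Gamma> \<turnstile>[m] sub s t \<Colon> sub s A"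
      by (rule conjunct2[OF judgement_map(2)[where R = "substs S"]])
        (fact substs_lift | fact var | fact mode | fact that)+
    with ok s show ?thesis by blast
  qed
  show "S; \<Gamma> \<turnstile> sub s t \<doteq> sub s u \<Colon> sub s A"
    if "S; \<Delta> \<turnstile> t \<doteq> u \<Colon> A" and s: "substs S Eras \<Gamma> s \<Delta>"
  proof -
    have "\<forall>\<Gamma> s. S \<turnstile> \<Gamma> ok \<longrightarrow> substs S Eras \<Gamma> s \<Delta> \<longrightarrow> S; \<Gamma> \<turnstile> sub s t \<doteq> sub s u \<Colon> sub s A"
      by (rule conjunct2[OF judgement_map(3)[where R = "substs S"]])
        (fact substs_lift | fact var | fact mode | fact that)+
    with ok s show ?thesis by blast
  qed
qed

lemma weaken_closed:
  assumes "S; [] \<turnstile>[m] t \<Colon> A" "S \<turnstile> \<Gamma> ok"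
  shows "S; \<Gamma> \<turnstile>[m] t \<Colon> A"
  using subst[OF assms(2,1) substs_Nil, of Var] by simp

text \<open>
  One step of the reduction of an abstraction applied to several arguments, which are collected
  in the substitution \<open>s\<close>.
\<close>

lemma beta_step:
  assumes s: "substs S Eras \<Gamma> s \<Delta>"
    and t: "S; (\<rho>, A) # \<Delta> \<turnstile>[Eras] t \<Colon> B"
    and g: "S; \<Gamma> \<turnstile> g \<doteq> sub s (Lam \<rho> t) \<Colon> sub s (Pi \<rho> A B)"
    and u: "S; \<Gamma> \<turnstile>[Eras] u \<Colon> sub s A"
  shows "S; \<Gamma> \<turnstile> App \<rho> g u \<doteq> sub (case_nat u s) t \<Colon> sub (case_nat u s) B"
proof -
  have ok: "S \<turnstile> \<Gamma> ok" using u by (rule has_type_ctx)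
  \<comment> \<open>That \<open>A\<close> is a type is recovered from the well-formed context in
    which \<open>t\<close> is typed.\<close>
  obtain l where "S; \<Delta> \<turnstile>[Eras] A \<Colon> Univ l"
    using has_type_ctx[OF t] by (auto elim: wf_ctx.cases)
  from subst[OF ok this s] have "S \<turnstile> (\<rho>, sub s A) # \<Gamma> ok"
    using ok by (auto intro: ctx_extend)
  from subst[OF this t substs_lift[OF s this]]
  have "S; (\<rho>, sub s A) # \<Gamma> \<turnstile>[Eras] sub (up_sub s) t \<Colon> sub (up_sub s) B" .
  from eq_trans[OF eq_app[OF g[unfolded sub.simps] eq_refl[OF u]] eq_beta[OF this u]]
  show ?thesis by (simp add: inst_def)
qed

section \<open>Typing rules of the constants\<close>

abbreviation "sucT n \<equiv> App Run (Const Succ) n"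
abbreviation "idT a A x y \<equiv> App Run (App Run (App Run (Const (Id a)) A) x) y"
abbreviation "reflT a A x \<equiv> App Eras (App Eras (Const (Refl a)) A) x"
abbreviation "jT a p A x P r y e \<equiv>
  App Run (App Eras (App Run (App Eras (App Eras (App Eras (Const (J a p)) A) x) P) r) y) e"
abbreviation "erasedT a A \<equiv> App Eras (Const (Erased a)) A"
abbreviation "boxT a A x \<equiv> App Eras (App Eras (Const (Box a)) A) x"
abbreviation "projT a A x \<equiv> App Run (App Eras (Const (Proj a)) A) x"
abbreviation "vecT a A n \<equiv> App Eras (App Run (Const (Vec a)) A) n"
abbreviation "nilT a A n e \<equiv> App Eras (App Eras (App Eras (Const (VNil a)) A) n) e"
abbreviation "consT a A n m x xs e \<equiv>
  App Eras (App Run (App Run (App Eras (App Eras (App Eras (Const (VCons a)) A) n) m) x) xs) e"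
abbreviation "vecElimT a p A P z c n xs \<equiv>
  App Run (App Eras (App Run (App Run (App Eras (App Eras (Const (VecElim a p)) A) P) z) c) n) xs"

lemmas named_defs = pi_def app_run_def app_eras_def con_def univ_t_def nat_t_def zero_t_def
  suc_t_def id_t_def refl_t_def erased_t_def box_t_def vec_t_def nil_t_def cons_t_def
  empty_t_def push_t_def

text \<open>Hiding the level allows contexts to be checked entry by entry without computing the
  \<open>lmax\<close> expressions that \<open>ty_pi\<close> produces.\<close>

definition is_type :: "'k extension \<Rightarrow> 'k ctx \<Rightarrow> 'k tm \<Rightarrow> bool" where
  "is_type S \<Gamma> A \<longleftrightarrow> (\<exists>l. S; \<Gamma> \<turnstile>[Eras] A \<Colon> Univ l)"

lemma is_typeI: "S; \<Gamma> \<turnstile>[\<sigma>] A \<Colon> Univ l \<Longrightarrow> is_type S \<Gamma> A"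
  using erase unfolding is_type_def by blast

lemma is_type_Univ: "S \<turnstile> \<Gamma> ok \<Longrightarrow> is_type S \<Gamma> (Univ l)"
  using is_typeI ty_univ by blast

lemma is_type_ctx: "is_type S \<Gamma> A \<Longrightarrow> S \<turnstile> (\<rho>, A) # \<Gamma> ok"
  using ctx_extend has_type_ctx unfolding is_type_def by blast

text \<open>
  The well-formedness of the extended context is supplied as an assumption, so that it is not
  derived again at every variable.
\<close>

lemma is_type_Pi:
  assumes "is_type S \<Gamma> A" "S \<turnstile> (\<rho>, A) # \<Gamma> ok \<Longrightarrow> is_type S ((\<rho>, A) # \<Gamma>) B"
  shows "is_type S \<Gamma> (Pi \<rho> A B)"
  using assms is_type_ctx ty_pi unfolding is_type_def by blast

text \<open>The type produced by \<open>ty_var\<close> is a weakening that rarely matches the wanted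
  type syntactically. Here the match is a separate equation for the simplifier;
  \<open>has_type_app\<close> does the same for \<open>inst B u\<close>.\<close>

lemma has_type_var:
  assumes "S \<turnstile> \<Gamma> ok" "i < length \<Gamma>" "wk (Suc i) (snd (\<Gamma> ! i)) = A" "\<sigma> = Run \<Longrightarrow> fst (\<Gamma> ! i) = Run"
  shows "S; \<Gamma> \<turnstile>[\<sigma>] Var i \<Colon> A"
  using assms ty_var[of S \<Gamma> i "fst (\<Gamma> ! i)" "snd (\<Gamma> ! i)" \<sigma>] by simp

lemma has_type_const:
  assumes "const_type S c = Some (\<rho>, A)" "is_type S [] A" "S \<turnstile> \<Gamma> ok" "\<sigma> = Run \<Longrightarrow> \<rho> = Run"
  shows "S; \<Gamma> \<turnstile>[\<sigma>] Const c \<Colon> A"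
  using assms ty_const unfolding is_type_def by blast

lemma has_type_app:
  assumes "S; \<Gamma> \<turnstile>[\<sigma>] t \<Colon> Pi \<rho> A B" "S; \<Gamma> \<turnstile>[arg_mode \<sigma> \<rho>] u \<Colon> A" "C = inst B u"
  shows "S; \<Gamma> \<turnstile>[\<sigma>] App \<rho> t u \<Colon> C"
  using assms ty_app by blast

lemma arg_mode_simps [simp]: "arg_mode \<sigma> Eras = Eras" "arg_mode \<sigma> Run = \<sigma>" "arg_mode Eras \<rho> = Eras"
  by (simp_all add: arg_mode_def)

lemma has_type_Nat: "S \<turnstile> \<Gamma> ok \<Longrightarrow> S; \<Gamma> \<turnstile>[\<sigma>] Const Nat \<Colon> Univ lzero"
  by (erule has_type_const[rotated 2]) (simp_all add: named_defs is_type_Univ ctx_empty)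

lemma has_type_Zero: "S \<turnstile> \<Gamma> ok \<Longrightarrow> S; \<Gamma> \<turnstile>[\<sigma>] Const Zero \<Colon> Const Nat"
  by (erule has_type_const[rotated 2])
    (auto simp: named_defs intro: is_typeI has_type_Nat ctx_empty)

lemma has_type_suc:
  assumes "S; \<Gamma> \<turnstile>[\<sigma>] n \<Colon> Const Nat"
  shows "S; \<Gamma> \<turnstile>[\<sigma>] sucT n \<Colon> Const Nat"
proof -
  have "is_type S [] (Pi Run (Const Nat) (Const Nat))"
    by (rule is_type_Pi is_typeI has_type_Nat ctx_empty | assumption)+
  then have "S; \<Gamma> \<turnstile>[\<sigma>] Const Succ \<Colon> Pi Run (Const Nat) (Const Nat)"
    using has_type_ctx[OF assms] by (rule has_type_const[rotated]) (simp_all add: named_defs)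
  from ty_app[OF this, of n] assms show ?thesis by (simp add: inst_def)
qed

text \<open>\<open>ty_const\<close> demands a derivation that the declared type of the constant is a
  type. That derivation uses the rules of the constants occurring in it, which fixes the order of
  this lemma and the similar ones after it.\<close>

lemma has_type_Id:
  assumes "S; \<Gamma> \<turnstile>[\<sigma>] A \<Colon> Univ a" "S; \<Gamma> \<turnstile>[\<sigma>] x \<Colon> A" "S; \<Gamma> \<turnstile>[\<sigma>] y \<Colon> A"
  shows "S; \<Gamma> \<turnstile>[\<sigma>] idT a A x y \<Colon> Univ a"
proof -
  have "is_type S [] (Pi Run (Univ a) (Pi Run (Var 0) (Pi Run (Var 1) (Univ a))))"
    by (rule is_type_Pi is_type_Univ ctx_empty | assumption | rule is_typeI, rule has_type_var | simp)+
  then have "S; \<Gamma> \<turnstile>[\<sigma>] Const (Id a) \<Colon> Pi Run (Univ a) (Pi Run (Var 0) (Pi Run (Var 1) (Univ a)))"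
    using has_type_ctx[OF assms(1)] by (rule has_type_const[rotated]) (simp_all add: named_defs)
  from has_type_app[OF has_type_app[OF has_type_app[OF this]]] show ?thesis
    using assms by (simp add: inst_def)
qed

text \<open>Intended for motives with two arguments. The two instantiations are merged into one
  simultaneous substitution, the form in which reduced motives appear later.\<close>

lemma has_type_app2:
  assumes "S; \<Gamma> \<turnstile>[Eras] P \<Colon> Pi \<rho> A (Pi \<rho>' B C)" "S; \<Gamma> \<turnstile>[Eras] x \<Colon> A"
    "inst B x = B'" "S; \<Gamma> \<turnstile>[Eras] y \<Colon> B'" "sub (case_nat y (case_nat x Var)) C = D"
  shows "S; \<Gamma> \<turnstile>[Eras] App \<rho>' (App \<rho> P x) y \<Colon> D"
proof -
  have "S; \<Gamma> \<turnstile>[Eras] App \<rho> P x \<Colon> Pi \<rho>' B' (sub (up_sub (case_nat x Var)) C)"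
    using assms(1-3) by (auto intro!: has_type_app simp: inst_def)
  from ty_app[OF this, of y] show ?thesis using assms(4,5) by (simp add: inst_def)
qed

lemma has_type_refl:
  assumes "S; \<Gamma> \<turnstile>[Eras] A \<Colon> Univ a" "S; \<Gamma> \<turnstile>[Eras] x \<Colon> A"
  shows "S; \<Gamma> \<turnstile>[\<sigma>] reflT a A x \<Colon> idT a A x x"
proof -
  let ?T = "Pi Eras (Univ a) (Pi Eras (Var 0) (idT a (Var 1) (Var 0) (Var 0)))"
  have "is_type S [] ?T"
    by (rule is_type_Pi is_type_Univ ctx_empty | assumption
      | rule is_typeI, rule has_type_Id has_type_var | rule has_type_var | simp)+
  then have "S; \<Gamma> \<turnstile>[\<sigma>] Const (Refl a) \<Colon> ?T"
    using has_type_ctx[OF assms(1)] by (rule has_type_const[rotated]) (simp_all add: named_defs)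
  from has_type_app[OF has_type_app[OF this]] show ?thesis
    using assms by (simp add: inst_def)
qed

lemma has_type_Erased:
  assumes "S; \<Gamma> \<turnstile>[Eras] A \<Colon> Univ a"
  shows "S; \<Gamma> \<turnstile>[\<sigma>] erasedT a A \<Colon> Univ a"
proof -
  let ?T = "Pi Eras (Univ a) (Univ a)"
  have "is_type S [] ?T"
    by (rule is_type_Pi is_type_Univ ctx_empty | assumption)+
  then have "S; \<Gamma> \<turnstile>[\<sigma>] Const (Erased a) \<Colon> ?T"
    using has_type_ctx[OF assms(1)] by (rule has_type_const[rotated]) (simp_all add: named_defs)
  from has_type_app[OF this] show ?thesis
    using assms by (simp add: inst_def)
qed

lemma has_type_box:
  assumes "S; \<Gamma> \<turnstile>[Eras] A \<Colon> Univ a" "S; \<Gamma> \<turnstile>[Eras] x \<Colon> A"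
  shows "S; \<Gamma> \<turnstile>[\<sigma>] boxT a A x \<Colon> erasedT a A"
proof -
  let ?T = "Pi Eras (Univ a) (Pi Eras (Var 0) (erasedT a (Var 1)))"
  have "is_type S [] ?T"
    by (rule is_type_Pi is_type_Univ ctx_empty | assumption
      | rule is_typeI, rule has_type_Erased has_type_var | rule has_type_var | simp)+
  then have "S; \<Gamma> \<turnstile>[\<sigma>] Const (Box a) \<Colon> ?T"
    using has_type_ctx[OF assms(1)] by (rule has_type_const[rotated]) (simp_all add: named_defs)
  from has_type_app[OF has_type_app[OF this]] show ?thesis
    using assms by (simp add: inst_def)
qed

lemma has_type_proj:
  assumes "S; \<Gamma> \<turnstile>[Eras] A \<Colon> Univ a" "S; \<Gamma> \<turnstile>[Eras] x \<Colon> erasedT a A"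
  shows "S; \<Gamma> \<turnstile>[Eras] projT a A x \<Colon> A"
proof -
  let ?T = "Pi Eras (Univ a) (Pi Run (erasedT a (Var 0)) (Var 1))"
  have "is_type S [] ?T"
    by (rule is_type_Pi is_type_Univ ctx_empty | assumption
      | rule is_typeI, rule has_type_Erased has_type_var | rule has_type_var | simp)+
  then have "S; \<Gamma> \<turnstile>[Eras] Const (Proj a) \<Colon> ?T"
    using has_type_ctx[OF assms(1)] by (rule has_type_const[rotated]) (simp_all add: named_defs)
  from has_type_app[OF has_type_app[OF this]] show ?thesis
    using assms by (simp add: inst_def)
qed

lemma has_type_Vec:
  assumes "S; \<Gamma> \<turnstile>[\<sigma>] A \<Colon> Univ a" "S; \<Gamma> \<turnstile>[Eras] n \<Colon> Const Nat"
  shows "S; \<Gamma> \<turnstile>[\<sigma>] vecT a A n \<Colon> Univ a"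
proof -
  let ?T = "Pi Run (Univ a) (Pi Eras (Const Nat) (Univ a))"
  have "is_type S [] ?T"
    by (rule is_type_Pi is_type_Univ ctx_empty | assumption
      | rule is_typeI, rule has_type_Nat has_type_var | rule has_type_var | simp)+
  then have "S; \<Gamma> \<turnstile>[\<sigma>] Const (Vec a) \<Colon> ?T"
    using has_type_ctx[OF assms(1)] by (rule has_type_const[rotated]) (simp_all add: named_defs)
  from has_type_app[OF has_type_app[OF this]] show ?thesis
    using assms by (simp add: inst_def)
qed

lemma has_type_nil:
  assumes "S; \<Gamma> \<turnstile>[Eras] A \<Colon> Univ a" "S; \<Gamma> \<turnstile>[Eras] n \<Colon> Const Nat"
    "S; \<Gamma> \<turnstile>[Eras] e \<Colon> idT lzero (Const Nat) (Const Zero) n"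
  shows "S; \<Gamma> \<turnstile>[\<sigma>] nilT a A n e \<Colon> vecT a A n"
proof -
  let ?T = "Pi Eras (Univ a) (Pi Eras (Const Nat)
    (Pi Eras (idT lzero (Const Nat) (Const Zero) (Var 0)) (vecT a (Var 2) (Var 1))))"
  have "is_type S [] ?T"
    by (rule is_type_Pi is_type_Univ ctx_empty | assumption
      | rule is_typeI, rule has_type_Nat has_type_Id has_type_Vec has_type_var
      | rule has_type_Nat has_type_Zero has_type_var | simp add: inst_def eval_nat_numeral)+
  then have "S; \<Gamma> \<turnstile>[\<sigma>] Const (VNil a) \<Colon> ?T"
    using has_type_ctx[OF assms(1)]
    by (rule has_type_const[rotated]) (simp_all add: named_defs eval_nat_numeral)
  from has_type_app[OF has_type_app[OF has_type_app[OF this]]] show ?thesis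
    using assms by (simp add: inst_def eval_nat_numeral)
qed

lemma has_type_cons:
  assumes "S; \<Gamma> \<turnstile>[Eras] A \<Colon> Univ a" "S; \<Gamma> \<turnstile>[Eras] n \<Colon> Const Nat" "S; \<Gamma> \<turnstile>[Eras] m \<Colon> Const Nat"
    "S; \<Gamma> \<turnstile>[\<sigma>] x \<Colon> A" "S; \<Gamma> \<turnstile>[\<sigma>] xs \<Colon> vecT a A m"
    "S; \<Gamma> \<turnstile>[Eras] e \<Colon> idT lzero (Const Nat) (sucT m) n"
  shows "S; \<Gamma> \<turnstile>[\<sigma>] consT a A n m x xs e \<Colon> vecT a A n"
proof -
  let ?T = "Pi Eras (Univ a) (Pi Eras (Const Nat) (Pi Eras (Const Nat)
    (Pi Run (Var 2) (Pi Run (vecT a (Var 3) (Var 1))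
    (Pi Eras (idT lzero (Const Nat) (sucT (Var 2)) (Var 3)) (vecT a (Var 5) (Var 4)))))))"
  have "is_type S [] ?T"
    by (rule is_type_Pi is_type_Univ ctx_empty | assumption
      | rule is_typeI, rule has_type_Nat has_type_Id has_type_Vec has_type_var
      | rule has_type_Nat has_type_suc has_type_var | simp add: inst_def eval_nat_numeral)+
  then have "S; \<Gamma> \<turnstile>[\<sigma>] Const (VCons a) \<Colon> ?T"
    using has_type_ctx[OF assms(1)]
    by (rule has_type_const[rotated]) (simp_all add: named_defs eval_nat_numeral)
  from has_type_app[OF has_type_app[OF has_type_app[OF has_type_app[OF
    has_type_app[OF has_type_app[OF this]]]]]]
  show ?thesis using assms by (simp add: inst_def eval_nat_numeral)
qed

text \<open>Stopping just before the proof argument makes it possible to exchange that argument for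
  a definitionally equal one by \<open>eq_app\<close>.\<close>

lemma has_type_J_fun:
  assumes "S; \<Gamma> \<turnstile>[Eras] A \<Colon> Univ a" "S; \<Gamma> \<turnstile>[Eras] x \<Colon> A"
    "S; \<Gamma> \<turnstile>[Eras] P \<Colon> Pi Run A (Pi Run (idT a (ren Suc A) (ren Suc x) (Var 0)) (Univ p))"
    "S; \<Gamma> \<turnstile>[\<sigma>] r \<Colon> App Run (App Run P x) (reflT a A x)"
    "S; \<Gamma> \<turnstile>[Eras] y \<Colon> A"
  shows "S; \<Gamma> \<turnstile>[\<sigma>] App Eras (App Run (App Eras (App Eras (App Eras (Const (J a p)) A) x) P) r) y
    \<Colon> Pi Run (idT a A x y) (App Run (App Run (ren Suc P) (ren Suc y)) (Var 0))"
proof -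
  let ?T = "Pi Eras (Univ a) (Pi Eras (Var 0)
    (Pi Eras (Pi Run (Var 1) (Pi Run (idT a (Var 2) (Var 1) (Var 0)) (Univ p)))
    (Pi Run (App Run (App Run (Var 0) (Var 1)) (reflT a (Var 2) (Var 1)))
    (Pi Eras (Var 3) (Pi Run (idT a (Var 4) (Var 3) (Var 0))
      (App Run (App Run (Var 3) (Var 1)) (Var 0)))))))"
  have "is_type S [] ?T"
    by (rule is_type_Pi is_type_Univ ctx_empty | assumption
      | rule is_typeI, rule has_type_Id has_type_app2 has_type_var
      | rule has_type_refl has_type_var | simp add: inst_def eval_nat_numeral)+
  then have "S; \<Gamma> \<turnstile>[\<sigma>] Const (J a p) \<Colon> ?T"
    using has_type_ctx[OF assms(1)]
    by (rule has_type_const[rotated]) (simp_all add: named_defs eval_nat_numeral)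
  from has_type_app[OF has_type_app[OF has_type_app[OF has_type_app[OF
    has_type_app[OF this]]]]]
  show ?thesis using assms by (simp add: inst_def eval_nat_numeral)
qed

lemma has_type_J:
  assumes "S; \<Gamma> \<turnstile>[Eras] A \<Colon> Univ a" "S; \<Gamma> \<turnstile>[Eras] x \<Colon> A"
    "S; \<Gamma> \<turnstile>[Eras] P \<Colon> Pi Run A (Pi Run (idT a (ren Suc A) (ren Suc x) (Var 0)) (Univ p))"
    "S; \<Gamma> \<turnstile>[\<sigma>] r \<Colon> App Run (App Run P x) (reflT a A x)"
    "S; \<Gamma> \<turnstile>[Eras] y \<Colon> A" "S; \<Gamma> \<turnstile>[\<sigma>] e \<Colon> idT a A x y"
  shows "S; \<Gamma> \<turnstile>[\<sigma>] jT a p A x P r y e \<Colon> App Run (App Run P y) e"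
  using ty_app[OF has_type_J_fun[OF assms(1-5)], of e] assms(6) by (simp add: inst_def)

lemma has_type_VecElim:
  assumes "S; \<Gamma> \<turnstile>[Eras] A \<Colon> Univ a"
    "S; \<Gamma> \<turnstile>[Eras] P \<Colon> Pi Run (Const Nat) (Pi Run (vecT a (ren Suc A) (Var 0)) (Univ p))"
    "S; \<Gamma> \<turnstile>[\<sigma>] z \<Colon> Pi Eras (Const Nat) (Pi Eras (idT lzero (Const Nat) (Const Zero) (Var 0))
      (App Run (App Run (wk 2 P) (Var 1)) (nilT a (wk 2 A) (Var 1) (Var 0))))"
    "S; \<Gamma> \<turnstile>[\<sigma>] c \<Colon> Pi Eras (Const Nat) (Pi Eras (Const Nat) (Pi Run (wk 2 A)
      (Pi Run (vecT a (wk 3 A) (Var 1)) (Pi Eras (idT lzero (Const Nat) (sucT (Var 2)) (Var 3))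
      (Pi Run (App Run (App Run (wk 5 P) (Var 3)) (Var 1))
      (App Run (App Run (wk 6 P) (Var 5))
        (consT a (wk 6 A) (Var 5) (Var 4) (Var 3) (Var 2) (Var 1))))))))"
    "S; \<Gamma> \<turnstile>[Eras] n \<Colon> Const Nat" "S; \<Gamma> \<turnstile>[\<sigma>] xs \<Colon> vecT a A n"
  shows "S; \<Gamma> \<turnstile>[\<sigma>] vecElimT a p A P z c n xs \<Colon> App Run (App Run P n) xs"
proof -
  let ?T = "Pi Eras (Univ a)
    (Pi Eras (Pi Run (Const Nat) (Pi Run (vecT a (Var 1) (Var 0)) (Univ p)))
    (Pi Run (Pi Eras (Const Nat) (Pi Eras (idT lzero (Const Nat) (Const Zero) (Var 0))
      (App Run (App Run (Var 2) (Var 1)) (nilT a (Var 3) (Var 1) (Var 0)))))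
    (Pi Run (Pi Eras (Const Nat) (Pi Eras (Const Nat) (Pi Run (Var 4)
      (Pi Run (vecT a (Var 5) (Var 1)) (Pi Eras (idT lzero (Const Nat) (sucT (Var 2)) (Var 3))
      (Pi Run (App Run (App Run (Var 6) (Var 3)) (Var 1))
      (App Run (App Run (Var 7) (Var 5))
        (consT a (Var 8) (Var 5) (Var 4) (Var 3) (Var 2) (Var 1)))))))))
    (Pi Eras (Const Nat) (Pi Run (vecT a (Var 4) (Var 0))
      (App Run (App Run (Var 4) (Var 1)) (Var 0)))))))"
  have "is_type S [] ?T"
    by (rule is_type_Pi is_type_Univ ctx_empty | assumption
      | rule is_typeI, rule has_type_Nat has_type_Id has_type_Vec has_type_app2 has_type_var
      | rule has_type_Nat has_type_Zero has_type_suc has_type_nil has_type_cons has_type_var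
      | simp add: inst_def eval_nat_numeral)+
  then have "S; \<Gamma> \<turnstile>[\<sigma>] Const (VecElim a p) \<Colon> ?T"
    using has_type_ctx[OF assms(1)]
    by (rule has_type_const[rotated]) (simp_all add: named_defs eval_nat_numeral)
  from has_type_app[OF has_type_app[OF has_type_app[OF has_type_app[OF
    has_type_app[OF has_type_app[OF this]]]]]]
  show ?thesis using assms by (simp add: inst_def eval_nat_numeral)
qed

lemma wk_conv_sub: "wk k t = sub (\<lambda>i. Var (i + k)) t"
  by (simp add: wk_def ren_conv_sub)

text \<open>Weakening past a whole block of variables is one well-typed substitution. The branches
  of an eliminator live under several new variables, and this reaches them in a single step.\<close>

lemma substs_wk:
  assumes "S \<turnstile> \<Theta> @ \<Gamma> ok"
  shows "substs S m (\<Theta> @ \<Gamma>) (\<lambda>i. Var (i + length \<Theta>)) \<Gamma>"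
  unfolding substs_def
proof (intro allI impI)
  fix i \<rho> A assume i: "i < length \<Gamma>" "\<Gamma> ! i = (\<rho>, A)"
  have "sub (\<lambda>i. Var (i + length \<Theta>)) (wk (Suc i) A) = wk (Suc (i + length \<Theta>)) A"
    by (simp add: wk_def ren_ren add.assoc flip: ren_conv_sub del: wk_Suc)
  then show "S; \<Theta> @ \<Gamma> \<turnstile>[arg_mode m \<rho>] Var (i + length \<Theta>) \<Colon> sub (\<lambda>i. Var (i + length \<Theta>)) (wk (Suc i) A)"
    using assms i by (intro has_type_var) (auto simp: nth_append arg_mode_def split: if_splits simp del: wk_Suc intro: usage.exhaust)
qed

text \<open>The double abstraction stands under a substitution \<open>s\<close> because motives also
  have to be reduced inside branch types, where they occur weakened; \<open>beta2_Var\<close> is the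
  case without weakening.\<close>

lemma beta2:
  assumes s: "substs S Eras \<Gamma> s \<Delta>"
    and t: "S; (\<rho>', B) # (\<rho>, A) # \<Delta> \<turnstile>[Eras] t \<Colon> C"
    and x: "S; \<Gamma> \<turnstile>[Eras] x \<Colon> sub s A" and y: "S; \<Gamma> \<turnstile>[Eras] y \<Colon> sub (case_nat x s) B"
  shows "S; \<Gamma> \<turnstile> App \<rho>' (App \<rho> (sub s (Lam \<rho> (Lam \<rho>' t))) x) y \<doteq>
    sub (case_nat y (case_nat x s)) t \<Colon> sub (case_nat y (case_nat x s)) C"
proof -
  have ok: "S \<turnstile> \<Gamma> ok" using x by (rule has_type_ctx)
  have "S; \<Delta> \<turnstile>[Eras] Lam \<rho> (Lam \<rho>' t) \<Colon> Pi \<rho> A (Pi \<rho>' B C)"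
    using t by (intro ty_lam)
  from eq_refl[OF subst[OF ok this s]]
  have "S; \<Gamma> \<turnstile> App \<rho> (sub s (Lam \<rho> (Lam \<rho>' t))) x \<doteq> sub (case_nat x s) (Lam \<rho>' t) \<Colon>
    sub (case_nat x s) (Pi \<rho>' B C)"
    by (intro beta_step[OF s ty_lam[OF t] _ x]) simp
  then show ?thesis
    using x by (intro beta_step[OF substs_Cons[OF s] t _ y]) simp_all
qed

lemmas beta2_Var = beta2[OF substs_Var, unfolded sub_Var]

section \<open>Identity elimination\<close>

text \<open>The motive is given by its body \<open>T\<close>, in which \<open>Var 1\<close> is the
  endpoint and \<open>Var 0\<close> the proof, so that the resulting types are already reduced. The
  second rule allows \<open>e\<close> to be merely definitionally equal to \<open>refl\<close>,
  because in a cast this argument is an application of congruence.\<close>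

lemma
  assumes A: "S; \<Gamma> \<turnstile>[Eras] A \<Colon> Univ a" and x: "S; \<Gamma> \<turnstile>[Eras] x \<Colon> A"
    and T: "S; (Run, idT a (ren Suc A) (ren Suc x) (Var 0)) # (Run, A) # \<Gamma> \<turnstile>[Eras] T \<Colon> Univ p"
    and r: "S; \<Gamma> \<turnstile>[\<sigma>] r \<Colon> sub (case_nat (reflT a A x) (case_nat x Var)) T"
  shows has_type_J_body: "S; \<Gamma> \<turnstile>[Eras] y \<Colon> A \<Longrightarrow> S; \<Gamma> \<turnstile>[\<sigma>] e \<Colon> idT a A x y \<Longrightarrow>
      S; \<Gamma> \<turnstile>[\<sigma>] jT a p A x (Lam Run (Lam Run T)) r y e \<Colon> sub (case_nat e (case_nat y Var)) T"
    and J_body_refl: "S; \<Gamma> \<turnstile> e \<doteq> reflT a A x \<Colon> idT a A x x \<Longrightarrow> S; \<Gamma> \<turnstile>[Eras] e \<Colon> idT a A x x \<Longrightarrow>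
      S; \<Gamma> \<turnstile> jT a p A x (Lam Run (Lam Run T)) r x e \<doteq> r
        \<Colon> sub (case_nat (reflT a A x) (case_nat x Var)) T"
proof -
  let ?P = "Lam Run (Lam Run T)"
  have ok: "S \<turnstile> \<Gamma> ok" using A by (rule has_type_ctx)
  have inst_P: "inst (App Run (App Run (ren Suc P) (ren Suc y)) (Var 0)) e = App Run (App Run P y) e"
    for P y e :: "'a tm"
    by (simp add: inst_def)
  have P: "S; \<Gamma> \<turnstile>[Eras] ?P \<Colon> Pi Run A (Pi Run (idT a (ren Suc A) (ren Suc x) (Var 0)) (Univ p))"
    using T by (intro ty_lam)
  have beta: "S; \<Gamma> \<turnstile> App Run (App Run ?P y) e \<doteq> sub (case_nat e (case_nat y Var)) T \<Colon> Univ p"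
    if "S; \<Gamma> \<turnstile>[Eras] y \<Colon> A" "S; \<Gamma> \<turnstile>[Eras] e \<Colon> idT a A x y" for y e
    using beta2_Var[OF ok T, of y e] that by simp
  have refl: "S; \<Gamma> \<turnstile>[m] reflT a A x \<Colon> idT a A x x" for m using A x by (rule has_type_refl)
  have r': "S; \<Gamma> \<turnstile>[\<sigma>] r \<Colon> App Run (App Run ?P x) (reflT a A x)"
    using r beta[OF x refl] by (blast intro: ty_conv eq_sym)
  show body: "S; \<Gamma> \<turnstile>[\<sigma>] jT a p A x ?P r y e \<Colon> sub (case_nat e (case_nat y Var)) T"
    if "S; \<Gamma> \<turnstile>[Eras] y \<Colon> A" "S; \<Gamma> \<turnstile>[\<sigma>] e \<Colon> idT a A x y" for y e
    using has_type_J[OF A x P r' that] beta[OF that(1) erase[OF that(2)]] by (rule ty_conv)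
  show "S; \<Gamma> \<turnstile> jT a p A x ?P r x e \<doteq> r \<Colon> sub (case_nat (reflT a A x) (case_nat x Var)) T"
    if e: "S; \<Gamma> \<turnstile> e \<doteq> reflT a A x \<Colon> idT a A x x" and te: "S; \<Gamma> \<turnstile>[Eras] e \<Colon> idT a A x x"
  proof -
    \<comment> \<open>\<open>eq_app\<close> assigns the type determined by the left argument.
      Starting from \<open>refl\<close> thus yields the motive at \<open>refl\<close>, which is the
      type of \<open>r\<close>; the equation is turned around afterwards.\<close>
    have "S; \<Gamma> \<turnstile> jT a p A x ?P r x (reflT a A x) \<doteq> jT a p A x ?P r x e \<Colon>
        App Run (App Run ?P x) (reflT a A x)"
      using eq_app[OF eq_refl[OF has_type_J_fun[OF A x P erase[OF r'] x]] eq_sym[OF e]]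
      unfolding inst_P .
    from eq_conv[OF this beta[OF x refl]]
    have "S; \<Gamma> \<turnstile> jT a p A x ?P r x e \<doteq> jT a p A x ?P r x (reflT a A x) \<Colon>
        sub (case_nat (reflT a A x) (case_nat x Var)) T" by (rule eq_sym)
    moreover have "S; \<Gamma> \<turnstile> jT a p A x ?P r x (reflT a A x) \<doteq> r \<Colon>
        sub (case_nat (reflT a A x) (case_nat x Var)) T"
      using comp_refl erase[OF body[OF x refl]] erase[OF r] by (rule eq_comp)
    ultimately show ?thesis by (rule eq_trans)
  qed
qed


section \<open>Casts along erased proofs and identity elimination for erased proofs\<close>

lemma has_type_any: "S; \<Gamma> \<turnstile>[Run] t \<Colon> A \<Longrightarrow> S; \<Gamma> \<turnstile>[\<sigma>] t \<Colon> A"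
  by (cases \<sigma>) (auto intro: erase)

lemma has_type_box_cong:
  assumes f: "S; [] \<turnstile>[Run] f \<Colon> box_cong_type a"
    and A: "S; \<Gamma> \<turnstile>[Eras] A \<Colon> Univ a" and x: "S; \<Gamma> \<turnstile>[Eras] x \<Colon> A" and y: "S; \<Gamma> \<turnstile>[Eras] y \<Colon> A"
    and e: "S; \<Gamma> \<turnstile>[Eras] e \<Colon> idT a A x y"
  shows "S; \<Gamma> \<turnstile>[\<sigma>] App Eras (App Eras (App Eras (App Eras f A) x) y) e \<Colon>
    idT a (erasedT a A) (boxT a A x) (boxT a A y)"
proof -
  have "S; \<Gamma> \<turnstile>[\<sigma>] f \<Colon> box_cong_type a"
    using weaken_closed[OF f has_type_ctx[OF A]] by (rule has_type_any)
  then have "S; \<Gamma> \<turnstile>[\<sigma>] f \<Colon> Pi Eras (Univ a) (Pi Eras (Var 0) (Pi Eras (Var 1)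
    (Pi Eras (idT a (Var 2) (Var 1) (Var 0))
      (idT a (erasedT a (Var 3)) (boxT a (Var 3) (Var 2)) (boxT a (Var 3) (Var 1))))))"
    by (simp add: box_cong_type_def named_defs eval_nat_numeral)
  from has_type_app[OF has_type_app[OF has_type_app[OF has_type_app[OF this]]]] show ?thesis
    using A x y e by (simp add: inst_def eval_nat_numeral)
qed

text \<open>The proof \<open>e\<close> that arrives here in the end is a \<open>J\<close> term that
  only reduces to \<open>refl\<close>, hence the hypothesis up to definitional equality.\<close>

lemma box_cong_refl:
  assumes f: "S; [] \<turnstile>[Run] f \<Colon> box_cong_type a" and comp: "box_cong_comp S a f"
    and A: "S; \<Gamma> \<turnstile>[Eras] A \<Colon> Univ a" and x: "S; \<Gamma> \<turnstile>[Eras] x \<Colon> A"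
    and e: "S; \<Gamma> \<turnstile> e \<doteq> reflT a A x \<Colon> idT a A x x"
  shows "S; \<Gamma> \<turnstile> App Eras (App Eras (App Eras (App Eras f A) x) x) e \<doteq>
    reflT a (erasedT a A) (boxT a A x) \<Colon> idT a (erasedT a A) (boxT a A x) (boxT a A x)"
proof -
  have ok: "S \<turnstile> \<Gamma> ok" using A by (rule has_type_ctx)
  have closed: "scoped 0 f" using f by (rule has_type_closed)
  have "S; \<Gamma> \<turnstile>[Eras] f \<Colon> box_cong_type a"
    using weaken_closed[OF f ok] by (rule erase)
  then have "S; \<Gamma> \<turnstile>[Eras] f \<Colon> Pi Eras (Univ a) (Pi Eras (Var 0) (Pi Eras (Var 1)
    (Pi Eras (idT a (Var 2) (Var 1) (Var 0))
      (idT a (erasedT a (Var 3)) (boxT a (Var 3) (Var 2)) (boxT a (Var 3) (Var 1))))))"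
    by (simp add: box_cong_type_def named_defs eval_nat_numeral)
  from has_type_app[OF has_type_app[OF has_type_app[OF this]]]
  have "S; \<Gamma> \<turnstile>[Eras] App Eras (App Eras (App Eras f A) x) x \<Colon> Pi Eras (idT a A x x)
      (ren Suc (idT a (erasedT a A) (boxT a A x) (boxT a A x)))"
    using A x by (simp add: inst_def eval_nat_numeral)
  from eq_app[OF eq_refl[OF this] e]
  have "S; \<Gamma> \<turnstile> App Eras (App Eras (App Eras (App Eras f A) x) x) e \<doteq>
    App Eras (App Eras (App Eras (App Eras f A) x) x) (reflT a A x) \<Colon>
    idT a (erasedT a A) (boxT a A x) (boxT a A x)"
    by (simp add: inst_def)
  \<comment> \<open>The assumed computation rule speaks about two generic variables; the
    substitution lemma transfers it to the terms \<open>A\<close> and \<open>x\<close>.\<close>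
  moreover have "S; [(Eras, Var 0), (Eras, Univ a)] \<turnstile>
    App Eras (App Eras (App Eras (App Eras f (Var 1)) (Var 0)) (Var 0)) (reflT a (Var 1) (Var 0)) \<doteq>
    reflT a (erasedT a (Var 1)) (boxT a (Var 1) (Var 0)) \<Colon>
    idT a (erasedT a (Var 1)) (boxT a (Var 1) (Var 0)) (boxT a (Var 1) (Var 0))"
    using comp closed by (simp add: box_cong_comp_def assuming_def equal_def closed_def named_defs
        wk_closed ren_closed)
  from subst_eq[OF ok this, of "case_nat x (case_nat A Var)"]
  have "S; \<Gamma> \<turnstile> App Eras (App Eras (App Eras (App Eras f A) x) x) (reflT a A x) \<doteq>
    reflT a (erasedT a A) (boxT a A x) \<Colon> idT a (erasedT a A) (boxT a A x) (boxT a A x)"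
    using A x by (simp add: substs_Cons substs_Nil sub_closed closed)
  ultimately show ?thesis by (rule eq_trans)
qed

text \<open>\<open>A\<close>, \<open>B\<close> and \<open>q\<close> occur only inside erased
  arguments, of \<open>J\<close> or of \<open>f\<close>, so nothing but \<open>f\<close> and
  \<open>t\<close> has to be a run-time term. The motive at a boxed type is the projection of a box,
  which reduces to the type itself.\<close>

definition cast :: "level \<Rightarrow> 'k tm \<Rightarrow> 'k tm \<Rightarrow> 'k tm \<Rightarrow> 'k tm \<Rightarrow> 'k tm \<Rightarrow> 'k tm" where
  "cast p f A B q t = jT (lsuc p) p (erasedT (lsuc p) (Univ p)) (boxT (lsuc p) (Univ p) A)
    (Lam Run (Lam Run (projT (lsuc p) (Univ p) (Var 1)))) t (boxT (lsuc p) (Univ p) B)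
    (App Eras (App Eras (App Eras (App Eras f (Univ p)) A) B) q)"

lemma
  assumes f: "S; [] \<turnstile>[Run] f \<Colon> box_cong_type (lsuc p)"
    and A: "S; \<Gamma> \<turnstile>[Eras] A \<Colon> Univ p" and t: "S; \<Gamma> \<turnstile>[\<sigma>] t \<Colon> A"
  shows has_type_cast: "S; \<Gamma> \<turnstile>[Eras] B \<Colon> Univ p \<Longrightarrow>
      S; \<Gamma> \<turnstile>[Eras] q \<Colon> idT (lsuc p) (Univ p) A B \<Longrightarrow> S; \<Gamma> \<turnstile>[\<sigma>] cast p f A B q t \<Colon> B"
    and cast_refl: "box_cong_comp S (lsuc p) f \<Longrightarrow>
      S; \<Gamma> \<turnstile>[Eras] q \<Colon> idT (lsuc p) (Univ p) A A \<Longrightarrow>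
      S; \<Gamma> \<turnstile> q \<doteq> reflT (lsuc p) (Univ p) A \<Colon> idT (lsuc p) (Univ p) A A \<Longrightarrow>
      S; \<Gamma> \<turnstile> cast p f A A q t \<doteq> t \<Colon> A"
proof -
  let ?E = "erasedT (lsuc p) (Univ p)" and ?T = "projT (lsuc p) (Univ p) (Var 1)"
  have ok: "S \<turnstile> \<Gamma> ok" using A by (rule has_type_ctx)
  have U: "S; \<Theta> \<turnstile>[m] Univ p \<Colon> Univ (lsuc p)" if "S \<turnstile> \<Theta> ok" for \<Theta> m
    using that by (rule ty_univ)
  note E = has_type_Erased[OF U]
  have box: "S; \<Gamma> \<turnstile>[m] boxT (lsuc p) (Univ p) X \<Colon> ?E" if "S; \<Gamma> \<turnstile>[Eras] X \<Colon> Univ p" for X m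
    using U[OF ok] that by (rule has_type_box)
  have unbox: "S; \<Gamma> \<turnstile> projT (lsuc p) (Univ p) (boxT (lsuc p) (Univ p) X) \<doteq> X \<Colon> Univ p"
    if "S; \<Gamma> \<turnstile>[Eras] X \<Colon> Univ p" for X
    using comp_proj has_type_proj[OF U[OF ok] box[OF that]] that by (rule eq_comp)
  have ok1: "S \<turnstile> (Run, ?E) # \<Gamma> ok" using E[OF ok] by (blast intro: is_typeI is_type_ctx)
  have "S; (Run, ?E) # \<Gamma> \<turnstile>[Eras] idT (lsuc p) ?E (ren Suc (boxT (lsuc p) (Univ p) A)) (Var 0) \<Colon>
      Univ (lsuc p)"
    using ok1 E[OF ok1] weaken[OF ok1 box[OF A]] by (intro has_type_Id has_type_var) auto
  then have "S \<turnstile> (Run, idT (lsuc p) ?E (ren Suc (boxT (lsuc p) (Univ p) A)) (Var 0)) # (Run, ?E) # \<Gamma> ok"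
    by (blast intro: is_typeI is_type_ctx)
  then have T: "S; (Run, idT (lsuc p) (ren Suc ?E) (ren Suc (boxT (lsuc p) (Univ p) A)) (Var 0)) #
      (Run, ?E) # \<Gamma> \<turnstile>[Eras] ?T \<Colon> Univ p"
    by (intro has_type_proj has_type_var U) auto
  have t': "S; \<Gamma> \<turnstile>[\<sigma>] t \<Colon> sub (case_nat (reflT (lsuc p) ?E (boxT (lsuc p) (Univ p) A))
      (case_nat (boxT (lsuc p) (Univ p) A) Var)) ?T"
    using t eq_sym[OF unbox[OF A]] by simp (rule ty_conv)
  show "S; \<Gamma> \<turnstile>[\<sigma>] cast p f A B q t \<Colon> B"
    if B: "S; \<Gamma> \<turnstile>[Eras] B \<Colon> Univ p" and q: "S; \<Gamma> \<turnstile>[Eras] q \<Colon> idT (lsuc p) (Univ p) A B"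
    using has_type_J_body[OF E[OF ok] box[OF A] T t' box[OF B]
        has_type_box_cong[OF f U[OF ok] A B q]] unbox[OF B]
    by (auto simp: cast_def intro: ty_conv)
  show "S; \<Gamma> \<turnstile> cast p f A A q t \<doteq> t \<Colon> A"
    if comp: "box_cong_comp S (lsuc p) f" and q: "S; \<Gamma> \<turnstile>[Eras] q \<Colon> idT (lsuc p) (Univ p) A A"
      "S; \<Gamma> \<turnstile> q \<doteq> reflT (lsuc p) (Univ p) A \<Colon> idT (lsuc p) (Univ p) A A"
    using J_body_refl[OF E[OF ok] box[OF A] T t' box_cong_refl[OF f comp U[OF ok] A q(2)]
        has_type_box_cong[OF f U[OF ok] A A q(1)]] unbox[OF A]
    by (auto simp: cast_def intro: eq_conv)
qed

text \<open>\<open>T\<close> has the endpoint as \<open>Var 1\<close> and the proof as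
  \<open>Var 0\<close>. The inner \<open>J\<close> eliminates into an identity type between elements
  of \<open>Univ p\<close>, hence its level \<open>lsuc p\<close>. It is passed to the cast as an
  erased proof, which is why \<open>e\<close> may be erased.\<close>

definition erasedJ :: "level \<Rightarrow> level \<Rightarrow> 'k tm \<Rightarrow> 'k tm \<Rightarrow> 'k tm \<Rightarrow> 'k tm \<Rightarrow> 'k tm \<Rightarrow> 'k tm \<Rightarrow> 'k tm \<Rightarrow> 'k tm"
where
  "erasedJ a p f A x T r y e =
    (let T\<^sub>0 = sub (case_nat (reflT a A x) (case_nat x Var)) T in
      cast p f T\<^sub>0 (sub (case_nat e (case_nat y Var)) T)
        (jT a (lsuc p) A x (Lam Run (Lam Run (idT (lsuc p) (Univ p) (ren Suc (ren Suc T\<^sub>0)) T)))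
          (reflT (lsuc p) (Univ p) T\<^sub>0) y e)
        r)"

text \<open>Reducing a branch of the vector eliminator substitutes into \<open>erasedJ\<close>; the
  result must again be recognised as an \<open>erasedJ\<close>, now at \<open>refl\<close>.\<close>

lemma sub_erasedJ:
  "scoped 0 f \<Longrightarrow> sub s (erasedJ a p f A x T r y e) =
    erasedJ a p f (sub s A) (sub s x) (sub (up_sub (up_sub s)) T) (sub s r) (sub s y) (sub s e)"
  by (simp add: erasedJ_def cast_def sub_closed sub_sub_case_nat Let_def)

lemma
  assumes f: "S; [] \<turnstile>[Run] f \<Colon> box_cong_type (lsuc p)"
    and A: "S; \<Gamma> \<turnstile>[Eras] A \<Colon> Univ a" and x: "S; \<Gamma> \<turnstile>[Eras] x \<Colon> A"
    and T: "S; (Run, idT a (ren Suc A) (ren Suc x) (Var 0)) # (Run, A) # \<Gamma> \<turnstile>[Eras] T \<Colon> Univ p"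
    and r: "S; \<Gamma> \<turnstile>[\<sigma>] r \<Colon> sub (case_nat (reflT a A x) (case_nat x Var)) T"
  shows has_type_erasedJ: "S; \<Gamma> \<turnstile>[Eras] y \<Colon> A \<Longrightarrow> S; \<Gamma> \<turnstile>[Eras] e \<Colon> idT a A x y \<Longrightarrow>
      S; \<Gamma> \<turnstile>[\<sigma>] erasedJ a p f A x T r y e \<Colon> sub (case_nat e (case_nat y Var)) T"
    and erasedJ_refl: "box_cong_comp S (lsuc p) f \<Longrightarrow>
      S; \<Gamma> \<turnstile> erasedJ a p f A x T r x (reflT a A x) \<doteq> r
        \<Colon> sub (case_nat (reflT a A x) (case_nat x Var)) T"
proof -
  define T0 where "T0 = sub (case_nat (reflT a A x) (case_nat x Var)) T"
  let ?Q = "idT (lsuc p) (Univ p) (ren Suc (ren Suc T0)) T"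
  have ok: "S \<turnstile> \<Gamma> ok" using A by (rule has_type_ctx)
  have ok2: "S \<turnstile> (Run, idT a (ren Suc A) (ren Suc x) (Var 0)) # (Run, A) # \<Gamma> ok"
    using T by (rule has_type_ctx)
  have ok1: "S \<turnstile> (Run, A) # \<Gamma> ok" using ok2 by (rule ctx_tail)
  have refl: "S; \<Gamma> \<turnstile>[Eras] reflT a A x \<Colon> idT a A x x" using A x by (rule has_type_refl)
  have T_sub: "S; \<Gamma> \<turnstile>[Eras] sub (case_nat e (case_nat y Var)) T \<Colon> Univ p"
    if "S; \<Gamma> \<turnstile>[Eras] y \<Colon> A" "S; \<Gamma> \<turnstile>[Eras] e \<Colon> idT a A x y" for y e
    using subst[OF ok T, of "case_nat e (case_nat y Var)"] that ok
    by (simp add: substs_Cons substs_Var)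
  have T0: "S; \<Gamma> \<turnstile>[Eras] T0 \<Colon> Univ p" using T_sub[OF x refl] by (simp add: T0_def)
  have "S; (Run, idT a (ren Suc A) (ren Suc x) (Var 0)) # (Run, A) # \<Gamma> \<turnstile>[Eras]
      ren Suc (ren Suc T0) \<Colon> Univ p"
    using weaken[OF ok2 weaken[OF ok1 T0]] by simp
  then have Q: "S; (Run, idT a (ren Suc A) (ren Suc x) (Var 0)) # (Run, A) # \<Gamma> \<turnstile>[Eras]
      ?Q \<Colon> Univ (lsuc p)"
    using T ok2 by (intro has_type_Id ty_univ)
  have Q_sub: "sub (case_nat e (case_nat y Var)) ?Q =
      idT (lsuc p) (Univ p) T0 (sub (case_nat e (case_nat y Var)) T)" for y e by simp
  have reflQ: "S; \<Gamma> \<turnstile>[Eras] reflT (lsuc p) (Univ p) T0 \<Colon>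
      sub (case_nat (reflT a A x) (case_nat x Var)) ?Q"
    using has_type_refl[OF ty_univ[OF ok] T0, of Eras] unfolding Q_sub T0_def by simp
  have q: "S; \<Gamma> \<turnstile>[Eras] jT a (lsuc p) A x (Lam Run (Lam Run ?Q)) (reflT (lsuc p) (Univ p) T0) y e \<Colon>
      idT (lsuc p) (Univ p) T0 (sub (case_nat e (case_nat y Var)) T)"
    if "S; \<Gamma> \<turnstile>[Eras] y \<Colon> A" "S; \<Gamma> \<turnstile>[Eras] e \<Colon> idT a A x y" for y e
    using has_type_J_body[OF A x Q reflQ that] unfolding Q_sub .
  have r0: "S; \<Gamma> \<turnstile>[\<sigma>] r \<Colon> T0" using r by (simp add: T0_def)
  show "S; \<Gamma> \<turnstile>[\<sigma>] erasedJ a p f A x T r y e \<Colon> sub (case_nat e (case_nat y Var)) T"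
    if "S; \<Gamma> \<turnstile>[Eras] y \<Colon> A" "S; \<Gamma> \<turnstile>[Eras] e \<Colon> idT a A x y"
    using has_type_cast[OF f T0 r0 T_sub[OF that] q[OF that]]
    by (simp add: erasedJ_def T0_def Let_def)
  show "S; \<Gamma> \<turnstile> erasedJ a p f A x T r x (reflT a A x) \<doteq> r
      \<Colon> sub (case_nat (reflT a A x) (case_nat x Var)) T"
    if comp: "box_cong_comp S (lsuc p) f"
  proof -
    \<comment> \<open>At \<open>refl\<close> both sides of the type equation are \<open>T0\<close>,
      and its proof reduces to \<open>refl\<close>. This is the condition under which the cast
      disappears.\<close>
    have "S; \<Gamma> \<turnstile> jT a (lsuc p) A x (Lam Run (Lam Run ?Q)) (reflT (lsuc p) (Univ p) T0) x (reflT a A x)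
        \<doteq> reflT (lsuc p) (Univ p) T0 \<Colon> idT (lsuc p) (Univ p) T0 T0"
      using J_body_refl[OF A x Q reflQ eq_refl[OF refl] refl] unfolding Q_sub
      by (simp add: T0_def)
    from cast_refl[OF f T0 r0 comp _ this] q[OF x refl] show ?thesis
      by (simp add: erasedJ_def T0_def Let_def)
  qed
qed

section \<open>Vector elimination\<close>

text \<open>\<open>eq_pi\<close> asks for a typing of the left domain in addition to the equation,
  so both are kept together and can be passed through nested function types.\<close>

definition type_eq :: "'k extension \<Rightarrow> 'k ctx \<Rightarrow> 'k tm \<Rightarrow> 'k tm \<Rightarrow> bool" where
  "type_eq S \<Gamma> A B \<longleftrightarrow> (\<exists>l. S; \<Gamma> \<turnstile>[Eras] A \<Colon> Univ l \<and> S; \<Gamma> \<turnstile> A \<doteq> B \<Colon> Univ l)"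

lemma type_eqI: "S; \<Gamma> \<turnstile>[Eras] A \<Colon> Univ l \<Longrightarrow> S; \<Gamma> \<turnstile> A \<doteq> B \<Colon> Univ l \<Longrightarrow> type_eq S \<Gamma> A B"
  unfolding type_eq_def by blast

lemma type_eq_refl: "is_type S \<Gamma> A \<Longrightarrow> type_eq S \<Gamma> A A"
  unfolding type_eq_def is_type_def by (blast intro: eq_refl)

lemma type_eq_Pi:
  "type_eq S \<Gamma> A A' \<Longrightarrow> type_eq S ((\<rho>, A) # \<Gamma>) B B' \<Longrightarrow> type_eq S \<Gamma> (Pi \<rho> A B) (Pi \<rho> A' B')"
  unfolding type_eq_def by (blast intro: ty_pi eq_pi)

lemma type_eq_Pi_right:
  assumes "type_eq S ((\<rho>, A) # \<Gamma>) B B'"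
  shows "type_eq S \<Gamma> (Pi \<rho> A B) (Pi \<rho> A B')"
proof -
  from assms have "S \<turnstile> (\<rho>, A) # \<Gamma> ok"
    unfolding type_eq_def by (blast intro: has_type_ctx)
  then have "is_type S \<Gamma> A" unfolding is_type_def by (auto elim: wf_ctx.cases)
  then show ?thesis using assms by (intro type_eq_Pi type_eq_refl)
qed

lemma has_type_type_eq: "S; \<Gamma> \<turnstile>[\<sigma>] t \<Colon> A \<Longrightarrow> type_eq S \<Gamma> A B \<Longrightarrow> S; \<Gamma> \<turnstile>[\<sigma>] t \<Colon> B"
  unfolding type_eq_def by (blast intro: ty_conv)

lemma has_type_app_sub:
  assumes "S; \<Gamma> \<turnstile>[\<sigma>] t \<Colon> sub s (Pi \<rho> A B)" "S; \<Gamma> \<turnstile>[arg_mode \<sigma> \<rho>] u \<Colon> sub s A"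
  shows "S; \<Gamma> \<turnstile>[\<sigma>] App \<rho> t u \<Colon> sub (case_nat u s) B"
  using ty_app[OF assms(1)[unfolded sub.simps], of u] assms(2) by (simp add: inst_def)

text \<open>The motive \<open>M\<close>, with two free variables, at \<open>n\<close> and \<open>xs\<close> in a context with \<open>k\<close> more variables.\<close>

abbreviation "motive_at k M n xs \<equiv> sub (case_nat xs (case_nat n (\<lambda>i. Var (i + k)))) M"

abbreviation "nil_ctx \<Gamma> \<equiv>
  (Eras, idT lzero (Const Nat) (Const Zero) (Var 0)) # (Eras, Const Nat) # \<Gamma>"

abbreviation "cons_ctx a A \<Gamma> \<equiv>
  (Eras, idT lzero (Const Nat) (sucT (Var 2)) (Var 3)) # (Run, vecT a (wk 3 A) (Var 1)) #
  (Run, wk 2 A) # (Eras, Const Nat) # (Eras, Const Nat) # \<Gamma>"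

abbreviation "nil_motive a A M \<equiv> motive_at 2 M (Var 1) (nilT a (wk 2 A) (Var 1) (Var 0))"

abbreviation "ih_motive M \<equiv> motive_at 5 M (Var 3) (Var 1)"

abbreviation "cons_motive a A M \<equiv>
  motive_at 6 M (Var 5) (consT a (wk 6 A) (Var 5) (Var 4) (Var 3) (Var 2) (Var 1))"

abbreviation "vecElimB a p A M z c n xs \<equiv>
  vecElimT a p A (Lam Run (Lam Run M)) (Lam Eras (Lam Eras z))
    (Lam Eras (Lam Eras (Lam Run (Lam Run (Lam Eras (Lam Run c)))))) n xs"

text \<open>The constant \<open>VecElim\<close> expects branch types with applied motives, while its
  uses here have reduced ones. The conversions below the binders of the two branch types are made
  once and for all in this proof.\<close>

lemma
  assumes A: "S; \<Gamma> \<turnstile>[Eras] A \<Colon> Univ a"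
    and M: "S; (Run, vecT a (ren Suc A) (Var 0)) # (Run, Const Nat) # \<Gamma> \<turnstile>[Eras] M \<Colon> Univ p"
    and z: "S; nil_ctx \<Gamma> \<turnstile>[\<sigma>] z \<Colon> nil_motive a A M"
    and c: "S; (Run, ih_motive M) # cons_ctx a A \<Gamma> \<turnstile>[\<sigma>] c \<Colon> cons_motive a A M"
  shows has_type_VecElim_body: "S; \<Gamma> \<turnstile>[Eras] n \<Colon> Const Nat \<Longrightarrow> S; \<Gamma> \<turnstile>[\<sigma>] xs \<Colon> vecT a A n \<Longrightarrow>
      S; \<Gamma> \<turnstile>[\<sigma>] vecElimB a p A M z c n xs \<Colon> motive_at 0 M n xs"
    and VecElim_body_nil: "S; \<Gamma> \<turnstile>[Eras] n \<Colon> Const Nat \<Longrightarrow>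
      S; \<Gamma> \<turnstile>[Eras] e \<Colon> idT lzero (Const Nat) (Const Zero) n \<Longrightarrow>
      S; \<Gamma> \<turnstile> vecElimB a p A M z c n (nilT a A n e) \<doteq> sub (case_nat e (case_nat n Var)) z
        \<Colon> motive_at 0 M n (nilT a A n e)"
    and VecElim_body_cons: "S; \<Gamma> \<turnstile>[Eras] n \<Colon> Const Nat \<Longrightarrow> S; \<Gamma> \<turnstile>[Eras] m \<Colon> Const Nat \<Longrightarrow>
      S; \<Gamma> \<turnstile>[Eras] x \<Colon> A \<Longrightarrow> S; \<Gamma> \<turnstile>[Eras] xs \<Colon> vecT a A m \<Longrightarrow>
      S; \<Gamma> \<turnstile>[Eras] e \<Colon> idT lzero (Const Nat) (sucT m) n \<Longrightarrow>
      S; \<Gamma> \<turnstile> vecElimB a p A M z c n (consT a A n m x xs e) \<doteq>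
        sub (case_nat (vecElimB a p A M z c m xs)
          (case_nat e (case_nat xs (case_nat x (case_nat m (case_nat n Var)))))) c
        \<Colon> motive_at 0 M n (consT a A n m x xs e)"
proof -
  let ?P = "Lam Run (Lam Run M)" and ?z = "Lam Eras (Lam Eras z)"
    and ?c = "Lam Eras (Lam Eras (Lam Run (Lam Run (Lam Eras (Lam Run c)))))"
  let ?Z = "Pi Eras (Const Nat) (Pi Eras (idT lzero (Const Nat) (Const Zero) (Var 0))
    (nil_motive a A M))"
    and ?C = "Pi Eras (Const Nat) (Pi Eras (Const Nat) (Pi Run (wk 2 A)
      (Pi Run (vecT a (wk 3 A) (Var 1)) (Pi Eras (idT lzero (Const Nat) (sucT (Var 2)) (Var 3))
      (Pi Run (ih_motive M) (cons_motive a A M))))))"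
  have ok: "S \<turnstile> \<Gamma> ok" using A by (rule has_type_ctx)
  have P: "S; \<Gamma> \<turnstile>[Eras] ?P \<Colon> Pi Run (Const Nat) (Pi Run (vecT a (ren Suc A) (Var 0)) (Univ p))"
    using M by (intro ty_lam)
  have z': "S; \<Gamma> \<turnstile>[\<sigma>] ?z \<Colon> ?Z" using z by (intro ty_lam)
  have c': "S; \<Gamma> \<turnstile>[\<sigma>] ?c \<Colon> ?C" using c by (intro ty_lam)
  have wkA: "S; \<Theta> @ \<Gamma> \<turnstile>[Eras] wk (length \<Theta>) A \<Colon> Univ a" if "S \<turnstile> \<Theta> @ \<Gamma> ok" for \<Theta>
    using subst[OF that A substs_wk[OF that]] by (simp add: wk_conv_sub)
  \<comment> \<open>The block \<open>\<Theta>\<close> is arbitrary because the motive is needed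
    under 2 variables in the nil branch, under 5 in the type of the induction hypothesis, under 6 in
    the result of the cons branch, and under none in the conclusions.\<close>
  have M_at: "S; \<Theta> @ \<Gamma> \<turnstile>[Eras] motive_at (length \<Theta>) M n xs \<Colon> Univ p"
    and beta: "S; \<Theta> @ \<Gamma> \<turnstile> App Run (App Run (wk (length \<Theta>) ?P) n) xs \<doteq>
      motive_at (length \<Theta>) M n xs \<Colon> Univ p"
    if "S; \<Theta> @ \<Gamma> \<turnstile>[Eras] n \<Colon> Const Nat" "S; \<Theta> @ \<Gamma> \<turnstile>[Eras] xs \<Colon> vecT a (wk (length \<Theta>) A) n"
    for \<Theta> n xs
  proof -
    have ok': "S \<turnstile> \<Theta> @ \<Gamma> ok" using that(1) by (rule has_type_ctx)
    note s = substs_wk[OF this]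
    have xs: "S; \<Theta> @ \<Gamma> \<turnstile>[Eras] xs \<Colon> sub (case_nat n (\<lambda>i. Var (i + length \<Theta>))) (vecT a (ren Suc A) (Var 0))"
      using that by (simp add: wk_conv_sub)
    show "S; \<Theta> @ \<Gamma> \<turnstile> App Run (App Run (wk (length \<Theta>) ?P) n) xs \<doteq>
      motive_at (length \<Theta>) M n xs \<Colon> Univ p"
      using beta2[OF s M _ xs] that(1) unfolding wk_conv_sub by simp
    show "S; \<Theta> @ \<Gamma> \<turnstile>[Eras] motive_at (length \<Theta>) M n xs \<Colon> Univ p"
      using subst[OF ok' M substs_Cons[OF substs_Cons[OF s]], of n xs] xs that(1) by simp
  qed
  have eq: "type_eq S (\<Theta> @ \<Gamma>) (motive_at k M n xs) (App Run (App Run (wk k ?P) n) xs)"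
    if "S; \<Theta> @ \<Gamma> \<turnstile>[Eras] n \<Colon> Const Nat" "S; \<Theta> @ \<Gamma> \<turnstile>[Eras] xs \<Colon> vecT a (wk k A) n" "k = length \<Theta>"
    for \<Theta> n xs k
    using that M_at beta by (blast intro: type_eqI eq_sym)
  have ok_c: "S \<turnstile> (Run, ih_motive M) # cons_ctx a A \<Gamma> ok" using c by (rule has_type_ctx)
  have z'': "S; \<Gamma> \<turnstile>[\<sigma>] ?z \<Colon> Pi Eras (Const Nat) (Pi Eras (idT lzero (Const Nat) (Const Zero) (Var 0))
      (App Run (App Run (wk 2 ?P) (Var 1)) (nilT a (wk 2 A) (Var 1) (Var 0))))"
  proof (rule has_type_type_eq[OF z'], intro type_eq_Pi_right)
    have ok_z: "S \<turnstile> nil_ctx \<Gamma> ok" using z by (rule has_type_ctx)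
    have n: "S; nil_ctx \<Gamma> \<turnstile>[Eras] Var 1 \<Colon> Const Nat"
      using ok_z by (intro has_type_var) auto
    have "S; nil_ctx \<Gamma> \<turnstile>[Eras] nilT a (wk 2 A) (Var 1) (Var 0) \<Colon> vecT a (wk 2 A) (Var 1)"
      using wkA[of "[_, _]"] ok_z n by (intro has_type_nil has_type_var) (auto simp: eval_nat_numeral)
    from eq[of "[_, _]", simplified, OF n[simplified] this[simplified]]
    show "type_eq S (nil_ctx \<Gamma>) (nil_motive a A M)
        (App Run (App Run (wk 2 ?P) (Var 1)) (nilT a (wk 2 A) (Var 1) (Var 0)))"
      by (simp add: eval_nat_numeral)
  qed
  have c'': "S; \<Gamma> \<turnstile>[\<sigma>] ?c \<Colon> Pi Eras (Const Nat) (Pi Eras (Const Nat) (Pi Run (wk 2 A)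
      (Pi Run (vecT a (wk 3 A) (Var 1)) (Pi Eras (idT lzero (Const Nat) (sucT (Var 2)) (Var 3))
      (Pi Run (App Run (App Run (wk 5 ?P) (Var 3)) (Var 1))
      (App Run (App Run (wk 6 ?P) (Var 5))
        (consT a (wk 6 A) (Var 5) (Var 4) (Var 3) (Var 2) (Var 1))))))))"
  \<comment> \<open>The first five domains agree. The sixth, the type of the induction hypothesis,
    contains the motive, so there domain and codomain are both converted.\<close>
  proof (rule has_type_type_eq[OF c'], intro type_eq_Pi_right type_eq_Pi)
    have ok5: "S \<turnstile> cons_ctx a A \<Gamma> ok" using ok_c by (rule ctx_tail)
    have m: "S; cons_ctx a A \<Gamma> \<turnstile>[Eras] Var 3 \<Colon> Const Nat"
      and xs: "S; cons_ctx a A \<Gamma> \<turnstile>[Eras] Var 1 \<Colon> vecT a (wk 5 A) (Var 3)"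
      using ok5 by (auto simp: eval_nat_numeral intro!: has_type_var)
    show "type_eq S (cons_ctx a A \<Gamma>) (ih_motive M) (App Run (App Run (wk 5 ?P) (Var 3)) (Var 1))"
      by (rule eq[of "[_, _, _, _, _]", unfolded append_Cons append_Nil, OF m xs]) simp
    have n: "S; (Run, ih_motive M) # cons_ctx a A \<Gamma> \<turnstile>[Eras] Var 5 \<Colon> Const Nat"
      using ok_c by (auto simp: eval_nat_numeral intro!: has_type_var)
    have cons: "S; (Run, ih_motive M) # cons_ctx a A \<Gamma> \<turnstile>[Eras]
        consT a (wk 6 A) (Var 5) (Var 4) (Var 3) (Var 2) (Var 1) \<Colon> vecT a (wk 6 A) (Var 5)"
      using wkA[of "[_, _, _, _, _, _]"] ok_c
      by (intro has_type_cons has_type_var) (auto simp: eval_nat_numeral)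
    show "type_eq S ((Run, ih_motive M) # cons_ctx a A \<Gamma>) (cons_motive a A M)
        (App Run (App Run (wk 6 ?P) (Var 5))
          (consT a (wk 6 A) (Var 5) (Var 4) (Var 3) (Var 2) (Var 1)))"
      by (rule eq[of "[_, _, _, _, _, _]", unfolded append_Cons append_Nil, OF n cons]) simp
  qed
  show elim: "S; \<Gamma> \<turnstile>[\<sigma>] vecElimB a p A M z c n xs \<Colon> motive_at 0 M n xs"
    if n: "S; \<Gamma> \<turnstile>[Eras] n \<Colon> Const Nat" and xs: "S; \<Gamma> \<turnstile>[\<sigma>] xs \<Colon> vecT a A n" for n xs
    using has_type_VecElim[OF A P z'' c'' n xs] beta[of "[]" n xs] n erase[OF xs]
    by (auto intro: ty_conv)
  note elim_eras = has_type_VecElim[OF A P erase[OF z''] erase[OF c'']]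
  show "S; \<Gamma> \<turnstile> vecElimB a p A M z c n (nilT a A n e) \<doteq> sub (case_nat e (case_nat n Var)) z
        \<Colon> motive_at 0 M n (nilT a A n e)"
    if n: "S; \<Gamma> \<turnstile>[Eras] n \<Colon> Const Nat" and e: "S; \<Gamma> \<turnstile>[Eras] e \<Colon> idT lzero (Const Nat) (Const Zero) n"
  proof -
    have nil: "S; \<Gamma> \<turnstile>[Eras] nilT a A n e \<Colon> vecT a A n" using A n e by (rule has_type_nil)
    have red: "S; \<Gamma> \<turnstile> App Eras (App Eras ?z n) e \<doteq> sub (case_nat e (case_nat n Var)) z
        \<Colon> motive_at 0 M n (nilT a A n e)"
      using beta2_Var[OF ok erase[OF z] n, of e] e
      by (simp add: sub_sub_case_nat eval_nat_numeral)
    have "S; \<Gamma> \<turnstile>[Eras] App Eras (App Eras ?z n) e \<Colon> motive_at 0 M n (nilT a A n e)"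
      using has_type_app2[OF erase[OF z'] n _ e] by (simp add: inst_def sub_sub_case_nat eval_nat_numeral)
    moreover have "S; \<Gamma> \<turnstile>[Eras] vecElimB a p A M z c n (nilT a A n e) \<Colon> motive_at 0 M n (nilT a A n e)"
      using elim_eras[OF n nil] beta[of "[]" n] n nil by (auto intro: ty_conv)
    ultimately show ?thesis using red by (blast intro: eq_trans eq_comp comp_nil)
  qed
  show "S; \<Gamma> \<turnstile> vecElimB a p A M z c n (consT a A n m x xs e) \<doteq>
        sub (case_nat (vecElimB a p A M z c m xs)
          (case_nat e (case_nat xs (case_nat x (case_nat m (case_nat n Var)))))) c
        \<Colon> motive_at 0 M n (consT a A n m x xs e)"
    if n: "S; \<Gamma> \<turnstile>[Eras] n \<Colon> Const Nat" and m: "S; \<Gamma> \<turnstile>[Eras] m \<Colon> Const Nat" and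
      x: "S; \<Gamma> \<turnstile>[Eras] x \<Colon> A" and xs: "S; \<Gamma> \<turnstile>[Eras] xs \<Colon> vecT a A m" and
      e: "S; \<Gamma> \<turnstile>[Eras] e \<Colon> idT lzero (Const Nat) (sucT m) n"
  proof -
    let ?ih = "vecElimB a p A M z c m xs"
    have cons: "S; \<Gamma> \<turnstile>[Eras] consT a A n m x xs e \<Colon> vecT a A n"
      using A n m x xs e by (rule has_type_cons)
    have ih: "S; \<Gamma> \<turnstile>[Eras] ?ih \<Colon> motive_at 0 M m xs"
      using elim_eras[OF m xs] beta[of "[]" m] m xs by (auto intro: ty_conv)
    \<comment> \<open>\<open>c5\<close> to \<open>c1\<close> type the branch with one to five of its
      innermost variables abstracted; \<open>s0\<close> to \<open>s5\<close> collect the arguments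
      supplied so far. The six contractions then accumulate into one simultaneous
      substitution.\<close>
    note c5 = ty_lam[OF erase[OF c]]
    note c4 = ty_lam[OF c5]
    note c3 = ty_lam[OF c4]
    note c2 = ty_lam[OF c3]
    note c1 = ty_lam[OF c2]
    note s0 = substs_Var[OF ok, of Eras]
    have u1: "S; \<Gamma> \<turnstile>[Eras] n \<Colon> sub Var (Const Nat)" using n by simp
    note s1 = substs_Cons[OF s0, where \<rho> = Eras, unfolded arg_mode_simps, OF u1]
    have u2: "S; \<Gamma> \<turnstile>[Eras] m \<Colon> sub (case_nat n Var) (Const Nat)" using m by simp
    note s2 = substs_Cons[OF s1, where \<rho> = Eras, unfolded arg_mode_simps, OF u2]
    have u3: "S; \<Gamma> \<turnstile>[Eras] x \<Colon> sub (case_nat m (case_nat n Var)) (wk 2 A)"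
      using x by (simp add: eval_nat_numeral)
    note s3 = substs_Cons[OF s2, where \<rho> = Run, unfolded arg_mode_simps, OF u3]
    have u4: "S; \<Gamma> \<turnstile>[Eras] xs \<Colon> sub (case_nat x (case_nat m (case_nat n Var))) (vecT a (wk 3 A) (Var 1))"
      using xs by (simp add: eval_nat_numeral)
    note s4 = substs_Cons[OF s3, where \<rho> = Run, unfolded arg_mode_simps, OF u4]
    have u5: "S; \<Gamma> \<turnstile>[Eras] e \<Colon> sub (case_nat xs (case_nat x (case_nat m (case_nat n Var))))
        (idT lzero (Const Nat) (sucT (Var 2)) (Var 3))"
      using e by (simp add: eval_nat_numeral)
    note s5 = substs_Cons[OF s4, where \<rho> = Eras, unfolded arg_mode_simps, OF u5]
    have u6: "S; \<Gamma> \<turnstile>[Eras] ?ih \<Colon> sub (case_nat e (case_nat xs (case_nat x (case_nat m (case_nat n Var)))))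
        (ih_motive M)"
      using ih by (simp add: sub_sub_case_nat eval_nat_numeral)
    note app = has_type_app_sub[where \<sigma> = Eras, unfolded arg_mode_simps]
    have "S; \<Gamma> \<turnstile>[Eras] ?c \<Colon> sub Var ?C" using erase[OF c'] unfolding sub_Var .
    note t1 = app[OF this u1]
    note t2 = app[OF t1 u2]
    note t3 = app[OF t2 u3]
    note t4 = app[OF t3 u4]
    note t5 = app[OF t4 u5]
    note t6 = app[OF t5 u6]
    have "S; \<Gamma> \<turnstile>[Eras] App Run (App Eras (App Run (App Run (App Eras (App Eras ?c n) m) x) xs) e) ?ih
        \<Colon> motive_at 0 M n (consT a A n m x xs e)"
      using t6 by (simp add: sub_sub_case_nat eval_nat_numeral)
    moreover have "S; \<Gamma> \<turnstile> App Run (App Eras (App Run (App Run (App Eras (App Eras ?c n) m) x) xs) e) ?ih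
        \<doteq> sub (case_nat ?ih (case_nat e (case_nat xs (case_nat x (case_nat m (case_nat n Var)))))) c
        \<Colon> motive_at 0 M n (consT a A n m x xs e)"
    proof -
      have "S; \<Gamma> \<turnstile> ?c \<doteq> sub Var ?c \<Colon> sub Var ?C"
        using eq_refl[OF erase[OF c']] unfolding sub_Var .
      note r1 = beta_step[OF s0 c1 this u1]
      note r2 = beta_step[OF s1 c2 r1 u2]
      note r3 = beta_step[OF s2 c3 r2 u3]
      note r4 = beta_step[OF s3 c4 r3 u4]
      note r5 = beta_step[OF s4 c5 r4 u5]
      note r6 = beta_step[OF s5 erase[OF c] r5 u6]
      then show ?thesis by (simp add: sub_sub_case_nat eval_nat_numeral)
    qed
    moreover have "S; \<Gamma> \<turnstile>[Eras] vecElimB a p A M z c n (consT a A n m x xs e)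
        \<Colon> motive_at 0 M n (consT a A n m x xs e)"
      using elim_eras[OF n cons] beta[of "[]" n] n cons by (auto intro: ty_conv)
    ultimately show ?thesis by (blast intro: eq_trans eq_comp comp_cons)
  qed
qed

section \<open>The eliminator with cases for the empty vector and for \<open>x :: xs\<close>\<close>

lemma has_type_wk:
  "S; \<Gamma> \<turnstile>[\<sigma>] t \<Colon> A \<Longrightarrow> S \<turnstile> \<Theta> @ \<Gamma> ok \<Longrightarrow> S; \<Theta> @ \<Gamma> \<turnstile>[\<sigma>] wk (length \<Theta>) t \<Colon> wk (length \<Theta>) A"
  unfolding wk_conv_sub by (rule subst[OF _ _ substs_wk])

lemma ctx_ok_Nat: "S \<turnstile> \<Gamma> ok \<Longrightarrow> S \<turnstile> (\<rho>, Const Nat) # \<Gamma> ok"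
  by (blast intro: is_type_ctx is_typeI has_type_Nat)

lemma ctx_ok_Id:
  "S; \<Gamma> \<turnstile>[Eras] x \<Colon> A \<Longrightarrow> S; \<Gamma> \<turnstile>[Eras] y \<Colon> A \<Longrightarrow> S; \<Gamma> \<turnstile>[Eras] A \<Colon> Univ a \<Longrightarrow>
    S \<turnstile> (\<rho>, idT a A x y) # \<Gamma> ok"
  by (blast intro: is_type_ctx is_typeI has_type_Id)

lemma ctx_ok_nil: "S \<turnstile> \<Gamma> ok \<Longrightarrow> S \<turnstile> nil_ctx \<Gamma> ok"
  by (intro ctx_ok_Id has_type_Nat has_type_Zero has_type_var ctx_ok_Nat) auto

lemma ctx_ok_cons:
  assumes A: "S; \<Gamma> \<turnstile>[Eras] A \<Colon> Univ a"
  shows "S \<turnstile> cons_ctx a A \<Gamma> ok"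
proof -
  have "S \<turnstile> (Eras, Const Nat) # (Eras, Const Nat) # \<Gamma> ok"
    using has_type_ctx[OF A] by (intro ctx_ok_Nat)
  then have "S \<turnstile> (Run, wk 2 A) # (Eras, Const Nat) # (Eras, Const Nat) # \<Gamma> ok"
    using has_type_wk[OF A, of "[_, _]"]
    by (auto simp: eval_nat_numeral intro!: is_type_ctx is_typeI[where \<sigma> = Eras])
  then have "S \<turnstile> (Run, vecT a (wk 3 A) (Var 1)) # (Run, wk 2 A) # (Eras, Const Nat) # (Eras, Const Nat) # \<Gamma> ok"
    using has_type_wk[OF A, of "[_, _, _]"]
    by (auto simp: eval_nat_numeral intro!: is_type_ctx is_typeI[where \<sigma> = Eras] has_type_Vec has_type_var)
  then show ?thesis
    by (intro ctx_ok_Id has_type_Nat has_type_suc has_type_var) (auto simp: eval_nat_numeral)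
qed

abbreviation "pushT a A n x xs \<equiv>
  consT a A (sucT n) n x xs (reflT lzero (Const Nat) (sucT n))"

abbreviation "emptyT a A \<equiv> nilT a A (Const Zero) (reflT lzero (Const Nat) (Const Zero))"

abbreviation "motiveT a p A \<equiv> Pi Eras (Const Nat) (Pi Run (vecT a (ren Suc A) (Var 0)) (Univ p))"

abbreviation "stepT a A P \<equiv> Pi Eras (Const Nat) (Pi Run (ren Suc A) (Pi Run (vecT a (wk 2 A) (Var 1))
  (Pi Run (App Run (App Eras (wk 3 P) (Var 2)) (Var 0))
    (App Run (App Eras (wk 4 P) (sucT (Var 3))) (pushT a (wk 4 A) (Var 3) (Var 2) (Var 1))))))"

text \<open>The variables of the branch are \<open>e\<close> and \<open>n\<close>, at indices 0 and
  1. Elimination runs from \<open>zero\<close> to \<open>n\<close> along \<open>e\<close>; its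
  motive binds two further variables, hence \<open>wk 4\<close>. At \<open>refl\<close> the motive
  is the type of \<open>z\<close>.\<close>

abbreviation "nil_case a p f A P z \<equiv>
  erasedJ lzero p f (Const Nat) (Const Zero)
    (App Run (App Eras (wk 4 P) (Var 1)) (nilT a (wk 4 A) (Var 1) (Var 0)))
    (wk 2 z) (Var 1) (Var 0)"

text \<open>From index 0 upwards the variables of the branch are \<open>ih\<close>,
  \<open>e\<close>, \<open>xs\<close>, \<open>x\<close>, \<open>m\<close>, \<open>n\<close>; inside
  the motive they are shifted by two. Elimination runs from \<open>suc m\<close> to \<open>n\<close>
  along \<open>e\<close>, and at \<open>refl\<close> the motive is the type of
  \<open>c m x xs ih\<close>.\<close>

abbreviation "cons_case a p f A P c \<equiv>
  erasedJ lzero p f (Const Nat) (sucT (Var 4))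
    (App Run (App Eras (wk 8 P) (Var 1))
      (consT a (wk 8 A) (Var 1) (Var 6) (Var 5) (Var 4) (Var 0)))
    (App Run (App Run (App Run (App Eras (wk 6 c) (Var 4)) (Var 3)) (Var 2)) (Var 0))
    (Var 5) (Var 1)"

text \<open>The motive is abstracted anew because \<open>VecElim\<close> expects an unannotated
  index, whereas the index of \<open>P\<close> is erased.\<close>

abbreviation "vecElim' a p f A P z c n xs \<equiv>
  vecElimB a p A (App Run (App Eras (wk 2 P) (Var 1)) (Var 0))
    (nil_case a p f A P z) (cons_case a p f A P c) n xs"

text \<open>Turning renamings into substitutions and composing them makes terms agree that reach the
  same \<open>A\<close>, \<open>P\<close> or \<open>c\<close> through different sequences of
  weakenings and instantiations.\<close>

lemmas sub_normal = ren_conv_sub sub_sub eval_nat_numeral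

lemma wk_stepT: "wk k (stepT a A P) = stepT a (wk k A) (wk k P)"
  by (simp add: wk_conv_sub sub_normal)

text \<open>The last argument is left out so that \<open>eq_app\<close> can later replace one form
  of the recursive call by another.\<close>

lemma has_type_step:
  assumes "S; \<Gamma> \<turnstile>[\<sigma>] c \<Colon> stepT a A P" "S; \<Gamma> \<turnstile>[Eras] n \<Colon> Const Nat"
    "S; \<Gamma> \<turnstile>[\<sigma>] x \<Colon> A" "S; \<Gamma> \<turnstile>[\<sigma>] xs \<Colon> vecT a A n"
  shows "S; \<Gamma> \<turnstile>[\<sigma>] App Run (App Run (App Eras c n) x) xs \<Colon> Pi Run (App Run (App Eras P n) xs)
    (ren Suc (App Run (App Eras P (sucT n)) (pushT a A n x xs)))"
proof -
  have "S; \<Gamma> \<turnstile>[\<sigma>] c \<Colon> sub Var (stepT a A P)" using assms(1) unfolding sub_Var .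
  from has_type_app_sub[OF this] assms(2)
  have "S; \<Gamma> \<turnstile>[\<sigma>] App Eras c n \<Colon> sub (case_nat n Var) (Pi Run (ren Suc A)
      (Pi Run (vecT a (wk 2 A) (Var 1)) (Pi Run (App Run (App Eras (wk 3 P) (Var 2)) (Var 0))
      (App Run (App Eras (wk 4 P) (sucT (Var 3))) (pushT a (wk 4 A) (Var 3) (Var 2) (Var 1))))))"
    by simp
  from has_type_app_sub[OF this] assms(3)
  have "S; \<Gamma> \<turnstile>[\<sigma>] App Run (App Eras c n) x \<Colon> sub (case_nat x (case_nat n Var))
      (Pi Run (vecT a (wk 2 A) (Var 1)) (Pi Run (App Run (App Eras (wk 3 P) (Var 2)) (Var 0))
      (App Run (App Eras (wk 4 P) (sucT (Var 3))) (pushT a (wk 4 A) (Var 3) (Var 2) (Var 1)))))"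
    by (simp add: eval_nat_numeral)
  from has_type_app_sub[OF this] assms(4) show ?thesis by (simp add: eval_nat_numeral)
qed

text \<open>In both computation rules the standard rule fires first and leaves
  \<open>erasedJ\<close> at the proof stored in the derived constructor. That proof is
  \<open>refl\<close>, so \<open>erasedJ\<close> collapses to the given case.\<close>

lemma
  assumes f: "S; [] \<turnstile>[Run] f \<Colon> box_cong_type (lsuc p)"
    and A: "S; \<Gamma> \<turnstile>[Eras] A \<Colon> Univ a" and P: "S; \<Gamma> \<turnstile>[Eras] P \<Colon> motiveT a p A"
    and z: "S; \<Gamma> \<turnstile>[\<sigma>] z \<Colon> App Run (App Eras P (Const Zero)) (emptyT a A)"
    and c: "S; \<Gamma> \<turnstile>[\<sigma>] c \<Colon> stepT a A P"
  shows has_type_vecElim': "S; \<Gamma> \<turnstile>[Eras] n \<Colon> Const Nat \<Longrightarrow> S; \<Gamma> \<turnstile>[\<sigma>] xs \<Colon> vecT a A n \<Longrightarrow>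
      S; \<Gamma> \<turnstile>[\<sigma>] vecElim' a p f A P z c n xs \<Colon> App Run (App Eras P n) xs"
    and vecElim'_empty: "box_cong_comp S (lsuc p) f \<Longrightarrow>
      S; \<Gamma> \<turnstile> vecElim' a p f A P z c (Const Zero) (emptyT a A) \<doteq> z
        \<Colon> App Run (App Eras P (Const Zero)) (emptyT a A)"
    and vecElim'_push: "box_cong_comp S (lsuc p) f \<Longrightarrow> S; \<Gamma> \<turnstile>[Eras] n \<Colon> Const Nat \<Longrightarrow>
      S; \<Gamma> \<turnstile>[Eras] x \<Colon> A \<Longrightarrow> S; \<Gamma> \<turnstile>[Eras] xs \<Colon> vecT a A n \<Longrightarrow>
      S; \<Gamma> \<turnstile> vecElim' a p f A P z c (sucT n) (pushT a A n x xs) \<doteq>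
        App Run (App Run (App Run (App Eras c n) x) xs) (vecElim' a p f A P z c n xs)
        \<Colon> App Run (App Eras P (sucT n)) (pushT a A n x xs)"
proof -
  let ?M = "App Run (App Eras (wk 2 P) (Var 1)) (Var 0)"
    and ?z = "nil_case a p f A P z" and ?c = "cons_case a p f A P c"
  have closed: "scoped 0 f" using f by (rule has_type_closed)
  have ok: "S \<turnstile> \<Gamma> ok" using A by (rule has_type_ctx)
  have app_P: "S; \<Theta> @ \<Gamma> \<turnstile>[Eras] App Run (App Eras (wk k P) n) xs \<Colon> Univ p"
    if "k = length \<Theta>" "S; \<Theta> @ \<Gamma> \<turnstile>[Eras] n \<Colon> Const Nat" "S; \<Theta> @ \<Gamma> \<turnstile>[Eras] xs \<Colon> vecT a (wk k A) n"
    for \<Theta> k n xs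
  proof -
    have "S; \<Theta> @ \<Gamma> \<turnstile>[Eras] wk k P \<Colon>
        Pi Eras (Const Nat) (Pi Run (vecT a (ren Suc (wk k A)) (Var 0)) (Univ p))"
      using has_type_wk[OF P has_type_ctx[OF that(2)]] that(1)
      by (simp add: wk_conv_sub)
    from has_type_app2[OF this that(2) _ that(3)] show ?thesis by (simp add: inst_def)
  qed
  have wkA: "S; \<Theta> @ \<Gamma> \<turnstile>[Eras] wk k A \<Colon> Univ a" if "S \<turnstile> \<Theta> @ \<Gamma> ok" "k = length \<Theta>" for \<Theta> k
    using has_type_wk[OF A that(1)] that(2) by (simp add: wk_conv_sub)
  note app_P2 = app_P[of _ "[_, _]", unfolded append_Cons append_Nil]
    and app_P4 = app_P[of _ "[_, _, _, _]", unfolded append_Cons append_Nil]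
    and app_P5 = app_P[of _ "[_, _, _, _, _]", unfolded append_Cons append_Nil]
    and app_P8 = app_P[of _ "[_, _, _, _, _, _, _, _]", unfolded append_Cons append_Nil]
  note wkA1 = wkA[of "[_]", unfolded append_Cons append_Nil]
    and wkA2 = wkA[of "[_, _]", unfolded append_Cons append_Nil]
    and wkA4 = wkA[of "[_, _, _, _]", unfolded append_Cons append_Nil]
    and wkA8 = wkA[of "[_, _, _, _, _, _, _, _]", unfolded append_Cons append_Nil]
  have "S; (Run, Const Nat) # \<Gamma> \<turnstile>[Eras] vecT a (ren Suc A) (Var 0) \<Colon> Univ a"
    using wkA1[where k = 1] ctx_ok_Nat[OF ok] by (intro has_type_Vec has_type_var) auto
  then have "S \<turnstile> (Run, vecT a (ren Suc A) (Var 0)) # (Run, Const Nat) # \<Gamma> ok"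
    by (intro is_type_ctx is_typeI)
  then have M: "S; (Run, vecT a (ren Suc A) (Var 0)) # (Run, Const Nat) # \<Gamma> \<turnstile>[Eras] ?M \<Colon> Univ p"
    by (intro app_P2 has_type_var) (auto simp: eval_nat_numeral)
  have Tz: "S; (Run, idT lzero (ren Suc (Const Nat)) (ren Suc (Const Zero)) (Var 0)) # (Run, Const Nat) # nil_ctx \<Gamma> \<turnstile>[Eras]
      App Run (App Eras (wk 4 P) (Var 1)) (nilT a (wk 4 A) (Var 1) (Var 0)) \<Colon> Univ p"
  proof -
    have ok4: "S \<turnstile> (Run, idT lzero (Const Nat) (Const Zero) (Var 0)) # (Run, Const Nat) # nil_ctx \<Gamma> ok"
      using ok
      by (intro ctx_ok_Id has_type_Nat has_type_Zero has_type_var ctx_ok_Nat) auto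
    then show ?thesis unfolding ren.simps
      by (intro app_P4 has_type_nil has_type_var wkA4) (auto simp: eval_nat_numeral)
  qed
  have rz: "S; nil_ctx \<Gamma> \<turnstile>[\<sigma>] wk 2 z \<Colon>
      sub (case_nat (reflT lzero (Const Nat) (Const Zero)) (case_nat (Const Zero) Var))
        (App Run (App Eras (wk 4 P) (Var 1)) (nilT a (wk 4 A) (Var 1) (Var 0)))"
    using has_type_wk[OF z, of "[_, _]"] ctx_ok_nil[OF ok] by (simp add: eval_nat_numeral)
  note J_z = f has_type_Nat[OF ctx_ok_nil[OF ok]] has_type_Zero[OF ctx_ok_nil[OF ok]]
  have z': "S; nil_ctx \<Gamma> \<turnstile>[\<sigma>] ?z \<Colon> nil_motive a A ?M"
    using has_type_erasedJ[OF J_z Tz rz, of "Var 1" "Var 0"] ctx_ok_nil[OF ok]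
    by (simp add: has_type_var sub_normal)
  have ih: "S; cons_ctx a A \<Gamma> \<turnstile>[Eras] ih_motive ?M \<Colon> Univ p"
    using app_P5[where k = 5 and n = "Var 3" and xs = "Var 1"] ctx_ok_cons[OF A]
    by (simp add: has_type_var sub_normal)
  let ?\<Gamma> = "(Run, ih_motive ?M) # cons_ctx a A \<Gamma>"
  have ok6: "S \<turnstile> ?\<Gamma> ok" using ih by (intro is_type_ctx is_typeI)
  have suc: "S; ?\<Gamma> \<turnstile>[Eras] sucT (Var 4) \<Colon> Const Nat"
    using ok6 by (intro has_type_suc has_type_var) (auto simp: eval_nat_numeral)
  have Tc: "S; (Run, idT lzero (ren Suc (Const Nat)) (ren Suc (sucT (Var 4))) (Var 0)) # (Run, Const Nat) # ?\<Gamma> \<turnstile>[Eras]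
    App Run (App Eras (wk 8 P) (Var 1))
      (consT a (wk 8 A) (Var 1) (Var 6) (Var 5) (Var 4) (Var 0)) \<Colon> Univ p"
  proof -
    have "S \<turnstile> (Run, idT lzero (Const Nat) (sucT (Var (Suc 4))) (Var 0)) # (Run, Const Nat) # ?\<Gamma> ok"
      using ok6
      by (intro ctx_ok_Id has_type_Nat has_type_suc has_type_var ctx_ok_Nat) (auto simp: eval_nat_numeral)
    then show ?thesis unfolding ren.simps
      by (intro app_P8 has_type_cons has_type_var wkA8) (auto simp: sub_normal)
  qed
  have rc: "S; ?\<Gamma> \<turnstile>[\<sigma>] App Run (App Run (App Run (App Eras (wk 6 c) (Var 4)) (Var 3)) (Var 2)) (Var 0) \<Colon>
      sub (case_nat (reflT lzero (Const Nat) (sucT (Var 4))) (case_nat (sucT (Var 4)) Var))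
        (App Run (App Eras (wk 8 P) (Var 1))
          (consT a (wk 8 A) (Var 1) (Var 6) (Var 5) (Var 4) (Var 0)))"
  proof -
    have "S; ?\<Gamma> \<turnstile>[\<sigma>] wk 6 c \<Colon> wk 6 (stepT a A P)"
      using has_type_wk[OF c, of "[_, _, _, _, _, _]", unfolded append_Cons append_Nil, OF ok6]
      by (simp add: eval_nat_numeral)
    then have "S; ?\<Gamma> \<turnstile>[\<sigma>] wk 6 c \<Colon> stepT a (wk 6 A) (wk 6 P)" unfolding wk_stepT .
    from ty_app[OF has_type_step[OF this, of "Var 4" "Var 3" "Var 2"], of "Var 0"]
    show ?thesis using ok6 by (simp add: has_type_var sub_normal inst_def)
  qed
  note J_c = f has_type_Nat[OF ok6] suc
  have c': "S; ?\<Gamma> \<turnstile>[\<sigma>] ?c \<Colon> cons_motive a A ?M"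
    using has_type_erasedJ[OF J_c Tc rc, of "Var 5" "Var 1"] ok6
    by (simp add: has_type_var sub_normal)
  show elim: "S; \<Gamma> \<turnstile>[\<sigma>] vecElim' a p f A P z c n xs \<Colon> App Run (App Eras P n) xs"
    if "S; \<Gamma> \<turnstile>[Eras] n \<Colon> Const Nat" "S; \<Gamma> \<turnstile>[\<sigma>] xs \<Colon> vecT a A n" for n xs
    using has_type_VecElim_body[OF A M z' c' that] by (simp add: sub_normal)
  show "S; \<Gamma> \<turnstile> vecElim' a p f A P z c (Const Zero) (emptyT a A) \<doteq> z
        \<Colon> App Run (App Eras P (Const Zero)) (emptyT a A)"
    if comp: "box_cong_comp S (lsuc p) f"
  proof -
    let ?T = "App Run (App Eras (wk 2 P) (Var 1)) (nilT a (wk 2 A) (Var 1) (Var 0))"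
    note Zero = has_type_Zero[OF ok] and Nat = has_type_Nat[OF ok]
    have "S \<turnstile> (Run, idT lzero (Const Nat) (Const Zero) (Var 0)) # (Run, Const Nat) # \<Gamma> ok"
      using ok by (intro ctx_ok_Id has_type_Nat has_type_Zero has_type_var ctx_ok_Nat) auto
    then have T: "S; (Run, idT lzero (ren Suc (Const Nat)) (ren Suc (Const Zero)) (Var 0)) #
        (Run, Const Nat) # \<Gamma> \<turnstile>[Eras] ?T \<Colon> Univ p"
      unfolding ren.simps
      by (intro app_P2 has_type_nil has_type_var wkA2) (auto simp: eval_nat_numeral)
    have r: "S; \<Gamma> \<turnstile>[\<sigma>] z \<Colon> sub (case_nat (reflT lzero (Const Nat) (Const Zero))
        (case_nat (Const Zero) Var)) ?T"
      using z by (simp add: eval_nat_numeral)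
    have "S; \<Gamma> \<turnstile> vecElim' a p f A P z c (Const Zero) (emptyT a A) \<doteq>
        erasedJ lzero p f (Const Nat) (Const Zero) ?T z (Const Zero) (reflT lzero (Const Nat) (Const Zero))
        \<Colon> App Run (App Eras P (Const Zero)) (emptyT a A)"
      using VecElim_body_nil[OF A M z' c' Zero has_type_refl[OF Nat Zero]]
      by (simp add: sub_erasedJ closed sub_normal)
    moreover have "S; \<Gamma> \<turnstile> erasedJ lzero p f (Const Nat) (Const Zero) ?T z (Const Zero)
        (reflT lzero (Const Nat) (Const Zero)) \<doteq> z \<Colon> App Run (App Eras P (Const Zero)) (emptyT a A)"
      using erasedJ_refl[OF f Nat Zero T r comp] by (simp add: eval_nat_numeral)
    ultimately show ?thesis by (rule eq_trans)
  qed
  show "S; \<Gamma> \<turnstile> vecElim' a p f A P z c (sucT n) (pushT a A n x xs) \<doteq>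
        App Run (App Run (App Run (App Eras c n) x) xs) (vecElim' a p f A P z c n xs)
        \<Colon> App Run (App Eras P (sucT n)) (pushT a A n x xs)"
    if comp: "box_cong_comp S (lsuc p) f" and n: "S; \<Gamma> \<turnstile>[Eras] n \<Colon> Const Nat"
      and x: "S; \<Gamma> \<turnstile>[Eras] x \<Colon> A" and xs: "S; \<Gamma> \<turnstile>[Eras] xs \<Colon> vecT a A n"
  proof -
    \<comment> \<open>This is the motive of \<open>cons_case\<close> after the variables of the
      branch have been instantiated. Only the endpoint and the proof remain bound, which explains
      \<open>wk 2\<close>.\<close>
    let ?T = "App Run (App Eras (wk 2 P) (Var 1))
      (consT a (wk 2 A) (Var 1) (wk 2 n) (wk 2 x) (wk 2 xs) (Var 0))"
    let ?r = "App Run (App Run (App Run (App Eras c n) x) xs) (vecElim' a p f A P z c n xs)"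
    note Nat = has_type_Nat[OF ok] and suc = has_type_suc[OF n]
    have ok2: "S \<turnstile> (Run, idT lzero (Const Nat) (ren Suc (sucT n)) (Var 0)) # (Run, Const Nat) # \<Gamma> ok"
      using ok weaken[OF ctx_ok_Nat[OF ok] suc]
      by (intro ctx_ok_Id has_type_Nat has_type_var ctx_ok_Nat) auto
    then have T: "S; (Run, idT lzero (ren Suc (Const Nat)) (ren Suc (sucT n)) (Var 0)) #
        (Run, Const Nat) # \<Gamma> \<turnstile>[Eras] ?T \<Colon> Univ p"
      using has_type_wk[OF n, of "[_, _]"] has_type_wk[OF x, of "[_, _]"] has_type_wk[OF xs, of "[_, _]"]
      unfolding ren.simps
      by (intro app_P2 has_type_cons has_type_var wkA2) (auto simp: eval_nat_numeral)
    have r: "S; \<Gamma> \<turnstile>[Eras] ?r \<Colon> sub (case_nat (reflT lzero (Const Nat) (sucT n))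
        (case_nat (sucT n) Var)) ?T"
      using ty_app[OF has_type_step[OF erase[OF c] n x xs], of "vecElim' a p f A P z c n xs"]
        has_type_VecElim_body[OF A M erase[OF z'] erase[OF c'] n xs]
      by (simp add: inst_def sub_normal)
    have "S; \<Gamma> \<turnstile> vecElim' a p f A P z c (sucT n) (pushT a A n x xs) \<doteq>
        erasedJ lzero p f (Const Nat) (sucT n) ?T ?r (sucT n) (reflT lzero (Const Nat) (sucT n))
        \<Colon> App Run (App Eras P (sucT n)) (pushT a A n x xs)"
      using VecElim_body_cons[OF A M z' c' suc n x xs has_type_refl[OF Nat suc]]
      by (simp add: sub_erasedJ closed sub_normal)
    moreover have "S; \<Gamma> \<turnstile> erasedJ lzero p f (Const Nat) (sucT n) ?T ?r (sucT n)
        (reflT lzero (Const Nat) (sucT n)) \<doteq> ?r \<Colon> App Run (App Eras P (sucT n)) (pushT a A n x xs)"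
      using erasedJ_refl[OF f Nat suc T r comp] by (simp add: eval_nat_numeral)
    ultimately show ?thesis by (rule eq_trans)
  qed
qed

section \<open>The two constructions\<close>

definition vecElim'_fun :: "level \<Rightarrow> level \<Rightarrow> 'k tm \<Rightarrow> 'k tm" where
  "vecElim'_fun a p f = Lam Eras (Lam Run (Lam Run (Lam Run (Lam Eras (Lam Run
    (vecElim' a p f (Var 5) (Var 4) (Var 3) (Var 2) (Var 1) (Var 0)))))))"

abbreviation "ctx1 a \<equiv> [(Eras, Univ a)]"
abbreviation "ctx2 a p \<equiv> (Run, motiveT a p (Var 0)) # ctx1 a"
abbreviation "ctx3 a p \<equiv> (Run, App Run (App Eras (Var 0) (Const Zero)) (emptyT a (Var 1))) # ctx2 a p"
abbreviation "ctx4 a p \<equiv> (Run, stepT a (Var 2) (Var 1)) # ctx3 a p"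

lemma ctx4_ok: "S \<turnstile> ctx4 a p ok"
proof -
  have "S \<turnstile> ctx1 a ok" by (intro is_type_ctx is_type_Univ ctx_empty)
  moreover from this have "S \<turnstile> ctx2 a p ok"
    by (intro is_type_ctx) (rule is_type_Pi is_type_Univ | assumption
      | rule is_typeI, rule has_type_Nat has_type_Vec
      | rule has_type_Nat has_type_var | simp add: inst_def eval_nat_numeral)+
  moreover from this have "S \<turnstile> ctx3 a p ok"
    by (intro is_type_ctx) (rule is_typeI, rule has_type_app2
      | rule has_type_Nat has_type_Zero has_type_nil has_type_refl has_type_var | assumption
      | simp add: inst_def eval_nat_numeral)+
  moreover from this show "S \<turnstile> ctx4 a p ok"
    by (intro is_type_ctx) (rule is_type_Pi | assumption
      | rule is_typeI, rule has_type_Nat has_type_Vec has_type_app2 has_type_var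
      | rule has_type_Nat has_type_suc has_type_cons has_type_refl has_type_var
      | simp add: inst_def eval_nat_numeral)+
qed

abbreviation "ctx6 a p \<equiv> (Run, vecT a (Var 4) (Var 0)) # (Eras, Const Nat) # ctx4 a p"

lemma ctx6_ok: "S \<turnstile> ctx6 a p ok"
proof -
  have "S \<turnstile> (Eras, Const Nat) # ctx4 a p ok" using ctx4_ok by (rule ctx_ok_Nat)
  then have "S; (Eras, Const Nat) # ctx4 a p \<turnstile>[Eras] vecT a (Var 4) (Var 0) \<Colon> Univ a"
    by (intro has_type_Vec has_type_var) (auto simp: eval_nat_numeral)
  then show ?thesis by (intro is_type_ctx is_typeI)
qed

lemma has_type_vecElim'_body:
  assumes f: "S; [] \<turnstile>[Run] f \<Colon> box_cong_type (lsuc p)"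
  shows "S; ctx6 a p \<turnstile>[Run] vecElim' a p f (Var 5) (Var 4) (Var 3) (Var 2) (Var 1) (Var 0)
    \<Colon> App Run (App Eras (Var 4) (Var 1)) (Var 0)"
  by (rule has_type_vecElim'[OF f])
    (use ctx6_ok in \<open>auto intro!: has_type_var simp: eval_nat_numeral\<close>)

abbreviation "vec_elim'T a p \<equiv> Pi Eras (Univ a) (Pi Run (motiveT a p (Var 0))
  (Pi Run (App Run (App Eras (Var 0) (Const Zero)) (emptyT a (Var 1)))
  (Pi Run (stepT a (Var 2) (Var 1)) (Pi Eras (Const Nat) (Pi Run (vecT a (Var 4) (Var 0))
  (App Run (App Eras (Var 4) (Var 1)) (Var 0)))))))"

lemma vec_elim'_type_eq: "vec_elim'_type a p = vec_elim'T a p"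
  by (simp add: vec_elim'_type_def motive_type_def step_type_def named_defs eval_nat_numeral)

lemma has_type_vecElim'_fun:
  assumes f: "S; [] \<turnstile>[Run] f \<Colon> box_cong_type (lsuc p)"
  shows "S; [] \<turnstile>[Run] vecElim'_fun a p f \<Colon> vec_elim'T a p"
  unfolding vecElim'_fun_def by (intro ty_lam has_type_vecElim'_body f)

lemma vecElim'_fun_app:
  assumes f: "S; [] \<turnstile>[Run] f \<Colon> box_cong_type (lsuc p)"
    and A: "S; \<Gamma> \<turnstile>[Eras] A \<Colon> Univ a" and P: "S; \<Gamma> \<turnstile>[Eras] P \<Colon> motiveT a p A"
    and z: "S; \<Gamma> \<turnstile>[Eras] z \<Colon> App Run (App Eras P (Const Zero)) (emptyT a A)"
    and c: "S; \<Gamma> \<turnstile>[Eras] c \<Colon> stepT a A P"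
    and n: "S; \<Gamma> \<turnstile>[Eras] n \<Colon> Const Nat" and xs: "S; \<Gamma> \<turnstile>[Eras] xs \<Colon> vecT a A n"
  shows "S; \<Gamma> \<turnstile> App Run (App Eras (App Run (App Run (App Run (App Eras (vecElim'_fun a p f) A) P) z) c) n) xs
    \<doteq> vecElim' a p f A P z c n xs \<Colon> App Run (App Eras P n) xs"
proof -
  have closed: "scoped 0 f" using f by (rule has_type_closed)
  have ok: "S \<turnstile> \<Gamma> ok" using A by (rule has_type_ctx)
  note b6 = erase[OF has_type_vecElim'_body[OF f, of a]]
  note b5 = ty_lam[OF b6]
  note b4 = ty_lam[OF b5]
  note b3 = ty_lam[OF b4]
  note b2 = ty_lam[OF b3]
  note b1 = ty_lam[OF b2]
  \<comment> \<open>The function is closed, so the accumulated substitution starts from the empty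
    context and has to type the six arguments only.\<close>
  note s0 = substs_Nil[of S Eras \<Gamma> Var]
  have u1: "S; \<Gamma> \<turnstile>[Eras] A \<Colon> sub Var (Univ a)" using A by simp
  note s1 = substs_Cons[OF s0, where \<rho> = Eras, unfolded arg_mode_simps, OF u1]
  have u2: "S; \<Gamma> \<turnstile>[Eras] P \<Colon> sub (case_nat A Var) (motiveT a p (Var 0))"
    using P by simp
  note s2 = substs_Cons[OF s1, where \<rho> = Run, unfolded arg_mode_simps, OF u2]
  have u3: "S; \<Gamma> \<turnstile>[Eras] z \<Colon> sub (case_nat P (case_nat A Var))
      (App Run (App Eras (Var 0) (Const Zero)) (emptyT a (Var 1)))"
    using z by simp
  note s3 = substs_Cons[OF s2, where \<rho> = Run, unfolded arg_mode_simps, OF u3]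
  have u4: "S; \<Gamma> \<turnstile>[Eras] c \<Colon> sub (case_nat z (case_nat P (case_nat A Var))) (stepT a (Var 2) (Var 1))"
    using c by (simp add: eval_nat_numeral)
  note s4 = substs_Cons[OF s3, where \<rho> = Run, unfolded arg_mode_simps, OF u4]
  have u5: "S; \<Gamma> \<turnstile>[Eras] n \<Colon> sub (case_nat c (case_nat z (case_nat P (case_nat A Var)))) (Const Nat)"
    using n by simp
  note s5 = substs_Cons[OF s4, where \<rho> = Eras, unfolded arg_mode_simps, OF u5]
  have u6: "S; \<Gamma> \<turnstile>[Eras] xs \<Colon> sub (case_nat n (case_nat c (case_nat z (case_nat P (case_nat A Var)))))
      (vecT a (Var 4) (Var 0))"
    using xs by (simp add: eval_nat_numeral)
  have "S; \<Gamma> \<turnstile> vecElim'_fun a p f \<doteq> sub Var (vecElim'_fun a p f) \<Colon> sub Var (vec_elim'T a p)"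
    using eq_refl[OF erase[OF weaken_closed[OF has_type_vecElim'_fun[OF f] ok]]] unfolding sub_Var .
  note r1 = beta_step[OF s0 b1 this[unfolded vecElim'_fun_def] u1]
  note r2 = beta_step[OF s1 b2 r1 u2]
  note r3 = beta_step[OF s2 b3 r2 u3]
  note r4 = beta_step[OF s3 b4 r3 u4]
  note r5 = beta_step[OF s4 b5 r4 u5]
  note r6 = beta_step[OF s5 b6 r5 u6]
  show ?thesis using r6 unfolding vecElim'_fun_def by (simp add: sub_erasedJ closed sub_closed eval_nat_numeral)
qed

lemma box_cong_imp_vec_elim':
  assumes f: "S; [] \<turnstile>[Run] f \<Colon> box_cong_type (lsuc p)" and comp: "box_cong_comp S (lsuc p) f"
  shows "S; [] \<turnstile>[Run] vecElim'_fun a p f \<Colon> vec_elim'_type a p"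
    and "vec_elim'_comp_empty S a p (vecElim'_fun a p f)"
    and "vec_elim'_comp_push S a p (vecElim'_fun a p f)"
proof -
  let ?F = "vecElim'_fun a p f"
  show F: "S; [] \<turnstile>[Run] ?F \<Colon> vec_elim'_type a p"
    unfolding vec_elim'_type_eq using f by (rule has_type_vecElim'_fun)
  have closed: "scoped 0 ?F" using F by (rule has_type_closed)
  have A: "S; ctx4 a p \<turnstile>[Eras] Var 3 \<Colon> Univ a" and P: "S; ctx4 a p \<turnstile>[Eras] Var 2 \<Colon> motiveT a p (Var 3)"
    and z: "S; ctx4 a p \<turnstile>[Eras] Var 1 \<Colon> App Run (App Eras (Var 2) (Const Zero)) (emptyT a (Var 3))"
    and c: "S; ctx4 a p \<turnstile>[Eras] Var 0 \<Colon> stepT a (Var 3) (Var 2)"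
    using ctx4_ok by (auto intro!: has_type_var simp: eval_nat_numeral)
  note ok = has_type_ctx[OF A]
  note empty = has_type_nil[OF A has_type_Zero[OF ok] has_type_refl[OF has_type_Nat[OF ok] has_type_Zero[OF ok]]]
  from eq_trans[OF vecElim'_fun_app[OF f A P z c has_type_Zero[OF ok] empty] vecElim'_empty[OF f A P z c comp]]
  show "vec_elim'_comp_empty S a p ?F"
    by (simp add: vec_elim'_comp_empty_def assuming_def equal_def closed_def ren_closed closed
        motive_type_def step_type_def named_defs eval_nat_numeral)
  let ?\<Gamma> = "(Run, vecT a (Var 5) (Var 1)) # (Run, Var 4) # (Eras, Const Nat) # ctx4 a p"
  have "S; (Eras, Const Nat) # ctx4 a p \<turnstile>[Eras] Var 4 \<Colon> Univ a"
    using ctx_ok_Nat[OF ok] by (intro has_type_var) (auto simp: eval_nat_numeral)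
  then have "S \<turnstile> (Run, Var 4) # (Eras, Const Nat) # ctx4 a p ok"
    by (intro is_type_ctx is_typeI)
  then have "S; (Run, Var 4) # (Eras, Const Nat) # ctx4 a p \<turnstile>[Eras] vecT a (Var 5) (Var 1) \<Colon> Univ a"
    by (intro has_type_Vec has_type_var) (auto simp: eval_nat_numeral)
  then have ok: "S \<turnstile> ?\<Gamma> ok" by (intro is_type_ctx is_typeI)
  then have A: "S; ?\<Gamma> \<turnstile>[Eras] Var 6 \<Colon> Univ a" and P: "S; ?\<Gamma> \<turnstile>[Eras] Var 5 \<Colon> motiveT a p (Var 6)"
    and z: "S; ?\<Gamma> \<turnstile>[Eras] Var 4 \<Colon> App Run (App Eras (Var 5) (Const Zero)) (emptyT a (Var 6))"
    and c: "S; ?\<Gamma> \<turnstile>[Eras] Var 3 \<Colon> stepT a (Var 6) (Var 5)" and n: "S; ?\<Gamma> \<turnstile>[Eras] Var 2 \<Colon> Const Nat"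
    and x: "S; ?\<Gamma> \<turnstile>[Eras] Var 1 \<Colon> Var 6" and xs: "S; ?\<Gamma> \<turnstile>[Eras] Var 0 \<Colon> vecT a (Var 6) (Var 2)"
    by (auto intro!: has_type_var simp: eval_nat_numeral)
  note push = has_type_cons[OF A has_type_suc[OF n] n x xs
      has_type_refl[OF has_type_Nat[OF ok] has_type_suc[OF n]]]
  \<comment> \<open>\<open>vecElim'_push\<close> leaves the recursive call in contracted form; it is
    folded back into an application of the function itself, as the rule demands.\<close>
  note step = eq_app[OF eq_refl[OF has_type_step[OF c n x xs]] eq_sym[OF vecElim'_fun_app[OF f A P z c n xs]]]
  from eq_trans[OF eq_trans[OF vecElim'_fun_app[OF f A P z c has_type_suc[OF n] push]
      vecElim'_push[OF f A P z c comp n x xs]]] step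
  show "vec_elim'_comp_push S a p ?F"
    by (simp add: vec_elim'_comp_push_def assuming_def equal_def closed_def ren_closed closed
        motive_type_def step_type_def named_defs inst_def eval_nat_numeral)
qed

text \<open>
  The index of \<open>family\<close> is erased, but \<open>family\<close> can be used at run time because the index only
  occurs below \<open>[_]\<close>.
\<close>

abbreviation "cong_type n \<equiv> idT lzero (erasedT lzero (Const Nat)) (boxT lzero (Const Nat) (Const Zero))
  (boxT lzero (Const Nat) n)"

text \<open>A large elimination: its motive is constantly the universe \<open>Univ lzero\<close>,
  hence the level \<open>lsuc lzero\<close>. \<open>Nat\<close> serves as the inhabited type at
  \<open>cons\<close>.\<close>

abbreviation "family_at n xs \<equiv>
  vecElimB lzero (lsuc lzero) (Const Nat) (Univ lzero) (cong_type (Var 1)) (Const Nat) n xs"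

definition family :: "'k tm" where
  "family = Lam Eras (Lam Run (family_at (Var 1) (Var 0)))"

lemma
  assumes ok: "S \<turnstile> \<Gamma> ok"
  shows has_type_family_at: "S; \<Gamma> \<turnstile>[Eras] n \<Colon> Const Nat \<Longrightarrow>
      S; \<Gamma> \<turnstile>[\<sigma>] xs \<Colon> vecT lzero (Const Nat) n \<Longrightarrow> S; \<Gamma> \<turnstile>[\<sigma>] family_at n xs \<Colon> Univ lzero"
    and family_at_nil: "S; \<Gamma> \<turnstile>[Eras] n \<Colon> Const Nat \<Longrightarrow>
      S; \<Gamma> \<turnstile>[Eras] e \<Colon> idT lzero (Const Nat) (Const Zero) n \<Longrightarrow>
      S; \<Gamma> \<turnstile> family_at n (nilT lzero (Const Nat) n e) \<doteq> cong_type n \<Colon> Univ lzero"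
    and family_at_cons: "S; \<Gamma> \<turnstile>[Eras] n \<Colon> Const Nat \<Longrightarrow> S; \<Gamma> \<turnstile>[Eras] m \<Colon> Const Nat \<Longrightarrow>
      S; \<Gamma> \<turnstile>[Eras] x \<Colon> Const Nat \<Longrightarrow> S; \<Gamma> \<turnstile>[Eras] xs \<Colon> vecT lzero (Const Nat) m \<Longrightarrow>
      S; \<Gamma> \<turnstile>[Eras] e \<Colon> idT lzero (Const Nat) (sucT m) n \<Longrightarrow>
      S; \<Gamma> \<turnstile> family_at n (consT lzero (Const Nat) n m x xs e) \<doteq> Const Nat \<Colon> Univ lzero"
proof -
  note Nat = has_type_Nat[OF ok]
  have "S; (Run, Const Nat) # \<Gamma> \<turnstile>[Eras] vecT lzero (Const Nat) (Var 0) \<Colon> Univ lzero"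
    using ctx_ok_Nat[OF ok] by (intro has_type_Vec has_type_Nat has_type_var) auto
  then have "S \<turnstile> (Run, vecT lzero (ren Suc (Const Nat)) (Var 0)) # (Run, Const Nat) # \<Gamma> ok"
    unfolding ren.simps by (intro is_type_ctx is_typeI)
  then have M: "S; (Run, vecT lzero (ren Suc (Const Nat)) (Var 0)) # (Run, Const Nat) # \<Gamma> \<turnstile>[Eras]
      Univ lzero \<Colon> Univ (lsuc lzero)"
    by (rule ty_univ)
  have z: "S; nil_ctx \<Gamma> \<turnstile>[\<sigma>] cong_type (Var 1) \<Colon> nil_motive lzero (Const Nat) (Univ lzero)" for \<sigma>
    unfolding sub.simps using ctx_ok_nil[OF ok]
    by (intro has_type_Id has_type_Erased has_type_box has_type_Nat has_type_Zero has_type_var) auto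
  have "S \<turnstile> (Run, ih_motive (Univ lzero)) # cons_ctx lzero (Const Nat) \<Gamma> ok"
    unfolding sub.simps by (intro is_type_ctx is_type_Univ ctx_ok_cons Nat)
  then have c: "S; (Run, ih_motive (Univ lzero)) # cons_ctx lzero (Const Nat) \<Gamma> \<turnstile>[\<sigma>]
      Const Nat \<Colon> cons_motive lzero (Const Nat) (Univ lzero)" for \<sigma>
    unfolding sub.simps by (rule has_type_Nat)
  show "S; \<Gamma> \<turnstile>[\<sigma>] family_at n xs \<Colon> Univ lzero"
    if "S; \<Gamma> \<turnstile>[Eras] n \<Colon> Const Nat" "S; \<Gamma> \<turnstile>[\<sigma>] xs \<Colon> vecT lzero (Const Nat) n"
    using has_type_VecElim_body[OF Nat M z c that] unfolding sub.simps .
  show "S; \<Gamma> \<turnstile> family_at n (nilT lzero (Const Nat) n e) \<doteq> cong_type n \<Colon> Univ lzero"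
    if "S; \<Gamma> \<turnstile>[Eras] n \<Colon> Const Nat" "S; \<Gamma> \<turnstile>[Eras] e \<Colon> idT lzero (Const Nat) (Const Zero) n"
    using VecElim_body_nil[OF Nat M z c that] by simp
  show "S; \<Gamma> \<turnstile> family_at n (consT lzero (Const Nat) n m x xs e) \<doteq> Const Nat \<Colon> Univ lzero"
    if "S; \<Gamma> \<turnstile>[Eras] n \<Colon> Const Nat" "S; \<Gamma> \<turnstile>[Eras] m \<Colon> Const Nat" "S; \<Gamma> \<turnstile>[Eras] x \<Colon> Const Nat"
      "S; \<Gamma> \<turnstile>[Eras] xs \<Colon> vecT lzero (Const Nat) m" "S; \<Gamma> \<turnstile>[Eras] e \<Colon> idT lzero (Const Nat) (sucT m) n"
    using VecElim_body_cons[OF Nat M z c that] unfolding sub.simps .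
qed

lemma scoped_family: "scoped 0 family"
  by (simp add: family_def)

lemmas family_closed [simp] = sub_closed[OF scoped_family] ren_closed[OF scoped_family]
  wk_closed[OF scoped_family]

text \<open>The given eliminator takes its motive as a run-time argument, so the family must be
  typable in mode \<open>Run\<close> although its index is erased.\<close>

lemma
  assumes ok: "S \<turnstile> \<Gamma> ok"
  shows has_type_family: "S; \<Gamma> \<turnstile>[\<sigma>] family \<Colon> motiveT lzero lzero (Const Nat)"
    and family_app: "S; \<Gamma> \<turnstile>[Eras] n \<Colon> Const Nat \<Longrightarrow> S; \<Gamma> \<turnstile>[Eras] xs \<Colon> vecT lzero (Const Nat) n \<Longrightarrow>
      S; \<Gamma> \<turnstile> App Run (App Eras family n) xs \<doteq> family_at n xs \<Colon> Univ lzero"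
proof -
  have "S; (Eras, Const Nat) # \<Gamma> \<turnstile>[Eras] vecT lzero (Const Nat) (Var 0) \<Colon> Univ lzero"
    using ctx_ok_Nat[OF ok] by (intro has_type_Vec has_type_Nat has_type_var) auto
  then have "S \<turnstile> (Run, vecT lzero (Const Nat) (Var 0)) # (Eras, Const Nat) # \<Gamma> ok"
    by (intro is_type_ctx is_typeI)
  then have body: "S; (Run, vecT lzero (Const Nat) (Var 0)) # (Eras, Const Nat) # \<Gamma> \<turnstile>[\<sigma>]
      family_at (Var 1) (Var 0) \<Colon> Univ lzero" for \<sigma>
    by (intro has_type_family_at has_type_var) auto
  show "S; \<Gamma> \<turnstile>[\<sigma>] family \<Colon> motiveT lzero lzero (Const Nat)"
    unfolding family_def ren.simps by (intro ty_lam body)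
  show "S; \<Gamma> \<turnstile> App Run (App Eras family n) xs \<doteq> family_at n xs \<Colon> Univ lzero"
    if "S; \<Gamma> \<turnstile>[Eras] n \<Colon> Const Nat" "S; \<Gamma> \<turnstile>[Eras] xs \<Colon> vecT lzero (Const Nat) n"
    using beta2_Var[OF ok body, of n xs] that by (simp add: family_def)
qed

lemma box_cong\<^sub>0_type_eq: "box_cong\<^sub>0_type =
    Pi Eras (Const Nat) (Pi Eras (idT lzero (Const Nat) (Const Zero) (Var 0)) (cong_type (Var 1)))"
  by (simp add: box_cong\<^sub>0_type_def named_defs)

lemma vec_elim'_imp_box_cong\<^sub>0:
  assumes f: "S; [] \<turnstile>[Run] f \<Colon> vec_elim'_type lzero lzero"
  shows "\<exists>g. S; [] \<turnstile>[Run] g \<Colon> box_cong\<^sub>0_type"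
proof -
  let ?\<Gamma> = "nil_ctx []" and ?N = "Const Nat"
  have ok: "S \<turnstile> ?\<Gamma> ok" by (intro ctx_ok_nil ctx_empty)
  note Nat = has_type_Nat[OF ok] and Zero = has_type_Zero[OF ok]
  have n: "S; ?\<Gamma> \<turnstile>[Eras] Var 1 \<Colon> ?N" and e: "S; ?\<Gamma> \<turnstile>[Eras] Var 0 \<Colon> idT lzero ?N (Const Zero) (Var 1)"
    using ok by (auto intro!: has_type_var)
  have nil: "S; ?\<Gamma> \<turnstile>[\<sigma>] nilT lzero ?N (Var 1) (Var 0) \<Colon> vecT lzero ?N (Var 1)" for \<sigma>
    using Nat n e by (rule has_type_nil)
  note refl = has_type_refl[OF Nat Zero]
  have empty: "S; ?\<Gamma> \<turnstile>[\<sigma>] emptyT lzero ?N \<Colon> vecT lzero ?N (Const Zero)" for \<sigma>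
    using Nat Zero refl by (rule has_type_nil)
  let ?z = "reflT lzero (erasedT lzero ?N) (boxT lzero ?N (Const Zero))"
  have "S; ?\<Gamma> \<turnstile>[Run] ?z \<Colon> cong_type (Const Zero)"
    using has_type_refl[OF has_type_Erased[OF Nat] has_type_box[OF Nat Zero]] .
  \<comment> \<open>At the empty vector the family reduces to the identity of \<open>[zero]\<close>
    with itself, so \<open>refl\<close> is a proof.\<close>
  then have z: "S; ?\<Gamma> \<turnstile>[Run] ?z \<Colon> App Run (App Eras family (Const Zero)) (emptyT lzero ?N)"
    using eq_sym[OF eq_trans[OF family_app[OF ok Zero empty] family_at_nil[OF ok Zero refl]]]
    by (rule ty_conv)
  \<comment> \<open>At \<open>x :: xs\<close> the family reduces to \<open>Nat\<close>, so the case
    can be the constant \<open>zero\<close>.\<close>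
  let ?c = "Lam Eras (Lam Run (Lam Run (Lam Run (Const Zero))))"
  have c: "S; ?\<Gamma> \<turnstile>[Run] ?c \<Colon> stepT lzero ?N family"
  proof -
    have "S \<turnstile> (Run, ?N) # (Eras, ?N) # ?\<Gamma> ok" using ok by (intro ctx_ok_Nat)
    then have "S; (Run, ?N) # (Eras, ?N) # ?\<Gamma> \<turnstile>[Eras] vecT lzero ?N (Var 1) \<Colon> Univ lzero"
      by (intro has_type_Vec has_type_Nat has_type_var) auto
    then have ok3: "S \<turnstile> (Run, vecT lzero ?N (Var 1)) # (Run, ?N) # (Eras, ?N) # ?\<Gamma> ok"
      by (intro is_type_ctx is_typeI)
    have "S; (Run, vecT lzero ?N (Var 1)) # (Run, ?N) # (Eras, ?N) # ?\<Gamma> \<turnstile>[Eras]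
        App Run (App Eras family (Var 2)) (Var 0) \<Colon> Univ lzero"
      using ok3 by (intro has_type_app2[OF has_type_family[OF ok3]] has_type_var)
        (auto simp: inst_def eval_nat_numeral)
    then have ok4: "S \<turnstile> (Run, App Run (App Eras family (Var 2)) (Var 0)) #
        (Run, vecT lzero ?N (Var 1)) # (Run, ?N) # (Eras, ?N) # ?\<Gamma> ok" (is "S \<turnstile> ?\<Delta> ok")
      by (intro is_type_ctx is_typeI)
    then have n: "S; ?\<Delta> \<turnstile>[Eras] Var 3 \<Colon> ?N" and x: "S; ?\<Delta> \<turnstile>[Eras] Var 2 \<Colon> ?N"
      and xs: "S; ?\<Delta> \<turnstile>[Eras] Var 1 \<Colon> vecT lzero ?N (Var 3)"
      by (auto intro!: has_type_var simp: eval_nat_numeral)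
    note suc = has_type_suc[OF n]
    note refl = has_type_refl[OF has_type_Nat[OF ok4] suc]
    note push = has_type_cons[OF has_type_Nat[OF ok4] suc n x xs refl]
    have "S; ?\<Delta> \<turnstile>[Run] Const Zero \<Colon>
        App Run (App Eras family (sucT (Var 3))) (pushT lzero ?N (Var 3) (Var 2) (Var 1))"
      using has_type_Zero[OF ok4] eq_sym[OF eq_trans[OF family_app[OF ok4 suc push]
          family_at_cons[OF ok4 suc n x xs refl]]]
      by (rule ty_conv)
    then have "S; ?\<Gamma> \<turnstile>[Run] ?c \<Colon> Pi Eras ?N (Pi Run ?N (Pi Run (vecT lzero ?N (Var 1))
      (Pi Run (App Run (App Eras family (Var 2)) (Var 0))
      (App Run (App Eras family (sucT (Var 3))) (pushT lzero ?N (Var 3) (Var 2) (Var 1))))))"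
      by (intro ty_lam)
    then show ?thesis by (simp add: eval_nat_numeral)
  qed
  note app = has_type_app_sub[where \<sigma> = Run]
  have "S; ?\<Gamma> \<turnstile>[Run] f \<Colon> sub Var (vec_elim'T lzero lzero)"
    using weaken_closed[OF f ok] unfolding vec_elim'_type_eq sub_Var .
  note t1 = app[OF this, of ?N, simplified arg_mode_simps]
  note t2 = app[OF t1, of family, simplified arg_mode_simps]
  note t3 = app[OF t2, of ?z, simplified arg_mode_simps]
  note t4 = app[OF t3, of ?c, simplified arg_mode_simps]
  note t5 = app[OF t4, of "Var 1", simplified arg_mode_simps]
  note t6 = app[OF t5, of "nilT lzero ?N (Var 1) (Var 0)", simplified arg_mode_simps]
  \<comment> \<open>The erased proof enters here: \<open>nil\<close> takes it as an erased argument,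
    so \<open>nil e\<close> is a run-time vector of length \<open>n\<close> even though
    \<open>n\<close> and \<open>e\<close> are erased variables.\<close>
  let ?t = "App Run (App Eras (App Run (App Run (App Run (App Eras f ?N) family) ?z) ?c) (Var 1))
    (nilT lzero ?N (Var 1) (Var 0))"
  have "S; ?\<Gamma> \<turnstile>[Run] ?t \<Colon> App Run (App Eras family (Var 1)) (nilT lzero ?N (Var 1) (Var 0))"
    using t6 Nat has_type_family[OF ok, of Run] z c n nil[of Run]
    by (simp add: eval_nat_numeral)
  then have "S; ?\<Gamma> \<turnstile>[Run] ?t \<Colon> cong_type (Var 1)"
    using eq_trans[OF family_app[OF ok n nil] family_at_nil[OF ok n e]] by (rule ty_conv)
  then have "S; [] \<turnstile>[Run] Lam Eras (Lam Eras ?t) \<Colon> box_cong\<^sub>0_type"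
    unfolding box_cong\<^sub>0_type_eq by (intro ty_lam)
  then show ?thesis by blast
qed

theorem mainTheorem8:
  fixes S :: "'k extension"
  shows "((\<forall>a. \<exists>f. S; [] \<turnstile>[Run] f \<Colon> box_cong_type a \<and> box_cong_comp S a f) \<longrightarrow>
          (\<forall>a p. \<exists>f. S; [] \<turnstile>[Run] f \<Colon> vec_elim'_type a p \<and>
                     vec_elim'_comp_empty S a p f \<and> vec_elim'_comp_push S a p f))
       \<and> ((\<forall>a p. \<exists>f. S; [] \<turnstile>[Run] f \<Colon> vec_elim'_type a p) \<longrightarrow>
          (\<exists>f. S; [] \<turnstile>[Run] f \<Colon> box_cong\<^sub>0_type))"
proof (intro conjI impI allI)
  fix a p
  assume "\<forall>a. \<exists>f. S; [] \<turnstile>[Run] f \<Colon> box_cong_type a \<and> box_cong_comp S a f"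
  \<comment> \<open>The casts compare types of level \<open>p\<close>, so the instance at
    \<open>lsuc p\<close> is chosen whatever the level \<open>a\<close> of the element type
    is.\<close>
  then obtain f where "S; [] \<turnstile>[Run] f \<Colon> box_cong_type (lsuc p)" "box_cong_comp S (lsuc p) f"
    by blast
  from box_cong_imp_vec_elim'[OF this]
  show "\<exists>f. S; [] \<turnstile>[Run] f \<Colon> vec_elim'_type a p \<and>
      vec_elim'_comp_empty S a p f \<and> vec_elim'_comp_push S a p f"
    by blast
next
  assume "\<forall>a p. \<exists>f. S; [] \<turnstile>[Run] f \<Colon> vec_elim'_type a p"
  then show "\<exists>f. S; [] \<turnstile>[Run] f \<Colon> box_cong\<^sub>0_type"
    using vec_elim'_imp_box_cong\<^sub>0 by blast
qed

end
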